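(* Let $\{N(\omega,t),\boldsymbol{F}^N,\boldsymbol{P}\}$ be a Poisson process of rate $1$, where $\boldsymbol{F}^N$ is the natural filtration of $N$, and let $\lambda(\omega,t)$ be an $\boldsymbol{F}^N$-predictable process satisfying (A0)-(A4) listed in the context. Let $\boldsymbol{Q}$ be another probability measure such that $M(\lambda)$ is an $\boldsymbol{F}^N$-martingale under $\boldsymbol{Q}$. Then for all $t\in[0,\infty]$, $$\boldsymbol{Q}(d\omega)=\exp[\zeta_0^t(\lambda)(\omega)]\,\boldsymbol{P}(d\omega)\quad\text{on }\mathscr{F}^N_t.$$
   Context: $(\boldsymbol{\varOmega},\mathscr{F},\boldsymbol{P})$ is a probability space. $\boldsymbol{F}^N=\{\mathscr{F}^N_t:t\ge0\}$ with $\mathscr{F}^N_t=\sigma(N(\cdot,s):s\leq t)$, and $\mathscr{F}^N_\infty$ is the smallest $\sigma$-algebra containing all $\mathscr{F}^N_t$, $t\ge 0$. For a filtration $\boldsymbol{F}=\{\mathscr{F}_t\}$, $\{N(\omega,t),\boldsymbol{F},\boldsymbol{P}\}$ is a Poisson process of rate $\lambda_0>0$ if: (P0) $N$ is $\boldsymbol{F}$-adapted; and for fixed $\omega$ the path $t\mapsto N(\omega,t)$, $t\ge 0$, is (P1) right-continuous, (P2) non-decreasing, (P3) integer-valued, (P4) satisfies $N(\omega,0)=0$, (P5) has jumps $N(\omega,s)-N(\omega,s-)\in\{0,1\}$; and (P6) $\int \exp[iu(N(\omega,t)-N(\omega,s))]\boldsymbol{P}(d\omega)=\exp[\lambda_0(t-s)(e^{iu}-1)]$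 for $0\le s\le t$; (P7) $N_t-N_s$ is independent of $\mathscr{F}_s$ for $0\leq s\leq t$. A process is $\boldsymbol{F}$-predictable if it is jointly measurable with respect to the $\sigma$-algebra on $\boldsymbol{\varOmega}\times[0,\infty)$ generated by all left-continuous $\boldsymbol{F}$-adapted processes. Assumptions on $\lambda$ (here with $\boldsymbol{F}=\boldsymbol{F}^N$): (A0) $\lambda$ is $\boldsymbol{F}$-adapted; (A1) $\lambda(\omega,t)$ is jointly measurable in $(\omega,t)$; (A2) $\lambda(\omega,t)>0$ for all $\omega,t$; (A3) $\int_0^t\lambda(\omega,s)\,ds<\infty$ almost surely for each $t$; (A4) $\int_0^t\log\lambda(\omega,s)\,N(\omega,ds)$ exists almost surely for each $t$. Notation: $A(\lambda)(\omega,t)=\int_0^t\lambda(\omega,s)\,ds$, $M(\lambda)(\omega,t)=N(\omega,t)-A(\lambda)(\omega,t)$, and $$\zeta_s^t(\lambda)(\omega)=\int_s^t[1-\lambda(\omega,u)]\,du+\int_s^t\log\lambda(\omega,u)\,N(\omega,du).$$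
   Formalization: For t=∞ the claim fails as stated (λ=2, Q the rate-2 law: ζ_0^∞ is undefined, Q and P are singular); it is proved when ζ_0^t has a finite limit Q-a.s. as t→∞, with exp ζ_0^∞ read as the limit (lim inf) of exp ζ_0^t. *)

theory Defs
  imports "HOL-Probability.Probability"
begin

text \<open>
  A process is a function \<open>X \<omega> t\<close> of the sample point and of a real time; only the times
  \<open>t \<ge> 0\<close> matter. A filtration is a family of sub-sigma-algebras indexed in the same way.
\<close>

definition is_filtration :: "'a measure \<Rightarrow> (real \<Rightarrow> 'a measure) \<Rightarrow> bool" where
  "is_filtration P F \<longleftrightarrow>
     (\<forall>t\<ge>0. subalgebra P (F t)) \<and> (\<forall>s t. 0 \<le> s \<longrightarrow> s \<le> t \<longrightarrow> sets (F s) \<subseteq> sets (F t))"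

definition adapted :: "(real \<Rightarrow> 'a measure) \<Rightarrow> ('a \<Rightarrow> real \<Rightarrow> 'b::topological_space) \<Rightarrow> bool" where
  "adapted F X \<longleftrightarrow> (\<forall>t\<ge>0. (\<lambda>\<omega>. X \<omega> t) \<in> borel_measurable (F t))"

definition natural_filtration :: "'a set \<Rightarrow> ('a \<Rightarrow> real \<Rightarrow> real) \<Rightarrow> real \<Rightarrow> 'a measure" where
  "natural_filtration \<Omega> N t =
     sigma \<Omega> {(\<lambda>\<omega>. N \<omega> s) -` B \<inter> \<Omega> | s B. 0 \<le> s \<and> s \<le> t \<and> B \<in> sets borel}"

definition filtration_limit :: "'a set \<Rightarrow> (real \<Rightarrow> 'a measure) \<Rightarrow> 'a measure" where
  "filtration_limit \<Omega> F = sigma \<Omega> (\<Union>t\<in>{0..}. sets (F t))"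

definition poisson_process ::
  "'a measure \<Rightarrow> (real \<Rightarrow> 'a measure) \<Rightarrow> ('a \<Rightarrow> real \<Rightarrow> real) \<Rightarrow> real \<Rightarrow> bool" where
  "poisson_process P F N rate \<longleftrightarrow>
     rate > 0 \<and> prob_space P \<and> is_filtration P F \<and>
     adapted F N \<and>
     (\<forall>\<omega>\<in>space P.
        (\<forall>t\<ge>0. continuous (at_right t) (N \<omega>)) \<and>
        mono_on {0..} (N \<omega>) \<and>
        (\<forall>t\<ge>0. N \<omega> t \<in> \<int>) \<and>
        N \<omega> 0 = 0 \<and>
        (\<forall>s>0. N \<omega> s - Lim (at_left s) (N \<omega>) \<in> {0, 1})) \<and>
     (\<forall>s t u. 0 \<le> s \<longrightarrow> s \<le> t \<longrightarrow>
        (CLINT \<omega>|P. iexp (u * (N \<omega> t - N \<omega> s))) =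
          exp (complex_of_real (rate * (t - s)) * (iexp u - 1))) \<and>
     (\<forall>s t. 0 \<le> s \<longrightarrow> s \<le> t \<longrightarrow>
        prob_space.indep_set P
          (sets (vimage_algebra (space P) (\<lambda>\<omega>. N \<omega> t - N \<omega> s) borel)) (sets (F s)))"

definition left_continuous_paths :: "'a set \<Rightarrow> ('a \<Rightarrow> real \<Rightarrow> real) \<Rightarrow> bool" where
  "left_continuous_paths \<Omega> X \<longleftrightarrow> (\<forall>\<omega>\<in>\<Omega>. \<forall>t>0. continuous (at_left t) (X \<omega>))"

definition predictable_algebra :: "'a set \<Rightarrow> (real \<Rightarrow> 'a measure) \<Rightarrow> ('a \<times> real) measure" where
  "predictable_algebra \<Omega> F =
     sigma (\<Omega> \<times> {0..})
       {(\<lambda>(\<omega>, t). X \<omega> t) -` B \<inter> (\<Omega> \<times> {0..}) | X B.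
          left_continuous_paths \<Omega> X \<and> adapted F X \<and> B \<in> sets (borel :: real measure)}"

definition predictable :: "'a set \<Rightarrow> (real \<Rightarrow> 'a measure) \<Rightarrow> ('a \<Rightarrow> real \<Rightarrow> real) \<Rightarrow> bool" where
  "predictable \<Omega> F X \<longleftrightarrow> (\<lambda>(\<omega>, t). X \<omega> t) \<in> borel_measurable (predictable_algebra \<Omega> F)"

text \<open>
  The measure \<open>N(\<omega>, du)\<close>. The path is extended by its value at time \<open>0\<close> to negative times, as
  \<^const>\<open>interval_measure\<close> wants a function on the whole line; this puts no mass on \<open>{..0}\<close>.
  An integral from \<open>s\<close> to \<open>t\<close> against it is over \<open>{s<..t}\<close>, so that a jump at \<open>t\<close> counts
  and a jump at \<open>s\<close> does not.
\<close>

definition path_measure :: "('a \<Rightarrow> real \<Rightarrow> real) \<Rightarrow> 'a \<Rightarrow> real measure" where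
  "path_measure N \<omega> = interval_measure (\<lambda>u. N \<omega> (max 0 u))"

definition cumulative_intensity :: "('a \<Rightarrow> real \<Rightarrow> real) \<Rightarrow> 'a \<Rightarrow> real \<Rightarrow> ennreal" where
  "cumulative_intensity lam \<omega> t = (\<integral>\<^sup>+u\<in>{0..t}. ennreal (lam \<omega> u) \<partial>lborel)"

definition compensated ::
  "('a \<Rightarrow> real \<Rightarrow> real) \<Rightarrow> ('a \<Rightarrow> real \<Rightarrow> real) \<Rightarrow> 'a \<Rightarrow> real \<Rightarrow> ereal" where
  "compensated N lam \<omega> t = ereal (N \<omega> t) - enn2ereal (cumulative_intensity lam \<omega> t)"

definition zeta ::
  "('a \<Rightarrow> real \<Rightarrow> real) \<Rightarrow> ('a \<Rightarrow> real \<Rightarrow> real) \<Rightarrow> real \<Rightarrow> real \<Rightarrow> 'a \<Rightarrow> real" where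
  "zeta N lam s t \<omega> =
     (LINT u:{s<..t}|lborel. 1 - lam \<omega> u) + (LINT u:{s<..t}|path_measure N \<omega>. ln (lam \<omega> u))"

definition admissible_intensity ::
  "'a measure \<Rightarrow> (real \<Rightarrow> 'a measure) \<Rightarrow> ('a \<Rightarrow> real \<Rightarrow> real) \<Rightarrow> ('a \<Rightarrow> real \<Rightarrow> real) \<Rightarrow> bool" where
  "admissible_intensity P F N lam \<longleftrightarrow>
     adapted F lam \<and>
     (\<lambda>(\<omega>, t). lam \<omega> t) \<in> borel_measurable (P \<Otimes>\<^sub>M restrict_space borel {0..}) \<and>
     (\<forall>\<omega>\<in>space P. \<forall>t\<ge>0. lam \<omega> t > 0) \<and>
     (\<forall>t\<ge>0. AE \<omega> in P. cumulative_intensity lam \<omega> t < \<infinity>) \<and>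
     (\<forall>t\<ge>0. AE \<omega> in P. set_integrable (path_measure N \<omega>) {0<..t} (\<lambda>u. ln (lam \<omega> u)))"

text \<open>
  Martingales are allowed extended real values because \<open>A(\<lambda>)\<close> may be infinite at some sample
  points. The integrability condition makes \<open>X \<omega> t\<close> finite for almost every \<open>\<omega>\<close>, so passing
  to \<^const>\<open>real_of_ereal\<close> changes it only on a null set.
\<close>

definition martingale ::
  "'a measure \<Rightarrow> (real \<Rightarrow> 'a measure) \<Rightarrow> ('a \<Rightarrow> real \<Rightarrow> ereal) \<Rightarrow> bool" where
  "martingale Q F X \<longleftrightarrow>
     is_filtration Q F \<and> adapted F X \<and>
     (\<forall>t\<ge>0. (\<integral>\<^sup>+\<omega>. e2ennreal \<bar>X \<omega> t\<bar> \<partial>Q) < \<infinity>) \<and>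
     (\<forall>s t. 0 \<le> s \<longrightarrow> s \<le> t \<longrightarrow>
        (AE \<omega> in Q. real_cond_exp Q (F s) (\<lambda>\<omega>. real_of_ereal (X \<omega> t)) \<omega> =
                    real_of_ereal (X \<omega> s)))"

definition has_density_on ::
  "'a measure \<Rightarrow> 'a measure \<Rightarrow> ('a \<Rightarrow> ennreal) \<Rightarrow> 'a measure \<Rightarrow> bool" where
  "has_density_on Q P f G \<longleftrightarrow> (\<forall>A\<in>sets G. emeasure Q A = (\<integral>\<^sup>+\<omega>\<in>A. f \<omega> \<partial>P))"

text \<open>
  Over the infinite horizon the two integrals in \<^const>\<open>zeta\<close> may diverge separately, so the
  exponent is read as the limit of \<open>zeta N lam 0 t \<omega>\<close> as \<open>t\<close> tends to infinity, with \<open>exp (-\<infinity>) = 0\<close>.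
  The limit agrees with the sum of the two integrals over \<open>{0<..}\<close> wherever that sum makes sense.
  It need not exist with a finite value almost surely: for the constant intensity \<open>2\<close> the
  measures \<open>P\<close> and \<open>Q\<close> are mutually singular on the limit sigma-algebra. The predicate
  \<open>zeta_infinity_exists\<close> states that it does. It is equivalent to \<open>Q\<close> having any density at all
  with respect to \<open>P\<close> on the limit sigma-algebra.
\<close>

definition zeta_infinity_exists ::
  "'a measure \<Rightarrow> ('a \<Rightarrow> real \<Rightarrow> real) \<Rightarrow> ('a \<Rightarrow> real \<Rightarrow> real) \<Rightarrow> bool" where
  "zeta_infinity_exists Q N lam \<longleftrightarrow>
     (AE \<omega> in Q. \<exists>l::real. ((\<lambda>t. zeta N lam 0 t \<omega>) \<longlongrightarrow> l) at_top)"

definition exp_zeta_infinity ::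
  "('a \<Rightarrow> real \<Rightarrow> real) \<Rightarrow> ('a \<Rightarrow> real \<Rightarrow> real) \<Rightarrow> 'a \<Rightarrow> ennreal" where
  "exp_zeta_infinity N lam \<omega> = Liminf at_top (\<lambda>t. ennreal (exp (zeta N lam 0 t \<omega>)))"

end

theory Submission
  imports Defs
begin

text \<open>
  Write \<open>Z\<close> for the exponential of \<open>\<zeta>\<close> and \<open>\<tau> k\<close> for the \<open>k\<close>-th jump of \<open>N\<close>. The formula for \<open>Z\<close> says
  that between jumps it is multiplied by \<open>exp (\<integral> (1 - \<lambda>))\<close> and at a jump by \<open>\<lambda>\<close>. The proof of
  \<open>Q = Z P\<close> on the past of a fixed time \<open>T\<close> consists of two inequalities whose total masses match.

  The martingale hypothesis, for \<open>Q\<close> with intensity \<open>\<lambda>\<close> and for \<open>P\<close> with intensity \<open>1\<close>, is first brought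
  into the form
    \<open>E H(\<tau> (k+1)) = E \<integral> H \<lambda> dr\<close>, the integral being over the times between \<open>\<tau> k\<close> and \<open>\<tau> (k+1)\<close>,
  for predictable \<open>H \<ge> 0\<close> (lemma \<open>jump_compensator\<close>). Under \<open>Q\<close> the counting variable itself need not
  be integrable. The martingale is therefore stopped at jump times, where the count is bounded
  (lemma \<open>optional_stopping\<close>).

  First inequality: \<open>Z\<^sup>-\<^sup>1 Q \<le> P\<close> on the past of \<open>T\<close>. Let \<open>f\<close> be a function of the first \<open>k\<close> jump times, and
  integrate \<open>f / Z\<close> under \<open>Q\<close> over the paths with exactly \<open>k\<close> jumps up to \<open>u\<close>. Following the
  process from one jump to the next, where \<open>exp A\<close> with \<open>A = \<integral> \<lambda> dr\<close> solves a linear equation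
  (lemma \<open>expo_ftc\<close>), this expectation is bounded by an integral over the last jump time of
  the same expectation for \<open>k - 1\<close> jumps. At a jump the factor \<open>1/\<lambda>\<close> cancels the
  intensity, so \<open>\<lambda>\<close> disappears from the recursion. The measure \<open>P\<close> satisfies the same
  recursion with equality, which gives the comparison by induction on \<open>k\<close> (lemma \<open>slice_le\<close>). Since an
  event of the past of \<open>T\<close> is, on the paths with \<open>k\<close> jumps, an event for the first \<open>k\<close> jump
  times (lemma \<open>past_factors_through_jumps\<close>), the comparison holds for all events, hence also for
  all nonnegative functions, and so \<open>Q \<le> Z P\<close>.

  Second inequality: \<open>E\<^sub>P Z \<le> 1\<close>. Here the same one-jump estimate telescopes over the number
  of jumps (lemma \<open>likelihood_integral_le_1\<close>). As \<open>Q\<close> has mass one, \<open>Q \<le> Z P\<close> must be an equality.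

  For the infinite horizon, let \<open>E\<close> be the event that \<open>\<zeta>\<close> has no finite limit, which is null for \<open>Q\<close>.
  A maximal inequality shows that \<open>Z\<close> tends to \<open>0\<close> almost surely under \<open>P\<close> on \<open>E\<close>, so \<open>Z\<close>
  converges almost surely under both measures. Passing to the limit in
  \<open>E\<^sub>P (Z \<chi>(Z) 1\<^sub>A) = E\<^sub>Q (\<chi>(Z) 1\<^sub>A)\<close> for continuous cutoffs \<open>\<chi>\<close>, and then removing the cutoff,
  gives the density of \<open>Q\<close> on the limit sigma-algebra (theorem \<open>limit_density\<close>).
\<close>

section \<open>Counting paths and their jump times\<close>

locale counting_process =
  fixes M :: "'a measure" and N :: "'a \<Rightarrow> real \<Rightarrow> real" and T :: real
  assumes T_nonneg: "0 \<le> T"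
    and N_measurable: "\<And>t. 0 \<le> t \<Longrightarrow> (\<lambda>\<omega>. N \<omega> t) \<in> borel_measurable M"
    and right_cont: "\<And>\<omega> t. \<omega> \<in> space M \<Longrightarrow> 0 \<le> t \<Longrightarrow> continuous (at_right t) (N \<omega>)"
    and mono_path: "\<And>\<omega>. \<omega> \<in> space M \<Longrightarrow> mono_on {0..} (N \<omega>)"
    and int_valued: "\<And>\<omega> t. \<omega> \<in> space M \<Longrightarrow> 0 \<le> t \<Longrightarrow> N \<omega> t \<in> \<int>"
    and starts_at_0: "\<And>\<omega>. \<omega> \<in> space M \<Longrightarrow> N \<omega> 0 = 0"
    and unit_jumps: "\<And>\<omega> s. \<omega> \<in> space M \<Longrightarrow> 0 < s \<Longrightarrow> N \<omega> s - Lim (at_left s) (N \<omega>) \<in> {0, 1}"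
begin

abbreviation F :: "real \<Rightarrow> 'a measure" where "F \<equiv> natural_filtration (space M) N"

text \<open>
  The horizon \<open>T\<close> makes this a real number in all cases: a jump that has not occurred by time
  \<open>T\<close> is placed at \<open>T + 1\<close>.
\<close>

definition jump_time :: "nat \<Rightarrow> 'a \<Rightarrow> real" where
  "jump_time k \<omega> = Inf (insert (T + 1) {u. 0 \<le> u \<and> u \<le> T \<and> real k \<le> N \<omega> u})"

lemma N_mono: "\<omega> \<in> space M \<Longrightarrow> 0 \<le> s \<Longrightarrow> s \<le> t \<Longrightarrow> N \<omega> s \<le> N \<omega> t"
  using mono_path unfolding mono_on_def by auto

lemma N_nonneg: "\<omega> \<in> space M \<Longrightarrow> 0 \<le> t \<Longrightarrow> 0 \<le> N \<omega> t"
  using N_mono[of \<omega> 0 t] starts_at_0 by auto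

lemma N_nat:
  assumes "\<omega> \<in> space M" "0 \<le> t" obtains n :: nat where "N \<omega> t = real n"
  using int_valued[OF assms] N_nonneg[OF assms]
  by (metis Ints_cases of_int_0_le_iff of_nat_nat of_int_of_nat_eq zero_le_imp_eq_int)

lemma N_right_eventually_const:
  assumes w: "\<omega> \<in> space M" and t: "0 \<le> t"
  shows "eventually (\<lambda>u. N \<omega> u = N \<omega> t) (at_right t)"
proof -
  have "((N \<omega>) \<longlongrightarrow> N \<omega> t) (at_right t)"
    using right_cont[OF w t] by (simp add: continuous_within)
  then have "eventually (\<lambda>u. dist (N \<omega> u) (N \<omega> t) < 1) (at_right t)"
    by (rule tendstoD) simp
  moreover have "eventually (\<lambda>u. t < u) (at_right t)" by (rule eventually_at_right_less)
  ultimately show ?thesis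
  proof eventually_elim
    case (elim u)
    obtain a b :: int where "N \<omega> u = of_int a" "N \<omega> t = of_int b"
      using int_valued[OF w, of u] int_valued[OF w, of t] t elim by (auto elim!: Ints_cases)
    then show ?case using elim by (auto simp: dist_real_def)
  qed
qed

lemma N_left_eventually_const:
  assumes w: "\<omega> \<in> space M" and t: "0 < t"
  obtains r where "0 \<le> r" "r < t" "\<And>u. r \<le> u \<Longrightarrow> u < t \<Longrightarrow> N \<omega> u = Lim (at_left t) (N \<omega>)"
proof -
  \<comment> \<open>the largest value before \<open>t\<close>; the path keeps it from its first occurrence on\<close>
  define m where "m = (GREATEST n. \<exists>r. 0 \<le> r \<and> r < t \<and> N \<omega> r = real n)"
  obtain b where b: "N \<omega> t = real b" by (rule N_nat[OF w, of t]) (use t in auto)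
  have b_ge: "n \<le> b" if "0 \<le> r" "r < t" "N \<omega> r = real n" for n r
    using N_mono[OF w that(1), of t] that b by simp
  have ex: "\<exists>r. 0 \<le> r \<and> r < t \<and> N \<omega> r = real m" unfolding m_def
  proof (rule GreatestI_nat)
    show "\<exists>r. 0 \<le> r \<and> r < t \<and> N \<omega> r = real 0"
      using starts_at_0[OF w] t by (intro exI[of _ 0]) auto
    show "\<And>n. \<exists>r. 0 \<le> r \<and> r < t \<and> N \<omega> r = real n \<Longrightarrow> n \<le> b"
      using b_ge by auto
  qed
  have mx: "n \<le> m" if "\<exists>r. 0 \<le> r \<and> r < t \<and> N \<omega> r = real n" for n
    unfolding m_def using that
    by (rule Greatest_le_nat[where b = b]) (auto simp: b_ge)
  obtain r where r: "0 \<le> r" "r < t" "N \<omega> r = real m" using ex by auto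
  have c: "N \<omega> u = real m" if u: "r \<le> u" "u < t" for u
  proof -
    obtain n where n: "N \<omega> u = real n" by (rule N_nat[OF w order_trans[OF r(1) u(1)]])
    have "0 \<le> u" using that r by simp
    then have "n \<le> m" using mx[of n] n that by blast
    then show ?thesis using n N_mono[OF w r(1) that(1)] r by simp
  qed
  have "eventually (\<lambda>u. N \<omega> u = real m) (at_left t)"
    unfolding eventually_at_left_field using r c by (intro exI[of _ r]) auto
  then have "((N \<omega>) \<longlongrightarrow> real m) (at_left t)" by (rule tendsto_eventually)
  then have "Lim (at_left t) (N \<omega>) = real m" by (intro tendsto_Lim) auto
  with r c show ?thesis by (intro that[of r]) auto
qed

lemma jump_time_bounds: "0 \<le> jump_time k \<omega>" "jump_time k \<omega> \<le> T + 1"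
  unfolding jump_time_def using T_nonneg
  by (auto intro!: cInf_greatest cInf_lower bdd_belowI[of _ 0])

text \<open>
  By right continuity the infimum is attained, so the jump times and the path up to \<open>T\<close>
  determine each other.
\<close>

lemma jump_time_le_iff:
  assumes w: "\<omega> \<in> space M" and u: "0 \<le> u" "u \<le> T"
  shows "jump_time k \<omega> \<le> u \<longleftrightarrow> real k \<le> N \<omega> u"
proof
  assume "real k \<le> N \<omega> u"
  then show "jump_time k \<omega> \<le> u"
    unfolding jump_time_def using u T_nonneg by (intro cInf_lower bdd_belowI[of _ 0]) auto
next
  let ?S = "{u. 0 \<le> u \<and> u \<le> T \<and> real k \<le> N \<omega> u}"
  assume le: "jump_time k \<omega> \<le> u"
  have "eventually (\<lambda>v. real k \<le> N \<omega> v) (at_right u)"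
    unfolding eventually_at_right_field
  proof (intro exI[of _ "T+1"] conjI allI impI)
    show "u < T + 1" using u by simp
    fix v assume v: "u < v" "v < T + 1"
    have "Inf (insert (T + 1) ?S) < v" using le v unfolding jump_time_def by simp
    then obtain x where "x \<in> insert (T+1) ?S" "x < v" using cInf_lessD[of "insert (T + 1) ?S" v] by auto
    with v have "0 \<le> x" "real k \<le> N \<omega> x" "x \<le> v" by auto
    then show "real k \<le> N \<omega> v" using N_mono[OF w, of x v] by linarith
  qed
  with N_right_eventually_const[OF w u(1)]
  have "eventually (\<lambda>v. real k \<le> N \<omega> u) (at_right u)" by eventually_elim simp
  then show "real k \<le> N \<omega> u" by (simp add: trivial_limit_at_right_real)
qed

lemma jump_time_gt_T: "jump_time k \<omega> > T \<Longrightarrow> jump_time k \<omega> = T + 1"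
proof -
  assume *: "jump_time k \<omega> > T"
  let ?S = "{u. 0 \<le> u \<and> u \<le> T \<and> real k \<le> N \<omega> u}"
  have "?S = {}"
  proof (rule ccontr)
    assume "?S \<noteq> {}" then obtain x where x: "x \<in> ?S" by auto
    then have "jump_time k \<omega> \<le> x"
      unfolding jump_time_def using T_nonneg by (intro cInf_lower bdd_belowI[of _ 0]) auto
    with x * show False by auto
  qed
  then show ?thesis unfolding jump_time_def by (metis cInf_singleton)
qed

lemma jump_time_0: "\<omega> \<in> space M \<Longrightarrow> jump_time 0 \<omega> = 0"
  using jump_time_le_iff[of \<omega> 0 0] starts_at_0 T_nonneg jump_time_bounds(1)[of 0 \<omega>] by auto

lemma jump_time_pos: "\<omega> \<in> space M \<Longrightarrow> 0 < k \<Longrightarrow> 0 < jump_time k \<omega>"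
  using jump_time_le_iff[of \<omega> 0 k] starts_at_0 T_nonneg jump_time_bounds(1)[of k \<omega>]
  by (metis linorder_not_le of_nat_0_less_iff order_refl)

lemma jump_time_mono: "j \<le> k \<Longrightarrow> jump_time j \<omega> \<le> jump_time k \<omega>"
  unfolding jump_time_def using T_nonneg
  by (intro cInf_superset_mono) (auto intro!: bdd_belowI[of _ 0])

text \<open>
  Two levels reached at the same time would force a jump of size at least two.
\<close>

lemma jump_time_strict:
  assumes w: "\<omega> \<in> space M" and le: "jump_time k \<omega> \<le> T"
  shows "jump_time k \<omega> < jump_time (Suc k) \<omega>"
proof (rule ccontr)
  define a where "a = jump_time k \<omega>"
  assume "\<not> ?thesis"
  with jump_time_mono[of k "Suc k" \<omega>] have eq: "jump_time (Suc k) \<omega> = a" by (auto simp: a_def)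
  have a: "0 < a" "a \<le> T" using jump_time_pos[OF w, of "Suc k"] eq le by (auto simp: a_def)
  have Na: "real (Suc k) \<le> N \<omega> a" using jump_time_le_iff[OF w, of a "Suc k"] eq a by auto
  obtain r where r: "0 \<le> r" "r < a" "\<And>u. r \<le> u \<Longrightarrow> u < a \<Longrightarrow> N \<omega> u = Lim (at_left a) (N \<omega>)"
    using N_left_eventually_const[OF w a(1)] by blast
  have "N \<omega> r = Lim (at_left a) (N \<omega>)" using r by auto
  with unit_jumps[OF w a(1)] Na have "real k \<le> N \<omega> r" by auto
  then have "jump_time k \<omega> \<le> r" using jump_time_le_iff[OF w, of r k] r a by auto
  with r show False by (auto simp: a_def)
qed

lemma N_eq_iff:
  assumes w: "\<omega> \<in> space M" and u: "0 \<le> u" "u \<le> T"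
  shows "N \<omega> u = real k \<longleftrightarrow> jump_time k \<omega> \<le> u \<and> u < jump_time (Suc k) \<omega>"
proof -
  obtain n where "N \<omega> u = real n" using N_nat[OF w u(1)] .
  then show ?thesis
    using jump_time_le_iff[OF w u, of k] jump_time_le_iff[OF w u, of "Suc k"] by (auto simp flip: not_le)
qed

lemma space_F [simp]: "space (F t) = space M"
  unfolding natural_filtration_def by (simp add: space_measure_of_conv)

lemma sets_F: "sets (F t) = sigma_sets (space M)
   {(\<lambda>\<omega>. N \<omega> s) -` B \<inter> space M | s B. 0 \<le> s \<and> s \<le> t \<and> B \<in> sets borel}"
  unfolding natural_filtration_def by (rule sets_measure_of) auto

lemma N_F_measurable: "0 \<le> s \<Longrightarrow> s \<le> t \<Longrightarrow> (\<lambda>\<omega>. N \<omega> s) \<in> borel_measurable (F t)"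
  by (rule measurableI) (auto simp: sets_F intro!: sigma_sets.Basic)

lemma F_mono: "s \<le> t \<Longrightarrow> sets (F s) \<subseteq> sets (F t)"
  unfolding sets_F by (rule sigma_sets_mono') (blast intro: order_trans)

lemma F_sub_M: "sets (F t) \<subseteq> sets M"
  unfolding sets_F by (rule sets.sigma_sets_subset) (auto intro!: measurable_sets N_measurable)

lemma F_measurable_mono: "s \<le> t \<Longrightarrow> f \<in> measurable (F s) X \<Longrightarrow> f \<in> measurable (F t) X"
  using F_mono[of s t] by (auto simp: measurable_def)

lemma F_measurable_M: "f \<in> measurable (F s) X \<Longrightarrow> f \<in> measurable M X"
  using F_sub_M[of s] by (auto simp: measurable_def)

lemma jump_time_stopping: 
  assumes "0 \<le> u" shows "{\<omega>\<in>space M. jump_time k \<omega> \<le> u} \<in> sets (F u)"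
proof (cases "u \<le> T")
  case True
  have "{\<omega>\<in>space M. jump_time k \<omega> \<le> u} = {\<omega>\<in>space (F u). real k \<le> N \<omega> u}"
    using jump_time_le_iff assms True by auto
  also have "\<dots> \<in> sets (F u)"
    using N_F_measurable[of u u] assms by measurable
  finally show ?thesis .
next
  case False
  show ?thesis
  proof (cases "T + 1 \<le> u")
    case True
    then have "{\<omega>\<in>space M. jump_time k \<omega> \<le> u} = space (F u)"
      using jump_time_bounds(2)[of k] by (auto intro: order_trans)
    then show ?thesis by (metis sets.top)
  next
    case F: False
    have "jump_time k \<omega> \<le> u \<longleftrightarrow> real k \<le> N \<omega> T" if "\<omega> \<in> space M" for \<omega>
      using jump_time_le_iff[OF that T_nonneg, of k] jump_time_gt_T[of k \<omega>] False F by linarith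
    then have "{\<omega>\<in>space M. jump_time k \<omega> \<le> u} = {\<omega>\<in>space (F u). real k \<le> N \<omega> T}"
      by auto
    also have "\<dots> \<in> sets (F u)"
    proof -
      have [measurable]: "(\<lambda>\<omega>. N \<omega> T) \<in> borel_measurable (F u)"
        using False T_nonneg by (intro N_F_measurable) auto
      show ?thesis by measurable
    qed
    finally show ?thesis .
  qed
qed

lemma jump_time_stopping_gt:
  assumes "0 \<le> u" shows "{\<omega>\<in>space M. u < jump_time k \<omega>} \<in> sets (F u)"
proof -
  have "{\<omega>\<in>space M. u < jump_time k \<omega>} = space (F u) - {\<omega>\<in>space M. jump_time k \<omega> \<le> u}" by auto
  then show ?thesis using jump_time_stopping[OF assms, of k] by (metis sets.compl_sets)
qed

lemma jump_time_measurable_F: "jump_time k \<in> borel_measurable (F T)"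
proof (rule borel_measurableI_le)
  fix y
  show "{\<omega> \<in> space (F T). jump_time k \<omega> \<le> y} \<in> sets (F T)"
  proof (cases "0 \<le> y")
    case False
    then have "{\<omega> \<in> space (F T). jump_time k \<omega> \<le> y} = {}"
      using jump_time_bounds(1)[of k] by (auto simp: not_le) (smt (verit))
    then show ?thesis by (metis sets.empty_sets)
  next
    case y: True
    consider "y \<le> T" | "T < y" "y < T + 1" | "T + 1 \<le> y" by linarith
    then show ?thesis
    proof cases
      case 1
      then show ?thesis using jump_time_stopping[OF y, of k] F_mono[of y T] by auto
    next
      case 2
      then have "{\<omega> \<in> space (F T). jump_time k \<omega> \<le> y} = {\<omega>\<in>space M. jump_time k \<omega> \<le> T}"
        using jump_time_gt_T[of k] by (auto simp: not_le) (smt (verit))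
      then show ?thesis using jump_time_stopping[OF T_nonneg, of k] by simp
    next
      case 3
      then have "{\<omega> \<in> space (F T). jump_time k \<omega> \<le> y} = space (F T)"
        using jump_time_bounds(2)[of k] by (auto intro: order_trans)
      then show ?thesis by (metis sets.top)
    qed
  qed
qed

lemma jump_time_measurable: "jump_time k \<in> borel_measurable M"
  using jump_time_measurable_F by (rule F_measurable_M)

end

section \<open>The predictable sigma-algebra\<close>

context counting_process
begin

text \<open>
  Rectangles generate the predictable sigma-algebra and are stable under intersection, so that
  measures on it can be compared on them. Time runs over the whole line, and a process is read at
  negative times as at time \<open>0\<close>; this avoids separate generators at time \<open>0\<close>.
\<close>

definition pred_sigma :: "('a \<times> real) measure" where
  "pred_sigma = sigma (space M \<times> UNIV) {B \<times> {a<..b} | a b B. B \<in> sets (F (max 0 a))}"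

lemma space_pred_sigma [simp]: "space pred_sigma = space M \<times> UNIV"
  unfolding pred_sigma_def by (simp add: space_measure_of_conv)

lemma F_sets_le: "B \<in> sets (F t) \<Longrightarrow> B \<subseteq> space M"
  using sets.sets_into_space[of B "F t"] by simp

lemma sets_pred_sigma: "sets pred_sigma = sigma_sets (space M \<times> UNIV) {B \<times> {a<..b} | a b B. B \<in> sets (F (max 0 a))}"
  unfolding pred_sigma_def by (rule sets_measure_of) (auto dest: F_sets_le)

lemma pred_sigma_rect: "B \<in> sets (F (max 0 a)) \<Longrightarrow> B \<times> {a<..b} \<in> sets pred_sigma"
  unfolding sets_pred_sigma by (rule sigma_sets.Basic) auto

lemma pred_sigma_rect_greater:
  assumes B: "B \<in> sets (F (max 0 a))" shows "B \<times> {a<..} \<in> sets pred_sigma"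
proof -
  have "B \<times> {a<..} = (\<Union>n::nat. B \<times> {a<..real n})"
    using real_arch_simple by (auto, blast)
  also have "\<dots> \<in> sets pred_sigma" using pred_sigma_rect[OF B] by auto
  finally show ?thesis .
qed

lemma measurable_into_pred_sigma:
  assumes "f \<in> space X \<rightarrow> space M \<times> UNIV"
    and "\<And>a b B. B \<in> sets (F (max 0 a)) \<Longrightarrow> f -` (B \<times> {a<..b}) \<inter> space X \<in> sets X"
  shows "f \<in> measurable X pred_sigma"
  unfolding pred_sigma_def using assms by (intro measurable_measure_of) (auto dest: F_sets_le)

lemma snd_pred_sigma [measurable]: "snd \<in> borel_measurable pred_sigma"
proof (rule borel_measurableI_le)
  fix y :: real
  have "{x \<in> space pred_sigma. snd x \<le> y} = (\<Union>n::nat. space M \<times> {- real n<..y})"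
  proof -
    have "\<exists>n::nat. - real n < r" for r using reals_Archimedean2[of "-r"] by (auto simp: minus_less_iff)
    then show ?thesis by auto
  qed
  also have "\<dots> \<in> sets pred_sigma"
    by (intro sets.countable_UN image_subsetI) (metis pred_sigma_rect sets.top space_F)
  finally show "{x \<in> space pred_sigma. snd x \<le> y} \<in> sets pred_sigma" .
qed

text \<open>
  A rectangle \<open>B \<times> {a<..b}\<close> is met by a time capped at \<open>u\<close> only if \<open>a < u\<close>, and then \<open>B\<close> belongs to
  the past of \<open>u\<close>. Composed with this map, a predictable process becomes jointly measurable for the
  past of \<open>u\<close>.
\<close>

lemma progressive:
  assumes "0 \<le> u"
  shows "(\<lambda>(\<omega>, r). (\<omega>, min r u)) \<in> measurable (F u \<Otimes>\<^sub>M borel) pred_sigma"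
proof (rule measurable_into_pred_sigma)
  show "(\<lambda>(\<omega>, r). (\<omega>, min r u)) \<in> space (F u \<Otimes>\<^sub>M borel) \<rightarrow> space M \<times> UNIV"
    by (auto simp: space_pair_measure)
  fix a b :: real and B assume B: "B \<in> sets (F (max 0 a))"
  show "(\<lambda>(\<omega>, r). (\<omega>, min r u)) -` (B \<times> {a<..b}) \<inter> space (F u \<Otimes>\<^sub>M borel) \<in> sets (F u \<Otimes>\<^sub>M borel)"
  proof (cases "a < u")
    case True
    then have "B \<in> sets (F u)" using B F_mono[of "max 0 a" u] assms by auto
    moreover have "(\<lambda>(\<omega>, r). (\<omega>, min r u)) -` (B \<times> {a<..b}) \<inter> space (F u \<Otimes>\<^sub>M borel)
        = B \<times> {r. a < min r u \<and> min r u \<le> b}"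
      using F_sets_le[OF B] by (auto simp: space_pair_measure)
    ultimately show ?thesis by (auto intro!: pair_measureI)
  next
    case False
    then have "(\<lambda>(\<omega>, r). (\<omega>, min r u)) -` (B \<times> {a<..b}) \<inter> space (F u \<Otimes>\<^sub>M borel) = {}"
      by auto
    then show ?thesis by (metis sets.empty_sets)
  qed
qed

lemma pred_sigma_snd_const: "0 \<le> u \<Longrightarrow> (\<lambda>\<omega>. (\<omega>, u)) \<in> measurable (F u) pred_sigma"
proof -
  assume u: "0 \<le> u"
  have "(\<lambda>\<omega>. (\<lambda>(\<omega>, r). (\<omega>, min r u)) (\<omega>, u)) \<in> measurable (F u) pred_sigma"
    by (rule measurable_compose[OF _ progressive[OF u]]) simp
  then show ?thesis by simp
qed

lemma graph_measurable:
  assumes t: "t \<in> borel_measurable (F u)" and u: "0 \<le> u"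
  shows "(\<lambda>\<omega>. (\<omega>, min (t \<omega>) u)) \<in> measurable (F u) pred_sigma"
proof -
  have "(\<lambda>\<omega>. (\<lambda>(\<omega>, r). (\<omega>, min r u)) (\<omega>, t \<omega>)) \<in> measurable (F u) pred_sigma"
    by (rule measurable_compose[OF _ progressive[OF u]]) (use t in measurable)
  then show ?thesis by simp
qed

lemma after_jump_pred_sigma: "{x \<in> space pred_sigma. jump_time k (fst x) < snd x} \<in> sets pred_sigma"
proof -
  have "{x \<in> space pred_sigma. jump_time k (fst x) < snd x} =
     (\<Union>q\<in>\<rat> \<inter> {0..}. {\<omega>\<in>space M. jump_time k \<omega> \<le> q} \<times> {q<..})" (is "?l = ?r")
  proof
    show "?l \<subseteq> ?r"
    proof
      fix x assume x: "x \<in> ?l"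
      then obtain q where q: "q \<in> \<rat>" "jump_time k (fst x) < q" "q < snd x"
        using Rats_dense_in_real[of "jump_time k (fst x)" "snd x"] by auto
      with jump_time_bounds(1)[of k "fst x"] x show "x \<in> ?r" by (auto intro!: bexI[of _ q] simp: mem_Times_iff)
    qed
    show "?r \<subseteq> ?l" by auto
  qed
  also have "\<dots> \<in> sets pred_sigma"
    using countable_rat jump_time_stopping[of _ k]
    by (intro sets.countable_UN' pred_sigma_rect_greater image_subsetI) (auto intro: countable_subset simp: max_def)
  finally show ?thesis .
qed

text \<open>
  Stopping a predictable process at a jump time leaves it predictable: a rectangle splits into the
  part before the jump, again a rectangle, and the part after a jump that occurred in \<open>{a<..b}\<close>, which
  is known from time \<open>b\<close> on.
\<close>

lemma stop_measurable: "(\<lambda>(\<omega>, r). (\<omega>, min (jump_time k \<omega>) r)) \<in> measurable pred_sigma pred_sigma"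
proof (rule measurable_into_pred_sigma)
  show "(\<lambda>(\<omega>, r). (\<omega>, min (jump_time k \<omega>) r)) \<in> space pred_sigma \<rightarrow> space M \<times> UNIV" by auto
  fix a b :: real and B assume B: "B \<in> sets (F (max 0 a))"
  define C where "C = {\<omega>\<in>space M. a < jump_time k \<omega>}"
  define D where "D = {\<omega>\<in>space M. jump_time k \<omega> \<le> b}"
  have BC: "B \<inter> C \<in> sets (F (max 0 a))"
  proof (cases "0 \<le> a")
    case True then show ?thesis using B jump_time_stopping_gt[of a k] by (auto simp: C_def max_def)
  next
    case False
    then have "C = space M" using jump_time_bounds(1)[of k] by (auto simp: C_def) (smt (verit))
    then show ?thesis using B F_sets_le[OF B] by (simp add: Int_absorb2)
  qed
  have BCD: "B \<inter> C \<inter> D \<in> sets (F (max 0 b))" if "a \<le> b"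
  proof (cases "0 \<le> b")
    case True then show ?thesis using BC jump_time_stopping[of b k] F_mono[of "max 0 a" b] that
      by (auto simp: D_def max_def split: if_splits)
  next
    case False
    then have "D = {}" using jump_time_bounds(1)[of k] by (auto simp: D_def) (smt (verit))
    then show ?thesis by simp
  qed
  have "(\<lambda>(\<omega>, r). (\<omega>, min (jump_time k \<omega>) r)) -` (B \<times> {a<..b}) \<inter> space pred_sigma =
    (if a \<le> b then (B \<inter> C) \<times> {a<..b} \<union> (B \<inter> C \<inter> D) \<times> {b<..} else {})"
    using F_sets_le[OF B] by (auto simp: C_def D_def min_def split: if_splits)
  also have "\<dots> \<in> sets pred_sigma" using pred_sigma_rect[OF BC] pred_sigma_rect_greater[OF BCD] by auto
  finally show "(\<lambda>(\<omega>, r). (\<omega>, min (jump_time k \<omega>) r)) -` (B \<times> {a<..b}) \<inter> space pred_sigma \<in> sets pred_sigma" .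
qed

text \<open>
  A left-continuous process is the limit of its values at the last grid point strictly before the
  current time, and these approximations are constant on rectangles.
\<close>

lemma left_cont_pred_sigma:
  fixes X :: "'a \<Rightarrow> real \<Rightarrow> real"
  assumes lc: "left_continuous_paths (space M) X" and ad: "adapted F X"
  shows "(\<lambda>(\<omega>, r). X \<omega> (max 0 r)) \<in> borel_measurable pred_sigma"
proof (rule borel_measurable_LIMSEQ_real)
  define p where "p = (\<lambda>(n::nat) (r::real). max 0 ((of_int \<lceil>real (Suc n) * r\<rceil> - 1) / real (Suc n)))"
  show "(\<lambda>(\<omega>, r). X \<omega> (p n r)) \<in> borel_measurable pred_sigma" for n
  proof -
    define a where "a = (\<lambda>j::int. of_int j / real (Suc n))"
    have eq: "\<lceil>real (Suc n) * r\<rceil> - 1 = j \<longleftrightarrow> a j < r \<and> r \<le> a (j + 1)" for r j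
    proof -
      have "\<lceil>real (Suc n) * r\<rceil> = j + 1 \<longleftrightarrow> of_int j < real (Suc n) * r \<and> real (Suc n) * r \<le> of_int j + 1"
        by (simp add: ceiling_eq_iff)
      also have "\<dots> \<longleftrightarrow> a j < r \<and> r \<le> a (j + 1)"
        unfolding a_def by (simp add: pos_divide_less_eq pos_le_divide_eq mult.commute)
      finally show ?thesis by linarith
    qed
    have p_eq: "p n r = max 0 (a (\<lceil>real (Suc n) * r\<rceil> - 1))" for r
      unfolding p_def a_def by simp
    show ?thesis
    proof (rule measurableI)
      fix S :: "real set" assume S: "S \<in> sets borel"
      define B where "B = (\<lambda>j. (\<lambda>\<omega>. X \<omega> (max 0 (a j))) -` S \<inter> space (F (max 0 (a j))))"
      have "B j \<in> sets (F (max 0 (a j)))" for j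
        unfolding B_def using ad S by (intro measurable_sets[of _ _ borel]) (auto simp: adapted_def)
      then have R: "B j \<times> {a j<..a (j + 1)} \<in> sets pred_sigma" for j by (rule pred_sigma_rect)
      have "(\<lambda>(\<omega>, r). X \<omega> (p n r)) -` S \<inter> space pred_sigma = (\<Union>j. B j \<times> {a j<..a (j + 1)})" (is "?l = ?r")
      proof
        show "?l \<subseteq> ?r"
        proof
          fix x assume "x \<in> ?l"
          then obtain \<omega> r where x: "x = (\<omega>, r)" "\<omega> \<in> space M" "X \<omega> (p n r) \<in> S" by auto
          show "x \<in> ?r"
            using x eq[of r "\<lceil>real (Suc n) * r\<rceil> - 1"]
            by (intro UN_I[of "\<lceil>real (Suc n) * r\<rceil> - 1"]) (auto simp: B_def p_eq)
        qed
        show "?r \<subseteq> ?l"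
        proof
          fix x assume "x \<in> ?r"
          then obtain \<omega> r j where x: "x = (\<omega>, r)" "\<omega> \<in> B j" "a j < r \<and> r \<le> a (j + 1)" by auto
          then have "p n r = max 0 (a j)" using eq[of r j] p_eq[of r] by simp
          with x show "x \<in> ?l" by (auto simp: B_def)
        qed
      qed
      with R show "(\<lambda>(\<omega>, r). X \<omega> (p n r)) -` S \<inter> space pred_sigma \<in> sets pred_sigma" by auto
    qed auto
  qed
  fix x assume "x \<in> space pred_sigma"
  then obtain \<omega> r where x: "x = (\<omega>, r)" "\<omega> \<in> space M" by auto
  have "(\<lambda>n. X \<omega> (p n r)) \<longlonglongrightarrow> X \<omega> (max 0 r)"
  proof (cases "r \<le> 0")
    case True
    then have "p n r = 0" for n
    proof -
      have "real (Suc n) * r \<le> 0" using True by (simp add: mult_nonneg_nonpos)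
      then have "\<lceil>real (Suc n) * r\<rceil> \<le> 0" by simp
      then show ?thesis by (simp add: p_def divide_le_0_iff)
    qed
    then show ?thesis using True by (simp add: max_def)
  next
    case False
    have lt: "p n r < r" for n
      using False ceiling_correct[of "real (Suc n) * r"] by (auto simp: p_def pos_divide_less_eq mult.commute)
    have ge: "r - 1 / real (Suc n) \<le> p n r" for n
    proof -
      have "r - 1 / real (Suc n) = (real (Suc n) * r - 1) / real (Suc n)" by (simp add: field_simps)
      also have "\<dots> \<le> (of_int \<lceil>real (Suc n) * r\<rceil> - 1) / real (Suc n)"
        by (intro divide_right_mono) (auto simp: le_of_int_ceiling)
      finally show ?thesis by (simp add: p_def)
    qed
    have "(\<lambda>n. p n r) \<longlonglongrightarrow> r"
    proof (rule tendsto_sandwich[OF always_eventually always_eventually])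
      show "\<forall>n. r - 1 / real (Suc n) \<le> p n r" using ge by auto
      show "\<forall>n. p n r \<le> r" using lt less_imp_le by blast
      show "(\<lambda>n. r - 1 / real (Suc n)) \<longlonglongrightarrow> r"
        using tendsto_diff[OF tendsto_const LIMSEQ_inverse_real_of_nat, of r] by (simp add: inverse_eq_divide)
    qed auto
    then have "filterlim (\<lambda>n. p n r) (at_left r) sequentially"
      unfolding filterlim_at using lt lt[THEN less_imp_neq] by (auto intro!: always_eventually)
    moreover have "((X \<omega>) \<longlongrightarrow> X \<omega> r) (at_left r)"
      using lc x False by (auto simp: left_continuous_paths_def continuous_within)
    ultimately have "(\<lambda>n. X \<omega> (p n r)) \<longlonglongrightarrow> X \<omega> r" by (rule filterlim_compose[rotated])
    then show ?thesis using False by (simp add: max_def)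
  qed
  then show "(\<lambda>n. case x of (\<omega>, r) \<Rightarrow> X \<omega> (p n r)) \<longlonglongrightarrow> (case x of (\<omega>, r) \<Rightarrow> X \<omega> (max 0 r))"
    by (simp add: x)
qed

lemma predictable_pred_sigma:
  assumes "predictable (space M) F X"
  shows "(\<lambda>(\<omega>, r). X \<omega> (max 0 r)) \<in> borel_measurable pred_sigma"
proof -
  have m: "(\<lambda>(\<omega>, r). (\<omega>, max 0 r)) \<in> measurable pred_sigma (predictable_algebra (space M) F)"
    unfolding predictable_algebra_def
  proof (rule measurable_measure_of)
    show "(\<lambda>(\<omega>, r). (\<omega>, max 0 r)) \<in> space pred_sigma \<rightarrow> space M \<times> {0..}" by auto
    fix S assume "S \<in> {(\<lambda>(\<omega>, t). X \<omega> t) -` B \<inter> (space M \<times> {0..}) | X B.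
          left_continuous_paths (space M) X \<and> adapted F X \<and> B \<in> sets (borel :: real measure)}"
    then obtain X and B :: "real set" where S: "S = (\<lambda>(\<omega>, t). X \<omega> t) -` B \<inter> (space M \<times> {0..})"
      "left_continuous_paths (space M) X" "adapted F X" "B \<in> sets borel" by auto
    have "(\<lambda>(\<omega>, r). (\<omega>, max 0 r)) -` S \<inter> space pred_sigma = (\<lambda>(\<omega>, r). X \<omega> (max 0 r)) -` B \<inter> space pred_sigma"
      unfolding S by auto
    with left_cont_pred_sigma[OF S(2,3)] S(4) show "(\<lambda>(\<omega>, r). (\<omega>, max 0 r)) -` S \<inter> space pred_sigma \<in> sets pred_sigma"
      by (metis measurable_sets)
  qed auto
  have "(\<lambda>x. (\<lambda>(\<omega>, r). X \<omega> r) ((\<lambda>(\<omega>, r). (\<omega>, max 0 r)) x)) \<in> borel_measurable pred_sigma"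
    by (rule measurable_compose[OF m]) (use assms in \<open>simp add: predictable_def\<close>)
  then show ?thesis by (simp add: case_prod_beta')
qed

end

section \<open>Optional stopping at jump times\<close>

text \<open>
  Truncation must be continuous, as limits are taken inside it.
\<close>

definition cutoff :: "nat \<Rightarrow> real \<Rightarrow> real" where
  "cutoff c x = max 0 (min 1 (real c + 1 - \<bar>x\<bar>))"

lemma cutoff_cont: "continuous_on UNIV (cutoff c)"
  unfolding cutoff_def by (intro continuous_intros)

lemma cutoff_bounds: "0 \<le> cutoff c x" "cutoff c x \<le> 1"
  by (auto simp: cutoff_def)

lemma cutoff_mult: "\<bar>cutoff c x * x\<bar> \<le> real c + 1"
proof (cases "\<bar>x\<bar> \<le> real c + 1")
  case True
  then show ?thesis using mult_mono[of "cutoff c x" 1 "\<bar>x\<bar>" "real c + 1"] cutoff_bounds[of c x] by (simp add: abs_mult)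
qed (simp add: cutoff_def)

lemma cutoff_incseq: "incseq (\<lambda>c. cutoff c x)"
  unfolding cutoff_def by (intro incseq_SucI) auto

lemma cutoff_lim: "(\<lambda>c. cutoff c x) \<longlonglongrightarrow> 1"
proof (rule tendsto_eventually)
  have "eventually (\<lambda>c. \<bar>x\<bar> \<le> real c) sequentially"
    by (rule eventually_sequentiallyI[of "nat \<lceil>\<bar>x\<bar>\<rceil>"]) linarith
  then show "eventually (\<lambda>c. cutoff c x = 1) sequentially" by eventually_elim (simp add: cutoff_def)
qed

lemma cutoff_meas[measurable]: "cutoff c \<in> borel_measurable borel"
  using cutoff_cont by (rule borel_measurable_continuous_onI)

context counting_process
begin

definition cumul :: "('a \<times> real \<Rightarrow> ennreal) \<Rightarrow> 'a \<Rightarrow> real \<Rightarrow> ennreal" where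
  "cumul \<kappa> \<omega> u = (\<integral>\<^sup>+r\<in>{0<..u}. \<kappa> (\<omega>, r) \<partial>lborel)"

text \<open>
  The real-valued compensated process; an infinite cumulative intensity counts as \<open>0\<close> here.
\<close>

definition counted_minus_cumul :: "('a \<times> real \<Rightarrow> ennreal) \<Rightarrow> 'a \<Rightarrow> real \<Rightarrow> real" where
  "counted_minus_cumul \<kappa> \<omega> u = N \<omega> u - enn2real (cumul \<kappa> \<omega> u)"

text \<open>
  The martingale property is tested against bounded functions of the past, the form in which
  stopping makes use of it.
\<close>

definition has_intensity :: "'a measure \<Rightarrow> ('a \<times> real \<Rightarrow> ennreal) \<Rightarrow> bool" where
  "has_intensity R \<kappa> \<longleftrightarrow> prob_space R \<and> sets R = sets M \<and> \<kappa> \<in> borel_measurable pred_sigma \<and>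
     (\<forall>u\<ge>0. AE \<omega> in R. cumul \<kappa> \<omega> u < \<infinity>) \<and>
     (\<forall>u\<ge>0. integrable R (\<lambda>\<omega>. counted_minus_cumul \<kappa> \<omega> u)) \<and>
     (\<forall>a b g. 0 \<le> a \<longrightarrow> a \<le> b \<longrightarrow> g \<in> borel_measurable (F a) \<longrightarrow> (\<forall>\<omega>. \<bar>g \<omega>\<bar> \<le> 1) \<longrightarrow>
        (\<integral>\<omega>. g \<omega> * counted_minus_cumul \<kappa> \<omega> b \<partial>R) = (\<integral>\<omega>. g \<omega> * counted_minus_cumul \<kappa> \<omega> a \<partial>R))"

lemma has_intensityD:
  assumes "has_intensity R \<kappa>"
  shows "prob_space R" "sets R = sets M" "space R = space M" "\<kappa> \<in> borel_measurable pred_sigma"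
    "\<And>u. 0 \<le> u \<Longrightarrow> AE \<omega> in R. cumul \<kappa> \<omega> u < \<infinity>"
    "\<And>u. 0 \<le> u \<Longrightarrow> integrable R (\<lambda>\<omega>. counted_minus_cumul \<kappa> \<omega> u)"
  using assms sets_eq_imp_space_eq unfolding has_intensity_def by blast+

lemma has_intensity_martingale:
  assumes "has_intensity R \<kappa>" "0 \<le> a" "a \<le> b" "g \<in> borel_measurable (F a)" "\<And>\<omega>. \<bar>g \<omega>\<bar> \<le> 1"
  shows "(\<integral>\<omega>. g \<omega> * counted_minus_cumul \<kappa> \<omega> b \<partial>R) = (\<integral>\<omega>. g \<omega> * counted_minus_cumul \<kappa> \<omega> a \<partial>R)"
  using assms unfolding has_intensity_def by blast

lemma section_pred_sigma:
  assumes "\<omega> \<in> space M" shows "(\<lambda>r. (\<omega>, r)) \<in> measurable borel pred_sigma"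
proof (rule measurable_into_pred_sigma)
  fix a b :: real and B
  have "(\<lambda>r. (\<omega>, r)) -` (B \<times> {a<..b}) \<inter> space borel = (if \<omega> \<in> B then {a<..b} else {})" by auto
  then show "(\<lambda>r. (\<omega>, r)) -` (B \<times> {a<..b}) \<inter> space borel \<in> sets borel" by simp
qed (use assms in auto)

lemma cumul_F_measurable:
  assumes k: "\<kappa> \<in> borel_measurable pred_sigma" and u: "0 \<le> u"
  shows "(\<lambda>\<omega>. cumul \<kappa> \<omega> u) \<in> borel_measurable (F u)"
proof -
  have [measurable]: "(\<lambda>x. \<kappa> (fst x, min (snd x) u)) \<in> borel_measurable (F u \<Otimes>\<^sub>M borel)"
    using measurable_compose[OF progressive[OF u] k] by (simp add: case_prod_beta')
  have "cumul \<kappa> = (\<lambda>\<omega> u. \<integral>\<^sup>+r. \<kappa> (\<omega>, min r u) * indicator {0<..u} r \<partial>lborel)"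
    unfolding cumul_def by (intro ext nn_integral_cong) (auto split: split_indicator simp: min_def)
  moreover have "(\<lambda>\<omega>. \<integral>\<^sup>+r. \<kappa> (\<omega>, min r u) * indicator {0<..u} r \<partial>lborel) \<in> borel_measurable (F u)"
    by measurable
  ultimately show ?thesis by simp
qed

lemma cumul_jump_measurable:
  assumes k: "\<kappa> \<in> borel_measurable pred_sigma" and u: "0 \<le> u"
  shows "(\<lambda>\<omega>. cumul \<kappa> \<omega> (min (jump_time k \<omega>) u)) \<in> borel_measurable M"
proof -
  have "(\<lambda>x. \<kappa> (fst x, min (snd x) u)) \<in> borel_measurable (F u \<Otimes>\<^sub>M borel)"
    using measurable_compose[OF progressive[OF u] k] by (simp add: case_prod_beta')
  moreover have "sets (F u \<Otimes>\<^sub>M borel) \<subseteq> sets (M \<Otimes>\<^sub>M (borel :: real measure))"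
    unfolding sets_pair_measure space_F using F_sub_M[of u] by (intro sigma_sets_mono') blast
  ultimately have [measurable]: "(\<lambda>x. \<kappa> (fst x, min (snd x) u)) \<in> borel_measurable (M \<Otimes>\<^sub>M borel)"
    by (auto simp: measurable_def space_pair_measure)
  note jump_time_measurable[measurable]
  have "(\<lambda>\<omega>. cumul \<kappa> \<omega> (min (jump_time k \<omega>) u)) =
     (\<lambda>\<omega>. \<integral>\<^sup>+r. \<kappa> (\<omega>, min r u) * (if 0 < r \<and> r \<le> jump_time k \<omega> \<and> r \<le> u then 1 else 0) \<partial>lborel)"
    unfolding cumul_def by (intro ext nn_integral_cong) (auto split: split_indicator simp: min_def)
  moreover have "(\<lambda>\<omega>. \<integral>\<^sup>+r. \<kappa> (\<omega>, min r u) * (if 0 < r \<and> r \<le> jump_time k \<omega> \<and> r \<le> u then 1 else 0) \<partial>lborel)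
     \<in> borel_measurable M"
    by measurable
  ultimately show ?thesis by simp
qed

lemma cumul_mono: "u \<le> v \<Longrightarrow> cumul \<kappa> \<omega> u \<le> cumul \<kappa> \<omega> v"
  unfolding cumul_def by (intro nn_integral_mono) (auto split: split_indicator)

text \<open>
  The cumulative intensity is continuous up to any time at which it is finite.
\<close>

lemma cumul_tendsto:
  assumes w: "\<omega> \<in> space M" and k: "\<kappa> \<in> borel_measurable pred_sigma" and fin: "cumul \<kappa> \<omega> b < \<infinity>"
    and x: "x \<longlonglongrightarrow> l" "\<And>m. x m \<le> b"
  shows "(\<lambda>m. cumul \<kappa> \<omega> (x m)) \<longlonglongrightarrow> cumul \<kappa> \<omega> l"
  unfolding cumul_def
proof (rule nn_integral_dominated_convergence[where w = "\<lambda>r. \<kappa> (\<omega>, r) * indicator {0<..b} r"])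
  have [measurable]: "(\<lambda>r. \<kappa> (\<omega>, r)) \<in> borel_measurable borel"
    by (rule measurable_compose[OF section_pred_sigma[OF w] k])
  show "(\<lambda>r. \<kappa> (\<omega>, r) * indicator {0<..x m} r) \<in> borel_measurable lborel"
    "(\<lambda>r. \<kappa> (\<omega>, r) * indicator {0<..l} r) \<in> borel_measurable lborel"
    "(\<lambda>r. \<kappa> (\<omega>, r) * indicator {0<..b} r) \<in> borel_measurable lborel" for m by measurable
  show "AE r in lborel. \<kappa> (\<omega>, r) * indicator {0<..x m} r \<le> \<kappa> (\<omega>, r) * indicator {0<..b} r" for m
    using x(2)[of m] by (auto split: split_indicator)
  show "(\<integral>\<^sup>+r. \<kappa> (\<omega>, r) * indicator {0<..b} r \<partial>lborel) < \<infinity>" using fin by (simp add: cumul_def)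
  show "AE r in lborel. (\<lambda>m. \<kappa> (\<omega>, r) * indicator {0<..x m} r) \<longlonglongrightarrow> \<kappa> (\<omega>, r) * indicator {0<..l} r"
  proof (rule AE_mp[OF AE_lborel_singleton[of l]], rule AE_I2, rule impI)
    fix r assume r: "r \<noteq> l"
    have "eventually (\<lambda>m. indicator {0<..x m} r = (indicator {0<..l} r :: ennreal)) sequentially"
    proof (cases "r < l")
      case True
      have "eventually (\<lambda>m. r < x m) sequentially" using x(1) True by (rule order_tendstoD)
      then show ?thesis by eventually_elim (use True in \<open>auto split: split_indicator\<close>)
    next
      case False
      then have "eventually (\<lambda>m. x m < r) sequentially" using x(1) r by (intro order_tendstoD(2)) auto
      then show ?thesis by eventually_elim (use False r in \<open>auto split: split_indicator\<close>)
    qed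
    then have "eventually (\<lambda>m. \<kappa> (\<omega>, r) * indicator {0<..x m} r = \<kappa> (\<omega>, r) * indicator {0<..l} r) sequentially"
      by eventually_elim simp
    then show "(\<lambda>m. \<kappa> (\<omega>, r) * indicator {0<..x m} r) \<longlonglongrightarrow> \<kappa> (\<omega>, r) * indicator {0<..l} r"
      by (rule tendsto_eventually)
  qed
qed

lemma N_right_tendsto:
  assumes w: "\<omega> \<in> space M" and x: "x \<longlonglongrightarrow> l" "\<And>m. l \<le> x m" and l: "0 \<le> l"
  shows "(\<lambda>m. N \<omega> (x m)) \<longlonglongrightarrow> N \<omega> l"
proof -
  obtain b where b: "b > l" "\<And>y. y > l \<Longrightarrow> y < b \<Longrightarrow> N \<omega> y = N \<omega> l"
    using N_right_eventually_const[OF w l] unfolding eventually_at_right_field by auto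
  have "eventually (\<lambda>m. x m < b) sequentially" using x(1) b(1) by (rule order_tendstoD)
  then have "eventually (\<lambda>m. N \<omega> (x m) = N \<omega> l) sequentially"
    by eventually_elim (use b x(2) in \<open>metis order_le_less\<close>)
  then show ?thesis by (rule tendsto_eventually)
qed

lemma counted_minus_cumul_F_measurable:
  "\<kappa> \<in> borel_measurable pred_sigma \<Longrightarrow> 0 \<le> u \<Longrightarrow> (\<lambda>\<omega>. counted_minus_cumul \<kappa> \<omega> u) \<in> borel_measurable (F u)"
  unfolding counted_minus_cumul_def using cumul_F_measurable[of \<kappa> u] N_F_measurable[of u u] by measurable

lemma N_stopped:
  assumes w: "\<omega> \<in> space M" and u: "0 \<le> u" "u \<le> T"
  shows "N \<omega> (min (jump_time k \<omega>) u) = min (real k) (N \<omega> u)"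
proof (cases "jump_time k \<omega> \<le> u")
  case True
  then have "N \<omega> (jump_time k \<omega>) = real k"
    using N_eq_iff[OF w, of "jump_time k \<omega>" k] jump_time_bounds(1)[of k \<omega>] u jump_time_strict[OF w, of k]
    by auto
  then show ?thesis using True jump_time_le_iff[OF w u, of k] by simp
next
  case False
  then show ?thesis using jump_time_le_iff[OF w u, of k] by simp
qed

lemma jump_time_stopping_any: "{\<omega>\<in>space M. jump_time k \<omega> \<le> u} \<in> sets (F (max 0 u))"
proof (cases "0 \<le> u")
  case True then show ?thesis using jump_time_stopping[of u k] by simp
next
  case False
  then have "{\<omega>\<in>space M. jump_time k \<omega> \<le> u} = {}" using jump_time_bounds(1)[of k] by (auto simp: not_le) (smt (verit))
  then show ?thesis by (metis sets.empty_sets)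
qed

text \<open>
  Optional stopping at the first grid point at or after a jump time. This stopping time has finitely
  many values before \<open>b\<close>, and the martingale property can be used on each of them. The factor \<open>\<phi>\<close>
  depends on the stopped value only, so it is known when the process is stopped.
\<close>

lemma stop_grid:
  fixes b :: real and m k :: nat and \<phi> :: "real \<Rightarrow> real"
  defines "\<rho> \<equiv> \<lambda>\<omega>. min b (of_int \<lceil>real (Suc m) * jump_time k \<omega>\<rceil> / real (Suc m))"
  assumes int: "has_intensity R \<kappa>" and b: "0 \<le> a" "a \<le> b"
    and B: "B \<in> sets (F a)" "B \<subseteq> {\<omega>. a < jump_time k \<omega>}"
    and phi: "\<phi> \<in> borel_measurable borel" "\<And>x. \<bar>\<phi> x\<bar> \<le> 1"
  shows "(\<integral>\<omega>. indicator B \<omega> * \<phi> (counted_minus_cumul \<kappa> \<omega> (\<rho> \<omega>)) * (counted_minus_cumul \<kappa> \<omega> (\<rho> \<omega>) - counted_minus_cumul \<kappa> \<omega> b) \<partial>R) = 0"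
    and "(\<lambda>\<omega>. counted_minus_cumul \<kappa> \<omega> (\<rho> \<omega>)) \<in> borel_measurable M"
proof -
  note k = has_intensityD(4)[OF int] and sR = has_intensityD(2)[OF int] and spR = has_intensityD(3)[OF int]
    and intg = has_intensityD(6)[OF int] and mart = has_intensity_martingale[OF int]
  define s where "s = (\<lambda>j::int. of_int j / real (Suc m))"
  define C where "C = (\<lambda>j::int. {\<omega>\<in>space M. \<lceil>real (Suc m) * jump_time k \<omega>\<rceil> = j})"
  define J where "J = {0..<\<lceil>real (Suc m) * b\<rceil>}"
  have sJ: "s j < b \<longleftrightarrow> j < \<lceil>real (Suc m) * b\<rceil>" for j
    unfolding s_def by (simp add: pos_divide_less_eq less_ceiling_iff mult.commute)
  have C_alt: "C j = {\<omega>\<in>space M. jump_time k \<omega> \<le> s j} - {\<omega>\<in>space M. jump_time k \<omega> \<le> s (j - 1)}" for j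
  proof -
    have "\<lceil>real (Suc m) * r\<rceil> = j \<longleftrightarrow> s (j - 1) < r \<and> r \<le> s j" for r
      unfolding s_def ceiling_eq_iff by (simp add: pos_divide_less_eq pos_le_divide_eq mult.commute del: of_nat_Suc)
    then have "C j = {\<omega>\<in>space M. s (j - 1) < jump_time k \<omega> \<and> jump_time k \<omega> \<le> s j}"
      unfolding C_def by (simp only:)
    also have "\<dots> = {\<omega>\<in>space M. jump_time k \<omega> \<le> s j} - {\<omega>\<in>space M. jump_time k \<omega> \<le> s (j - 1)}"
      by (intro set_eqI) (simp only: mem_Collect_eq Diff_iff de_Morgan_conj not_le, blast)
    finally show ?thesis .
  qed
  have CF: "C j \<in> sets (F (max 0 (s j)))" for j
  proof -
    have "s (j - 1) \<le> s j" unfolding s_def by (intro divide_right_mono) auto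
    then have "sets (F (max 0 (s (j - 1)))) \<subseteq> sets (F (max 0 (s j)))" by (intro F_mono) auto
    then have "{\<omega>\<in>space M. jump_time k \<omega> \<le> s (j - 1)} \<in> sets (F (max 0 (s j)))"
      using jump_time_stopping_any[of k "s (j - 1)"] by auto
    then show ?thesis unfolding C_alt using jump_time_stopping_any[of k "s j"] by (intro sets.Diff)
  qed
  have s0: "0 \<le> s j" if "j \<in> J" for j using that unfolding J_def s_def by auto
  have J_iff: "j \<in> J \<longleftrightarrow> s j < b" if ne: "C j \<noteq> {}" for j
  proof -
    obtain \<omega> where "\<lceil>real (Suc m) * jump_time k \<omega>\<rceil> = j" using ne unfolding C_def by blast
    then have "0 \<le> j" using jump_time_bounds(1)[of k \<omega>]
      by (metis ceiling_mono ceiling_zero mult_nonneg_nonneg of_nat_0_le_iff)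
    then show ?thesis using sJ[of j] by (simp add: J_def)
  qed
  have rho: "\<rho> \<omega> = (if s j < b then s j else b)" if "\<omega> \<in> C j" for \<omega> j
    using that unfolding \<rho>_def C_def s_def by (auto simp: min_def)
  have inC: "\<omega> \<in> space M \<Longrightarrow> \<omega> \<in> C j \<longleftrightarrow> j = \<lceil>real (Suc m) * jump_time k \<omega>\<rceil>" for \<omega> j
    unfolding C_def by auto
  have decomp: "f (counted_minus_cumul \<kappa> \<omega> (\<rho> \<omega>)) = f (counted_minus_cumul \<kappa> \<omega> b) +
      (\<Sum>j\<in>J. indicator (C j) \<omega> * (f (counted_minus_cumul \<kappa> \<omega> (s j)) - f (counted_minus_cumul \<kappa> \<omega> b)))"
    if w: "\<omega> \<in> space M" for \<omega> and f :: "real \<Rightarrow> real"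
  proof -
    define i where "i = \<lceil>real (Suc m) * jump_time k \<omega>\<rceil>"
    have i: "\<omega> \<in> C i" using inC[OF w] i_def by auto
    have "(\<Sum>j\<in>J. indicator (C j) \<omega> * (f (counted_minus_cumul \<kappa> \<omega> (s j)) - f (counted_minus_cumul \<kappa> \<omega> b))) =
      (\<Sum>j\<in>J. if j = i then f (counted_minus_cumul \<kappa> \<omega> (s i)) - f (counted_minus_cumul \<kappa> \<omega> b) else 0)"
      using inC[OF w] i_def by (intro sum.cong refl) (auto split: split_indicator)
    also have "\<dots> = (if i \<in> J then f (counted_minus_cumul \<kappa> \<omega> (s i)) - f (counted_minus_cumul \<kappa> \<omega> b) else 0)"
      by (simp add: J_def)
    finally show ?thesis using rho[OF i] J_iff[of i] i by auto
  qed
  have cM[measurable]: "(\<lambda>\<omega>. counted_minus_cumul \<kappa> \<omega> u) \<in> borel_measurable M" if "0 \<le> u" for u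
    using counted_minus_cumul_F_measurable[OF k that] by (rule F_measurable_M)
  have CM[measurable]: "C j \<in> sets M" for j using CF F_sub_M by blast
  have BM[measurable]: "B \<in> sets M" using B F_sub_M by blast
  have "(\<lambda>\<omega>. counted_minus_cumul \<kappa> \<omega> b + (\<Sum>j\<in>J. indicator (C j) \<omega> * (counted_minus_cumul \<kappa> \<omega> (s j) - counted_minus_cumul \<kappa> \<omega> b)))
      \<in> borel_measurable M"
    using b s0 by (intro borel_measurable_add borel_measurable_sum borel_measurable_times borel_measurable_diff
        borel_measurable_indicator cM CM) auto
  moreover have "(\<lambda>\<omega>. counted_minus_cumul \<kappa> \<omega> (\<rho> \<omega>)) \<in> borel_measurable M \<longleftrightarrow>
    (\<lambda>\<omega>. counted_minus_cumul \<kappa> \<omega> b + (\<Sum>j\<in>J. indicator (C j) \<omega> * (counted_minus_cumul \<kappa> \<omega> (s j) - counted_minus_cumul \<kappa> \<omega> b))) \<in> borel_measurable M"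
    by (rule measurable_cong) (use decomp[where f="\<lambda>x. x"] in simp)
  ultimately show "(\<lambda>\<omega>. counted_minus_cumul \<kappa> \<omega> (\<rho> \<omega>)) \<in> borel_measurable M" by simp
  define g where "g = (\<lambda>j \<omega>. indicator (B \<inter> C j) \<omega> * \<phi> (counted_minus_cumul \<kappa> \<omega> (s j)))"
  have zero: "(\<integral>\<omega>. g j \<omega> * (counted_minus_cumul \<kappa> \<omega> (s j) - counted_minus_cumul \<kappa> \<omega> b) \<partial>R) = 0"
    "integrable R (\<lambda>\<omega>. g j \<omega> * (counted_minus_cumul \<kappa> \<omega> (s j) - counted_minus_cumul \<kappa> \<omega> b))" if j: "j \<in> J" for j
  proof -
    have sb: "s j \<le> b" using j sJ[of j] by (auto simp: J_def)
    have BC: "B \<inter> C j \<in> sets (F (s j))"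
    proof (cases "a \<le> s j")
      case True
      then show ?thesis using B(1) F_mono[of a "s j"] CF[of j] s0[OF j] by (auto simp: max_def split: if_splits)
    next
      case False
      then have "B \<inter> C j = {}" using B(2) unfolding C_alt by auto
      then show ?thesis by simp
    qed
    have g1: "g j \<in> borel_measurable (F (s j))"
      unfolding g_def using BC phi(1) counted_minus_cumul_F_measurable[OF k s0[OF j]] by measurable
    have g2: "\<bar>g j \<omega>\<bar> \<le> 1" for \<omega> unfolding g_def using phi(2) by (auto split: split_indicator simp: abs_mult)
    have gR: "g j \<in> borel_measurable R" using F_measurable_M[OF g1] sR by (simp cong: measurable_cong_sets)
    have i: "integrable R (\<lambda>\<omega>. g j \<omega> * counted_minus_cumul \<kappa> \<omega> u)" if "0 \<le> u" for u
    proof (rule Bochner_Integration.integrable_bound[OF intg[OF that]])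
      show "(\<lambda>\<omega>. g j \<omega> * counted_minus_cumul \<kappa> \<omega> u) \<in> borel_measurable R" 
        using gR intg[OF that] by measurable
      show "AE \<omega> in R. norm (g j \<omega> * counted_minus_cumul \<kappa> \<omega> u) \<le> norm (counted_minus_cumul \<kappa> \<omega> u)"
        using g2 by (auto simp: abs_mult mult_left_le_one_le)
    qed
    show "integrable R (\<lambda>\<omega>. g j \<omega> * (counted_minus_cumul \<kappa> \<omega> (s j) - counted_minus_cumul \<kappa> \<omega> b))"
      using i[OF s0[OF j]] i[of b] b by (simp add: right_diff_distrib)
    show "(\<integral>\<omega>. g j \<omega> * (counted_minus_cumul \<kappa> \<omega> (s j) - counted_minus_cumul \<kappa> \<omega> b) \<partial>R) = 0"
      using i[OF s0[OF j]] i[of b] b mart[OF s0[OF j] sb g1 g2] by (simp add: right_diff_distrib)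
  qed
  have "(\<integral>\<omega>. indicator B \<omega> * \<phi> (counted_minus_cumul \<kappa> \<omega> (\<rho> \<omega>)) * (counted_minus_cumul \<kappa> \<omega> (\<rho> \<omega>) - counted_minus_cumul \<kappa> \<omega> b) \<partial>R)
     = (\<integral>\<omega>. (\<Sum>j\<in>J. g j \<omega> * (counted_minus_cumul \<kappa> \<omega> (s j) - counted_minus_cumul \<kappa> \<omega> b)) \<partial>R)"
  proof (rule Bochner_Integration.integral_cong[OF refl])
    fix \<omega> assume "\<omega> \<in> space R"
    then have w: "\<omega> \<in> space M" by (simp add: spR)
    define i where "i = \<lceil>real (Suc m) * jump_time k \<omega>\<rceil>"
    have i: "\<omega> \<in> C i" using inC[OF w] i_def by auto
    have "(\<Sum>j\<in>J. g j \<omega> * (counted_minus_cumul \<kappa> \<omega> (s j) - counted_minus_cumul \<kappa> \<omega> b)) =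
      (\<Sum>j\<in>J. if j = i then g i \<omega> * (counted_minus_cumul \<kappa> \<omega> (s i) - counted_minus_cumul \<kappa> \<omega> b) else 0)"
      using inC[OF w] i_def by (intro sum.cong refl) (auto split: split_indicator simp: g_def)
    also have "\<dots> = (if i \<in> J then g i \<omega> * (counted_minus_cumul \<kappa> \<omega> (s i) - counted_minus_cumul \<kappa> \<omega> b) else 0)"
      by (simp add: J_def)
    finally show "indicator B \<omega> * \<phi> (counted_minus_cumul \<kappa> \<omega> (\<rho> \<omega>)) * (counted_minus_cumul \<kappa> \<omega> (\<rho> \<omega>) - counted_minus_cumul \<kappa> \<omega> b) =
      (\<Sum>j\<in>J. g j \<omega> * (counted_minus_cumul \<kappa> \<omega> (s j) - counted_minus_cumul \<kappa> \<omega> b))"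
      using rho[OF i] J_iff[of i] i by (auto simp: g_def split: split_indicator)
  qed
  also have "\<dots> = 0" using zero by (simp add: Bochner_Integration.integral_sum)
  finally show "(\<integral>\<omega>. indicator B \<omega> * \<phi> (counted_minus_cumul \<kappa> \<omega> (\<rho> \<omega>)) * (counted_minus_cumul \<kappa> \<omega> (\<rho> \<omega>) - counted_minus_cumul \<kappa> \<omega> b) \<partial>R) = 0" .
qed

text \<open>
  The limit of finer and finer grids in \<open>stop_grid\<close>: the compensated process is right-continuous,
  and the boundedness of \<open>\<phi> x * x\<close> provides the domination.
\<close>

lemma stop_cutoff:
  fixes b :: real and k :: nat and \<phi> :: "real \<Rightarrow> real" and \<kappa>
  defines "X \<equiv> \<lambda>\<omega>. counted_minus_cumul \<kappa> \<omega> (min (jump_time k \<omega>) b)"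
  assumes int: "has_intensity R \<kappa>" and b: "0 \<le> a" "a \<le> b" "b \<le> T"
    and B: "B \<in> sets (F a)" "B \<subseteq> {\<omega>. a < jump_time k \<omega>}"
    and phi: "continuous_on UNIV \<phi>" "\<And>x. \<bar>\<phi> x\<bar> \<le> 1" "\<And>x. \<bar>\<phi> x * x\<bar> \<le> C"
  shows "(\<integral>\<omega>. indicator B \<omega> * (\<phi> (X \<omega>) * X \<omega>) \<partial>R) = (\<integral>\<omega>. indicator B \<omega> * (\<phi> (X \<omega>) * counted_minus_cumul \<kappa> \<omega> b) \<partial>R)"
    and "X \<in> borel_measurable M"
proof -
  have b0: "0 \<le> b" using b by simp
  note pR = has_intensityD(1)[OF int] and sR = has_intensityD(2)[OF int] and spR = has_intensityD(3)[OF int]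
    and k = has_intensityD(4)[OF int] and fin = has_intensityD(5)[OF int b0] and intg = has_intensityD(6)[OF int b0]
  interpret R: prob_space R by (rule pR)
  show XM: "X \<in> borel_measurable M"
  proof -
    have "X \<in> borel_measurable M \<longleftrightarrow> (\<lambda>\<omega>. min (real k) (N \<omega> b) - enn2real (cumul \<kappa> \<omega> (min (jump_time k \<omega>) b))) \<in> borel_measurable M"
      by (rule measurable_cong) (use N_stopped[of _ b k] b0 b in \<open>auto simp: X_def counted_minus_cumul_def\<close>)
    also have "\<dots>" using N_measurable[OF b0] cumul_jump_measurable[OF k b0, of k] by measurable
    finally show ?thesis .
  qed
  have [measurable]: "X \<in> borel_measurable R" using XM sR by (simp cong: measurable_cong_sets)
  have phm[measurable]: "\<phi> \<in> borel_measurable borel"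
    using phi(1) by (rule borel_measurable_continuous_onI)
  have [measurable]: "B \<in> sets R" using B F_sub_M sR by blast
  \<comment> \<open>the first grid point of mesh \<open>1 / (m + 1)\<close> at or after the jump time, capped at \<open>b\<close>\<close>
  define \<rho> where "\<rho> = (\<lambda>m \<omega>. min b (of_int \<lceil>real (Suc m) * jump_time k \<omega>\<rceil> / real (Suc m)))"
  define Y where "Y = (\<lambda>m \<omega>. counted_minus_cumul \<kappa> \<omega> (\<rho> m \<omega>))"
  note grid = stop_grid[OF int b(1,2) B phm phi(2), folded \<rho>_def]
  have [measurable]: "Y m \<in> borel_measurable R" for m
    using grid(2)[of m] sR unfolding Y_def \<rho>_def by (simp cong: measurable_cong_sets)
  note [measurable] = borel_measurable_integrable[OF intg]
  have conv: "AE \<omega> in R. (\<lambda>m. Y m \<omega>) \<longlonglongrightarrow> X \<omega>"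
    using fin
  proof (rule AE_mp, intro AE_I2 impI)
    fix \<omega> assume w: "\<omega> \<in> space R" and f: "cumul \<kappa> \<omega> b < \<infinity>"
    then have w: "\<omega> \<in> space M" by (simp add: spR)
    define t where "t = jump_time k \<omega>"
    define l where "l = min t b"
    have t0: "0 \<le> t" unfolding t_def by (rule jump_time_bounds)
    have ge: "t \<le> of_int \<lceil>real (Suc m) * t\<rceil> / real (Suc m)" for m
      using le_of_int_ceiling[of "real (Suc m) * t"] by (simp add: pos_le_divide_eq mult.commute)
    have le: "of_int \<lceil>real (Suc m) * t\<rceil> / real (Suc m) \<le> t + 1 / real (Suc m)" for m
    proof -
      have "of_int \<lceil>real (Suc m) * t\<rceil> \<le> real (Suc m) * t + 1" by (rule of_int_ceiling_le_add_one)
      then have "of_int \<lceil>real (Suc m) * t\<rceil> / real (Suc m) \<le> (real (Suc m) * t + 1) / real (Suc m)"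
        by (intro divide_right_mono) auto
      then show ?thesis by (simp add: field_simps)
    qed
    have "(\<lambda>m. of_int \<lceil>real (Suc m) * t\<rceil> / real (Suc m)) \<longlonglongrightarrow> t"
    proof (rule tendsto_sandwich[where f = "\<lambda>_. t"])
      show "(\<lambda>m. t + 1 / real (Suc m)) \<longlonglongrightarrow> t"
        using tendsto_add[OF tendsto_const LIMSEQ_inverse_real_of_nat, of t] by (simp add: inverse_eq_divide)
    qed (use ge le in \<open>auto simp del: of_nat_Suc\<close>)
    then have "(\<lambda>m. min b (of_int \<lceil>real (Suc m) * t\<rceil> / real (Suc m))) \<longlonglongrightarrow> min b t"
      by (intro tendsto_min tendsto_const)
    then have lim: "(\<lambda>m. \<rho> m \<omega>) \<longlonglongrightarrow> l" by (simp add: \<rho>_def l_def t_def min.commute)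
    have lr: "l \<le> \<rho> m \<omega>" "\<rho> m \<omega> \<le> b" for m
      using ge[of m] by (auto simp: \<rho>_def l_def t_def)
    have l0: "0 \<le> l" using t0 b0 by (simp add: l_def)
    have "(\<lambda>m. cumul \<kappa> \<omega> (\<rho> m \<omega>)) \<longlonglongrightarrow> cumul \<kappa> \<omega> l"
      by (rule cumul_tendsto[OF w k f lim lr(2)])
    moreover have "cumul \<kappa> \<omega> l < \<infinity>" using cumul_mono[of l b \<kappa> \<omega>] f by (auto simp: l_def intro: order.strict_trans1)
    ultimately have "(\<lambda>m. enn2real (cumul \<kappa> \<omega> (\<rho> m \<omega>))) \<longlonglongrightarrow> enn2real (cumul \<kappa> \<omega> l)"
      by (intro tendsto_enn2real) auto
    with N_right_tendsto[OF w lim lr(1) l0]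
    show "(\<lambda>m. Y m \<omega>) \<longlonglongrightarrow> X \<omega>" unfolding Y_def X_def counted_minus_cumul_def l_def t_def by (intro tendsto_diff)
  qed
  have cphi: "isCont \<phi> x" for x using phi(1) by (simp add: continuous_on_eq_continuous_at)
  have 1: "(\<lambda>m. \<integral>\<omega>. indicator B \<omega> * (\<phi> (Y m \<omega>) * Y m \<omega>) \<partial>R) \<longlonglongrightarrow> (\<integral>\<omega>. indicator B \<omega> * (\<phi> (X \<omega>) * X \<omega>) \<partial>R)"
  proof (rule integral_dominated_convergence[where w = "\<lambda>_. \<bar>C\<bar>"])
    show "AE \<omega> in R. (\<lambda>m. indicator B \<omega> * (\<phi> (Y m \<omega>) * Y m \<omega>)) \<longlonglongrightarrow> indicator B \<omega> * (\<phi> (X \<omega>) * X \<omega>)"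
      using conv by eventually_elim (intro tendsto_intros isCont_tendsto_compose[OF cphi])
    show "AE \<omega> in R. norm (indicator B \<omega> * (\<phi> (Y m \<omega>) * Y m \<omega>)) \<le> \<bar>C\<bar>" for m
      using phi(3) by (intro AE_I2) (auto split: split_indicator intro: order_trans[OF _ abs_ge_self])
  qed auto
  have iB: "integrable R (\<lambda>\<omega>. norm (counted_minus_cumul \<kappa> \<omega> b))" using intg by simp
  have bd: "norm (indicator B \<omega> * (\<phi> y * counted_minus_cumul \<kappa> \<omega> b)) \<le> norm (counted_minus_cumul \<kappa> \<omega> b)" for \<omega> y
    using phi(2)[of y] by (auto split: split_indicator simp: abs_mult mult_left_le_one_le)
  have 2: "(\<lambda>m. \<integral>\<omega>. indicator B \<omega> * (\<phi> (Y m \<omega>) * counted_minus_cumul \<kappa> \<omega> b) \<partial>R) \<longlonglongrightarrow> (\<integral>\<omega>. indicator B \<omega> * (\<phi> (X \<omega>) * counted_minus_cumul \<kappa> \<omega> b) \<partial>R)"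
  proof (rule integral_dominated_convergence[where w = "\<lambda>\<omega>. norm (counted_minus_cumul \<kappa> \<omega> b)"])
    show "AE \<omega> in R. (\<lambda>m. indicator B \<omega> * (\<phi> (Y m \<omega>) * counted_minus_cumul \<kappa> \<omega> b)) \<longlonglongrightarrow> indicator B \<omega> * (\<phi> (X \<omega>) * counted_minus_cumul \<kappa> \<omega> b)"
      using conv by eventually_elim (intro tendsto_intros isCont_tendsto_compose[OF cphi])
  qed (use bd iB in auto)
  have eq: "(\<integral>\<omega>. indicator B \<omega> * (\<phi> (Y m \<omega>) * Y m \<omega>) \<partial>R) = (\<integral>\<omega>. indicator B \<omega> * (\<phi> (Y m \<omega>) * counted_minus_cumul \<kappa> \<omega> b) \<partial>R)" for m
  proof -
    have i1: "integrable R (\<lambda>\<omega>. indicator B \<omega> * (\<phi> (Y m \<omega>) * Y m \<omega>))"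
      using phi(3) by (intro R.integrable_const_bound[where B = "\<bar>C\<bar>"])
         (auto split: split_indicator intro!: AE_I2 intro: order_trans[OF _ abs_ge_self])
    have i2: "integrable R (\<lambda>\<omega>. indicator B \<omega> * (\<phi> (Y m \<omega>) * counted_minus_cumul \<kappa> \<omega> b))"
      by (rule Bochner_Integration.integrable_bound[OF intg]) (use bd in auto)
    have "(\<integral>\<omega>. indicator B \<omega> * \<phi> (Y m \<omega>) * (Y m \<omega> - counted_minus_cumul \<kappa> \<omega> b) \<partial>R) = 0"
      using grid(1)[of m] unfolding Y_def \<rho>_def .
    moreover have "(\<integral>\<omega>. indicator B \<omega> * \<phi> (Y m \<omega>) * (Y m \<omega> - counted_minus_cumul \<kappa> \<omega> b) \<partial>R)
      = (\<integral>\<omega>. indicator B \<omega> * (\<phi> (Y m \<omega>) * Y m \<omega>) - indicator B \<omega> * (\<phi> (Y m \<omega>) * counted_minus_cumul \<kappa> \<omega> b) \<partial>R)"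
      by (simp add: algebra_simps)
    ultimately show ?thesis using i1 i2 by simp
  qed
  show "(\<integral>\<omega>. indicator B \<omega> * (\<phi> (X \<omega>) * X \<omega>) \<partial>R) = (\<integral>\<omega>. indicator B \<omega> * (\<phi> (X \<omega>) * counted_minus_cumul \<kappa> \<omega> b) \<partial>R)"
    using LIMSEQ_unique[OF 1] 2 unfolding eq by auto
qed

text \<open>
  Take \<open>\<phi> x = x / (1 + \<bar>x\<bar>)\<close>, cut off, in \<open>stop_cutoff\<close>. Then \<open>\<phi> x * x \<ge> \<bar>x\<bar> - 1\<close> up to the
  cutoff, while the other side is at most the expectation of \<open>\<bar>X b\<bar>\<close>, where \<open>X\<close> is the compensated
  process.
\<close>

lemma stopped_integrable:
  assumes int: "has_intensity R \<kappa>" and b: "0 \<le> b" "b \<le> T"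
  shows "integrable R (\<lambda>\<omega>. counted_minus_cumul \<kappa> \<omega> (min (jump_time k \<omega>) b))"
proof (cases "k = 0")
  case True
  note spR = has_intensityD(3)[OF int]
  have "integrable R (\<lambda>\<omega>. counted_minus_cumul \<kappa> \<omega> (min (jump_time k \<omega>) b)) \<longleftrightarrow> integrable R (\<lambda>\<omega>. 0 :: real)"
    by (rule Bochner_Integration.integrable_cong)
      (use True jump_time_0 b starts_at_0 spR in \<open>auto simp: counted_minus_cumul_def cumul_def\<close>)
  then show ?thesis by simp
next
  case False
  define X where "X = (\<lambda>\<omega>. counted_minus_cumul \<kappa> \<omega> (min (jump_time k \<omega>) b))"
  note pR = has_intensityD(1)[OF int] and sR = has_intensityD(2)[OF int] and spR = has_intensityD(3)[OF int]
    and intg = has_intensityD(6)[OF int b(1)]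
  interpret R: prob_space R by (rule pR)
  \<comment> \<open>a continuous substitute for the sign function\<close>
  define sg where "sg = (\<lambda>x::real. x / (1 + \<bar>x\<bar>))"
  have sg: "continuous_on UNIV sg" "\<bar>sg x\<bar> \<le> 1" for x
    unfolding sg_def by (auto intro!: continuous_intros simp: add_nonneg_eq_0_iff)
  have [measurable]: "sg \<in> borel_measurable borel" using sg(1) by (rule borel_measurable_continuous_onI)
  have phi: "continuous_on UNIV (\<lambda>x. cutoff c x * sg x)" for c
    by (intro continuous_intros cutoff_cont sg)
  have phi1: "\<bar>cutoff c x * sg x\<bar> \<le> 1" for c x
    using sg(2)[of x] cutoff_bounds[of c x] by (simp add: abs_mult mult_le_one)
  have phi2: "\<bar>cutoff c x * sg x * x\<bar> \<le> real c + 1" for c x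
  proof -
    have "\<bar>cutoff c x * sg x * x\<bar> = \<bar>sg x\<bar> * \<bar>cutoff c x * x\<bar>" by (simp add: abs_mult)
    also have "\<dots> \<le> 1 * (real c + 1)" using sg(2)[of x] cutoff_mult[of c x] by (intro mult_mono) auto
    finally show ?thesis by simp
  qed
  have sp: "space M \<in> sets (F 0)" using sets.top[of "F 0"] by simp
  have sub: "space M \<subseteq> {\<omega>. 0 < jump_time k \<omega>}" using False jump_time_pos by auto
  have X_eq: "counted_minus_cumul \<kappa> \<omega> (min (jump_time k \<omega>) b) = X \<omega>" for \<omega> by (simp add: X_def)
  note cut = stop_cutoff[OF int order_refl b sp sub phi phi1 phi2, unfolded X_eq]
  have [measurable]: "X \<in> borel_measurable R" using cut(2) sR by (simp cong: measurable_cong_sets)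
  have "(\<integral>\<^sup>+\<omega>. ennreal (sg (X \<omega>) * X \<omega>) \<partial>R) \<le> ennreal (\<integral>\<omega>. \<bar>counted_minus_cumul \<kappa> \<omega> b\<bar> \<partial>R)"
  proof -
    have nn: "0 \<le> sg x * x" for x unfolding sg_def by (simp add: mult_nonneg_nonneg zero_le_divide_iff)
    have "(\<integral>\<^sup>+\<omega>. ennreal (sg (X \<omega>) * X \<omega>) \<partial>R) = (\<integral>\<^sup>+\<omega>. (SUP c. ennreal (cutoff c (X \<omega>) * (sg (X \<omega>) * X \<omega>))) \<partial>R)"
    proof (intro nn_integral_cong)
      fix \<omega>
      have "(\<lambda>c. ennreal (cutoff c (X \<omega>) * (sg (X \<omega>) * X \<omega>))) \<longlonglongrightarrow> ennreal (1 * (sg (X \<omega>) * X \<omega>))"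
        by (intro tendsto_intros cutoff_lim)
      moreover have "incseq (\<lambda>c. ennreal (cutoff c (X \<omega>) * (sg (X \<omega>) * X \<omega>)))"
        using cutoff_incseq[of "X \<omega>"] nn[of "X \<omega>"] by (auto simp: incseq_def intro!: ennreal_leI mult_right_mono)
      ultimately show "ennreal (sg (X \<omega>) * X \<omega>) = (SUP c. ennreal (cutoff c (X \<omega>) * (sg (X \<omega>) * X \<omega>)))"
        using LIMSEQ_SUP LIMSEQ_unique by fastforce
    qed
    also have "\<dots> = (SUP c. \<integral>\<^sup>+\<omega>. ennreal (cutoff c (X \<omega>) * (sg (X \<omega>) * X \<omega>)) \<partial>R)"
    proof (rule nn_integral_monotone_convergence_SUP)
      show "incseq (\<lambda>c \<omega>. ennreal (cutoff c (X \<omega>) * (sg (X \<omega>) * X \<omega>)))"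
        using cutoff_incseq nn by (auto simp: incseq_def le_fun_def intro!: ennreal_leI mult_right_mono)
    qed measurable
    also have "\<dots> \<le> ennreal (\<integral>\<omega>. \<bar>counted_minus_cumul \<kappa> \<omega> b\<bar> \<partial>R)"
    proof (rule SUP_least)
      fix c
      have i: "integrable R (\<lambda>\<omega>. cutoff c (X \<omega>) * (sg (X \<omega>) * X \<omega>))"
        using phi2[of c] by (intro R.integrable_const_bound[where B = "real c + 1"]) (auto simp: mult.assoc)
      have i2: "integrable R (\<lambda>\<omega>. cutoff c (X \<omega>) * sg (X \<omega>) * counted_minus_cumul \<kappa> \<omega> b)"
        by (rule Bochner_Integration.integrable_bound[OF intg])
          (use intg phi1[of c] in \<open>auto simp: abs_mult intro!: mult_left_le_one_le\<close>)
      have "(\<integral>\<^sup>+\<omega>. ennreal (cutoff c (X \<omega>) * (sg (X \<omega>) * X \<omega>)) \<partial>R) = ennreal (\<integral>\<omega>. cutoff c (X \<omega>) * (sg (X \<omega>) * X \<omega>) \<partial>R)"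
        using i nn cutoff_bounds(1) by (intro nn_integral_eq_integral) auto
      also have "(\<integral>\<omega>. cutoff c (X \<omega>) * (sg (X \<omega>) * X \<omega>) \<partial>R) = (\<integral>\<omega>. indicator (space M) \<omega> * (cutoff c (X \<omega>) * sg (X \<omega>) * X \<omega>) \<partial>R)"
        by (intro Bochner_Integration.integral_cong refl) (auto simp: spR)
      also have "\<dots> = (\<integral>\<omega>. indicator (space M) \<omega> * (cutoff c (X \<omega>) * sg (X \<omega>) * counted_minus_cumul \<kappa> \<omega> b) \<partial>R)"
        by (rule cut(1))
      also have "\<dots> = (\<integral>\<omega>. cutoff c (X \<omega>) * sg (X \<omega>) * counted_minus_cumul \<kappa> \<omega> b \<partial>R)"
        by (intro Bochner_Integration.integral_cong refl) (auto simp: spR)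
      also have "\<dots> \<le> (\<integral>\<omega>. \<bar>counted_minus_cumul \<kappa> \<omega> b\<bar> \<partial>R)"
      proof (intro integral_mono i2)
        show "integrable R (\<lambda>\<omega>. \<bar>counted_minus_cumul \<kappa> \<omega> b\<bar>)" using intg by simp
        fix \<omega>
        have "cutoff c (X \<omega>) * sg (X \<omega>) * counted_minus_cumul \<kappa> \<omega> b \<le> \<bar>cutoff c (X \<omega>) * sg (X \<omega>)\<bar> * \<bar>counted_minus_cumul \<kappa> \<omega> b\<bar>"
          by (metis abs_ge_self abs_mult)
        also have "\<dots> \<le> \<bar>counted_minus_cumul \<kappa> \<omega> b\<bar>" using phi1[of c "X \<omega>"] by (intro mult_left_le_one_le) auto
        finally show "cutoff c (X \<omega>) * sg (X \<omega>) * counted_minus_cumul \<kappa> \<omega> b \<le> \<bar>counted_minus_cumul \<kappa> \<omega> b\<bar>" .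
      qed
      finally show "(\<integral>\<^sup>+\<omega>. ennreal (cutoff c (X \<omega>) * (sg (X \<omega>) * X \<omega>)) \<partial>R) \<le> ennreal (\<integral>\<omega>. \<bar>counted_minus_cumul \<kappa> \<omega> b\<bar> \<partial>R)"
        by (simp add: ennreal_leI)
    qed
    finally show ?thesis .
  qed
  then have f: "(\<integral>\<^sup>+\<omega>. ennreal (sg (X \<omega>) * X \<omega>) \<partial>R) < \<infinity>" by (rule order.strict_trans1) simp
  have "integrable R (\<lambda>\<omega>. sg (X \<omega>) * X \<omega>)"
    by (rule integrableI_bounded) (use f in \<open>auto simp: sg_def abs_mult mult_nonneg_nonneg\<close>)
  then have "integrable R (\<lambda>\<omega>. 1 + sg (X \<omega>) * X \<omega>)" by simp
  then have "integrable R X"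
  proof (rule Bochner_Integration.integrable_bound)
    have "\<bar>x\<bar> \<le> 1 + sg x * x" for x
    proof -
      have "1 + sg x * x = (1 + \<bar>x\<bar> + x\<^sup>2) / (1 + \<bar>x\<bar>)" unfolding sg_def by (simp add: field_simps power2_eq_square)
      also have "\<dots> \<ge> (\<bar>x\<bar> + \<bar>x\<bar>\<^sup>2) / (1 + \<bar>x\<bar>)" by (intro divide_right_mono) auto
      also have "(\<bar>x\<bar> + \<bar>x\<bar>\<^sup>2) / (1 + \<bar>x\<bar>) = \<bar>x\<bar>"
      proof -
        have "\<bar>x\<bar> + \<bar>x\<bar>\<^sup>2 = \<bar>x\<bar> * (1 + \<bar>x\<bar>)" by (simp add: algebra_simps power2_eq_square)
        then show ?thesis by (simp add: add_nonneg_eq_0_iff)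
      qed
      finally show ?thesis .
    qed
    then show "AE \<omega> in R. norm (X \<omega>) \<le> norm (1 + sg (X \<omega>) * X \<omega>)"
      by (intro AE_I2) (smt (verit) real_norm_def)
  qed auto
  then show ?thesis by (simp add: X_def)
qed

text \<open>
  With the stopped value integrable, the cutoff is removed by dominated convergence.
\<close>

lemma optional_stopping:
  fixes b :: real and k :: nat and \<kappa>
  defines "X \<equiv> \<lambda>\<omega>. counted_minus_cumul \<kappa> \<omega> (min (jump_time k \<omega>) b)"
  assumes int: "has_intensity R \<kappa>" and b: "0 \<le> a" "a \<le> b" "b \<le> T"
    and B: "B \<in> sets (F a)" "B \<subseteq> {\<omega>. a < jump_time k \<omega>}"
  shows "(\<integral>\<omega>. indicator B \<omega> * X \<omega> \<partial>R) = (\<integral>\<omega>. indicator B \<omega> * counted_minus_cumul \<kappa> \<omega> b \<partial>R)"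
proof -
  note sR = has_intensityD(2)[OF int] and intg = has_intensityD(6)[OF int order_trans[OF b(1,2)]]
  have iX: "integrable R X" unfolding X_def using b by (intro stopped_integrable[OF int]) auto
  note [measurable] = borel_measurable_integrable[OF intg] borel_measurable_integrable[OF iX]
  have [measurable]: "B \<in> sets R" using B F_sub_M sR by blast
  have c1: "\<bar>cutoff c x\<bar> \<le> 1" for c x using cutoff_bounds[of c x] by auto
  have X_eq: "counted_minus_cumul \<kappa> \<omega> (min (jump_time k \<omega>) b) = X \<omega>" for \<omega> by (simp add: X_def)
  note cut = stop_cutoff(1)[OF int b B cutoff_cont c1 cutoff_mult, unfolded X_eq]
  have L: "(\<lambda>c. \<integral>\<omega>. indicator B \<omega> * (cutoff c (X \<omega>) * V \<omega>) \<partial>R) \<longlonglongrightarrow> (\<integral>\<omega>. indicator B \<omega> * (1 * V \<omega>) \<partial>R)"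
    if V: "integrable R V" for V
  proof (rule integral_dominated_convergence[where w = "\<lambda>\<omega>. \<bar>V \<omega>\<bar>"])
    note [measurable] = borel_measurable_integrable[OF V]
    show "(\<lambda>\<omega>. indicator B \<omega> * (1 * V \<omega>)) \<in> borel_measurable R"
      "(\<lambda>\<omega>. indicator B \<omega> * (cutoff c (X \<omega>) * V \<omega>)) \<in> borel_measurable R" for c
      by measurable
    show "integrable R (\<lambda>\<omega>. \<bar>V \<omega>\<bar>)" using V by simp
    show "AE \<omega> in R. (\<lambda>c. indicator B \<omega> * (cutoff c (X \<omega>) * V \<omega>)) \<longlonglongrightarrow> indicator B \<omega> * (1 * V \<omega>)"
      by (intro AE_I2 tendsto_intros cutoff_lim)
    show "AE \<omega> in R. norm (indicator B \<omega> * (cutoff c (X \<omega>) * V \<omega>)) \<le> \<bar>V \<omega>\<bar>" for c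
      using c1[of c] by (intro AE_I2) (auto split: split_indicator simp: abs_mult intro!: mult_left_le_one_le)
  qed
  show ?thesis using LIMSEQ_unique[OF L[OF iX, unfolded cut] L[OF intg]] by simp
qed

end

section \<open>The compensator of a single jump\<close>

context counting_process
begin

lemma progressive_M:
  assumes "0 \<le> u"
  shows "(\<lambda>(\<omega>, r). (\<omega>, min r u)) \<in> measurable (M \<Otimes>\<^sub>M borel) pred_sigma"
proof -
  have "sets (F u \<Otimes>\<^sub>M borel) \<subseteq> sets (M \<Otimes>\<^sub>M (borel :: real measure))"
    unfolding sets_pair_measure space_F using F_sub_M[of u] by (intro sigma_sets_mono') blast
  with progressive[OF assms] show ?thesis by (auto simp: measurable_def space_pair_measure)
qed

text \<open>
  The times up to \<open>T\<close> at which exactly \<open>k\<close> jumps lie strictly in the past.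
\<close>

definition level :: "nat \<Rightarrow> 'a \<Rightarrow> real set" where
  "level k \<omega> = {r. jump_time k \<omega> < r \<and> r \<le> jump_time (Suc k) \<omega> \<and> r \<le> T}"

text \<open>
  On the event that the jump happened before \<open>a\<close> both stopped values coincide; on its complement
  optional stopping applies.
\<close>

lemma stopped_martingale:
  assumes int: "has_intensity R \<kappa>" and ab: "0 \<le> a" "a \<le> b" "b \<le> T" and B: "B \<in> sets (F a)"
  shows "(\<integral>\<omega>. indicator B \<omega> * counted_minus_cumul \<kappa> \<omega> (min (jump_time k \<omega>) b) \<partial>R) =
         (\<integral>\<omega>. indicator B \<omega> * counted_minus_cumul \<kappa> \<omega> (min (jump_time k \<omega>) a) \<partial>R)"
proof -
  note sR = has_intensityD(2)[OF int] and spR = has_intensityD(3)[OF int]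
  define B' where "B' = B \<inter> {\<omega>\<in>space M. a < jump_time k \<omega>}"
  have B'F: "B' \<in> sets (F a)" using B jump_time_stopping_gt[OF ab(1), of k] unfolding B'_def by (rule sets.Int)
  have B's: "B' \<subseteq> {\<omega>. a < jump_time k \<omega>}" by (auto simp: B'_def)
  have BR[measurable]: "B \<in> sets R" "B' \<in> sets R" using B B'F F_sub_M sR by blast+
  have ia: "integrable R (\<lambda>\<omega>. counted_minus_cumul \<kappa> \<omega> (min (jump_time k \<omega>) u))" if "0 \<le> u" "u \<le> T" for u
    using stopped_integrable[OF int that] .
  have i1: "integrable R (\<lambda>\<omega>. indicator C \<omega> * counted_minus_cumul \<kappa> \<omega> (min (jump_time k \<omega>) u))"
    if "0 \<le> u" "u \<le> T" "C \<in> sets R" for u C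
    using integrable_mult_indicator[OF that(3) ia[OF that(1,2)]] by simp
  have "(\<integral>\<omega>. indicator B' \<omega> * counted_minus_cumul \<kappa> \<omega> (min (jump_time k \<omega>) b) \<partial>R) = (\<integral>\<omega>. indicator B' \<omega> * counted_minus_cumul \<kappa> \<omega> b \<partial>R)"
    by (rule optional_stopping[OF int ab B'F B's])
  also have "\<dots> = (\<integral>\<omega>. indicator B' \<omega> * counted_minus_cumul \<kappa> \<omega> a \<partial>R)"
    by (rule has_intensity_martingale[OF int ab(1,2)]) (use B'F in \<open>auto split: split_indicator\<close>)
  also have "\<dots> = (\<integral>\<omega>. indicator B' \<omega> * counted_minus_cumul \<kappa> \<omega> (min (jump_time k \<omega>) a) \<partial>R)"
    by (intro Bochner_Integration.integral_cong refl) (auto split: split_indicator simp: B'_def min_def)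
  finally have eq: "(\<integral>\<omega>. indicator B' \<omega> * counted_minus_cumul \<kappa> \<omega> (min (jump_time k \<omega>) b) - indicator B' \<omega> * counted_minus_cumul \<kappa> \<omega> (min (jump_time k \<omega>) a) \<partial>R) = 0"
    using i1[OF _ _ BR(2), of a] i1[OF _ _ BR(2), of b] ab by simp
  have "(\<integral>\<omega>. indicator B \<omega> * counted_minus_cumul \<kappa> \<omega> (min (jump_time k \<omega>) b) - indicator B \<omega> * counted_minus_cumul \<kappa> \<omega> (min (jump_time k \<omega>) a) \<partial>R) = 0"
    unfolding eq[symmetric]
    by (intro Bochner_Integration.integral_cong refl)
      (use ab F_sets_le[OF B] in \<open>auto split: split_indicator simp: B'_def min_def\<close>)
  then show ?thesis using i1[OF _ _ BR(1), of a] i1[OF _ _ BR(1), of b] ab by simp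
qed

text \<open>
  Subtract the martingales stopped at two consecutive jump times. The stopped counts differ exactly
  by the indicator of the later jump, and the stopped compensators by the intensity over the
  level between the two jumps.
\<close>

lemma jump_compensator_rect:
  assumes int: "has_intensity R \<kappa>" and ab: "0 \<le> a" "a \<le> b" "b \<le> T" and B: "B \<in> sets (F a)"
  shows "(\<integral>\<^sup>+\<omega>. indicator B \<omega> * indicator {a<..b} (jump_time (Suc k) \<omega>) \<partial>R) =
    (\<integral>\<^sup>+\<omega>. indicator B \<omega> * (\<integral>\<^sup>+r. \<kappa> (\<omega>, r) * indicator (level k \<omega> \<inter> {a<..b}) r \<partial>lborel) \<partial>R)"
proof -
  note pR = has_intensityD(1)[OF int] and sR = has_intensityD(2)[OF int] and spR = has_intensityD(3)[OF int]
    and k = has_intensityD(4)[OF int] and fin = has_intensityD(5)[OF int T_nonneg]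
  interpret R: prob_space R by (rule pR)
  have a: "0 \<le> a" "a \<le> T" and b: "0 \<le> b" "b \<le> T" using ab by auto
  have BR[measurable]: "B \<in> sets R" using B F_sub_M sR by blast
  have mR: "f \<in> borel_measurable R" if "f \<in> borel_measurable M" for f :: "'a \<Rightarrow> 'c::topological_space"
    using that sR by (simp cong: measurable_cong_sets)
  have [measurable]: "jump_time j \<in> borel_measurable R" for j by (rule mR[OF jump_time_measurable])
  define Y where "Y = (\<lambda>j u \<omega>. min (real j) (N \<omega> u))"
  define G where "G = (\<lambda>j u \<omega>. enn2real (cumul \<kappa> \<omega> (min (jump_time j \<omega>) u)))"
  have XYG: "counted_minus_cumul \<kappa> \<omega> (min (jump_time j \<omega>) u) = Y j u \<omega> - G j u \<omega>" if "\<omega> \<in> space R" "0 \<le> u" "u \<le> T" for j u \<omega>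
    using N_stopped[of \<omega> u j] that spR by (simp add: counted_minus_cumul_def Y_def G_def)
  have iY: "integrable R (Y j u)" if u: "0 \<le> u" for j u
  proof (rule R.integrable_const_bound[where B = "real j"])
    show "Y j u \<in> borel_measurable R"
      unfolding Y_def using mR[OF N_measurable[OF u]] by measurable
    show "AE \<omega> in R. norm (Y j u \<omega>) \<le> real j"
      using N_nonneg[OF _ u] spR by (intro AE_I2) (auto simp: Y_def)
  qed
  have iX: "integrable R (\<lambda>\<omega>. Y j u \<omega> - G j u \<omega>)" if u: "0 \<le> u" "u \<le> T" for j u
  proof -
    have "integrable R (\<lambda>\<omega>. counted_minus_cumul \<kappa> \<omega> (min (jump_time j \<omega>) u)) \<longleftrightarrow> integrable R (\<lambda>\<omega>. Y j u \<omega> - G j u \<omega>)"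
      by (rule Bochner_Integration.integrable_cong) (use XYG u in auto)
    with stopped_integrable[OF int u, of j] show ?thesis by simp
  qed
  have iG: "integrable R (G j u)" if u: "0 \<le> u" "u \<le> T" for j u
    using Bochner_Integration.integrable_diff[OF iY[OF u(1), of j] iX[OF u, of j]] by simp
  note iB = integrable_mult_indicator[OF BR]
  have st: "(\<integral>\<omega>. indicator B \<omega> * (Y j b \<omega> - Y j a \<omega>) \<partial>R) = (\<integral>\<omega>. indicator B \<omega> * (G j b \<omega> - G j a \<omega>) \<partial>R)" for j
  proof -
    have "(\<integral>\<omega>. indicator B \<omega> * (Y j b \<omega> - G j b \<omega>) \<partial>R) = (\<integral>\<omega>. indicator B \<omega> * counted_minus_cumul \<kappa> \<omega> (min (jump_time j \<omega>) b) \<partial>R)"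
      by (intro Bochner_Integration.integral_cong refl) (use XYG b in auto)
    also have "\<dots> = (\<integral>\<omega>. indicator B \<omega> * counted_minus_cumul \<kappa> \<omega> (min (jump_time j \<omega>) a) \<partial>R)"
      by (rule stopped_martingale[OF int ab B])
    also have "\<dots> = (\<integral>\<omega>. indicator B \<omega> * (Y j a \<omega> - G j a \<omega>) \<partial>R)"
      by (intro Bochner_Integration.integral_cong refl) (use XYG a in auto)
    finally show ?thesis
      using iB[OF iY[OF a(1), of j]] iB[OF iY[OF b(1), of j]] iB[OF iG[OF a, of j]] iB[OF iG[OF b, of j]]
      by (simp add: right_diff_distrib)
  qed
  define I where "I = (\<lambda>\<omega>. \<integral>\<^sup>+r. \<kappa> (\<omega>, r) * indicator (level k \<omega> \<inter> {a<..b}) r \<partial>lborel)"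
  define D where "D = (\<lambda>\<omega>. (G (Suc k) b \<omega> - G (Suc k) a \<omega>) - (G k b \<omega> - G k a \<omega>))"
  have "AE \<omega> in R. I \<omega> = ennreal (D \<omega>) \<and> 0 \<le> D \<omega>"
    using fin
  proof (rule AE_mp, intro AE_I2 impI)
    fix \<omega> assume wR: "\<omega> \<in> space R" and f: "cumul \<kappa> \<omega> T < \<infinity>"
    then have w: "\<omega> \<in> space M" by (simp add: spR)
    have [measurable]: "(\<lambda>r. \<kappa> (\<omega>, r)) \<in> borel_measurable borel"
      by (rule measurable_compose[OF section_pred_sigma[OF w] k])
    have [measurable]: "level k \<omega> \<in> sets borel" unfolding level_def by measurable
    have fc: "cumul \<kappa> \<omega> (min t u) < \<infinity>" if "u \<le> T" for t u
      using cumul_mono[of "min t u" T \<kappa> \<omega>] f that by (intro order.strict_trans1[OF _ f] cumul_mono) auto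
    have "cumul \<kappa> \<omega> (min (jump_time (Suc k) \<omega>) b) + cumul \<kappa> \<omega> (min (jump_time k \<omega>) a) =
      cumul \<kappa> \<omega> (min (jump_time (Suc k) \<omega>) a) + cumul \<kappa> \<omega> (min (jump_time k \<omega>) b) + I \<omega>"
      unfolding cumul_def I_def
    proof -
      let ?f = "\<lambda>S r. \<kappa> (\<omega>, r) * indicator S r"
      let ?A = "{0<..min (jump_time (Suc k) \<omega>) b}" and ?B = "{0<..min (jump_time k \<omega>) a}"
        and ?C = "{0<..min (jump_time (Suc k) \<omega>) a}" and ?D = "{0<..min (jump_time k \<omega>) b}"
        and ?E = "level k \<omega> \<inter> {a<..b}"
      have "(\<integral>\<^sup>+r. ?f ?A r \<partial>lborel) + (\<integral>\<^sup>+r. ?f ?B r \<partial>lborel) = (\<integral>\<^sup>+r. ?f ?A r + ?f ?B r \<partial>lborel)"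
        by (intro nn_integral_add[symmetric]) measurable
      also have "\<dots> = (\<integral>\<^sup>+r. ?f ?C r + ?f ?D r + ?f ?E r \<partial>lborel)"
        by (intro nn_integral_cong)
          (use ab jump_time_mono[of k "Suc k" \<omega>] jump_time_bounds(1)[of k \<omega>] in \<open>auto split: split_indicator simp: level_def\<close>)
      also have "\<dots> = (\<integral>\<^sup>+r. ?f ?C r + ?f ?D r \<partial>lborel) + (\<integral>\<^sup>+r. ?f ?E r \<partial>lborel)"
        by (intro nn_integral_add) measurable
      also have "(\<integral>\<^sup>+r. ?f ?C r + ?f ?D r \<partial>lborel) = (\<integral>\<^sup>+r. ?f ?C r \<partial>lborel) + (\<integral>\<^sup>+r. ?f ?D r \<partial>lborel)"
        by (intro nn_integral_add) measurable
      finally show "(\<integral>\<^sup>+r. ?f ?A r \<partial>lborel) + (\<integral>\<^sup>+r. ?f ?B r \<partial>lborel) =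
        (\<integral>\<^sup>+r. ?f ?C r \<partial>lborel) + (\<integral>\<^sup>+r. ?f ?D r \<partial>lborel) + (\<integral>\<^sup>+r. ?f ?E r \<partial>lborel)" .
    qed
    moreover have "I \<omega> < \<infinity>"
      unfolding I_def using f unfolding cumul_def
      by (rule order.strict_trans1[rotated])
        (auto intro!: nn_integral_mono split: split_indicator simp: level_def intro: order.strict_trans1[OF jump_time_bounds(1)])
    ultimately have "enn2real (cumul \<kappa> \<omega> (min (jump_time (Suc k) \<omega>) b)) + enn2real (cumul \<kappa> \<omega> (min (jump_time k \<omega>) a)) =
      enn2real (cumul \<kappa> \<omega> (min (jump_time (Suc k) \<omega>) a)) + enn2real (cumul \<kappa> \<omega> (min (jump_time k \<omega>) b)) + enn2real (I \<omega>)"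
      using fc[OF b(2)] fc[OF a(2)] by (metis enn2real_plus ennreal_add_less_top infinity_ennreal_def)
    then have "D \<omega> = enn2real (I \<omega>)" unfolding D_def G_def by simp
    then show "I \<omega> = ennreal (D \<omega>) \<and> 0 \<le> D \<omega>" using \<open>I \<omega> < \<infinity>\<close> by (simp add: less_top)
  qed
  then have AED: "AE \<omega> in R. indicator B \<omega> * I \<omega> = ennreal (indicator B \<omega> * D \<omega>) \<and> 0 \<le> indicator B \<omega> * D \<omega>"
    by eventually_elim (auto split: split_indicator)
  have iD: "integrable R D" unfolding D_def using iG[OF a] iG[OF b] by simp
  have iBD: "integrable R (\<lambda>\<omega>. indicator B \<omega> * D \<omega>)" using iB[OF iD] by simp
  have "(\<integral>\<^sup>+\<omega>. indicator B \<omega> * I \<omega> \<partial>R) = (\<integral>\<^sup>+\<omega>. ennreal (indicator B \<omega> * D \<omega>) \<partial>R)"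
    using AED by (intro nn_integral_cong_AE) auto
  also have "\<dots> = ennreal (\<integral>\<omega>. indicator B \<omega> * D \<omega> \<partial>R)"
    using AED iBD by (intro nn_integral_eq_integral) auto
  also have "(\<integral>\<omega>. indicator B \<omega> * D \<omega> \<partial>R) =
      (\<integral>\<omega>. indicator B \<omega> * (G (Suc k) b \<omega> - G (Suc k) a \<omega>) - indicator B \<omega> * (G k b \<omega> - G k a \<omega>) \<partial>R)"
    unfolding D_def by (simp add: right_diff_distrib)
  also have "\<dots> = (\<integral>\<omega>. indicator B \<omega> * (G (Suc k) b \<omega> - G (Suc k) a \<omega>) \<partial>R) - (\<integral>\<omega>. indicator B \<omega> * (G k b \<omega> - G k a \<omega>) \<partial>R)"
    using iB[OF Bochner_Integration.integrable_diff[OF iG[OF b, of "Suc k"] iG[OF a, of "Suc k"]]]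
      iB[OF Bochner_Integration.integrable_diff[OF iG[OF b, of "k"] iG[OF a, of "k"]]]
    by (intro Bochner_Integration.integral_diff) auto
  also have "\<dots> = (\<integral>\<omega>. indicator B \<omega> * (Y (Suc k) b \<omega> - Y (Suc k) a \<omega>) \<partial>R) - (\<integral>\<omega>. indicator B \<omega> * (Y k b \<omega> - Y k a \<omega>) \<partial>R)"
    unfolding st ..
  also have "\<dots> = (\<integral>\<omega>. indicator B \<omega> * (Y (Suc k) b \<omega> - Y (Suc k) a \<omega>) - indicator B \<omega> * (Y k b \<omega> - Y k a \<omega>) \<partial>R)"
    using iB[OF Bochner_Integration.integrable_diff[OF iY[OF b(1), of "Suc k"] iY[OF a(1), of "Suc k"]]]
      iB[OF Bochner_Integration.integrable_diff[OF iY[OF b(1), of "k"] iY[OF a(1), of "k"]]]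
    by (intro Bochner_Integration.integral_diff[symmetric]) auto
  also have "\<dots> = (\<integral>\<omega>. indicator B \<omega> * indicator {a<..b} (jump_time (Suc k) \<omega>) \<partial>R)"
  proof (intro Bochner_Integration.integral_cong refl)
    fix \<omega> assume "\<omega> \<in> space R"
    then have w: "\<omega> \<in> space M" by (simp add: spR)
    have Yd: "Y (Suc k) u \<omega> - Y k u \<omega> = (if jump_time (Suc k) \<omega> \<le> u then 1 else 0)" if u: "0 \<le> u" "u \<le> T" for u
    proof -
      obtain n where "N \<omega> u = real n" by (rule N_nat[OF w u(1)])
      then show ?thesis using jump_time_le_iff[OF w u, of "Suc k"] by (auto simp: Y_def min_def)
    qed
    show "indicator B \<omega> * (Y (Suc k) b \<omega> - Y (Suc k) a \<omega>) - indicator B \<omega> * (Y k b \<omega> - Y k a \<omega>) =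
        indicator B \<omega> * (indicator {a<..b} (jump_time (Suc k) \<omega>) :: real)"
      using Yd[OF a] Yd[OF b] ab by (auto split: split_indicator if_splits)
  qed
  also have "ennreal \<dots> = (\<integral>\<^sup>+\<omega>. ennreal (indicator B \<omega> * indicator {a<..b} (jump_time (Suc k) \<omega>)) \<partial>R)"
    by (intro nn_integral_eq_integral[symmetric] R.integrable_const_bound[where B = 1]) 
       (auto split: split_indicator)
  also have "\<dots> = (\<integral>\<^sup>+\<omega>. indicator B \<omega> * indicator {a<..b} (jump_time (Suc k) \<omega>) \<partial>R)"
    by (intro nn_integral_cong) (auto split: split_indicator)
  finally show ?thesis by (simp add: I_def)
qed

text \<open>
  As functions of \<open>H\<close>, both sides are integrals for finite measures on the predictable sigma-algebra,
  and these measures agree on rectangles. This is the form in which the martingale property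
  enters all that follows.
\<close>

lemma jump_compensator:
  assumes int: "has_intensity R \<kappa>" and H: "H \<in> borel_measurable pred_sigma"
  shows "(\<integral>\<^sup>+\<omega>. H (\<omega>, jump_time (Suc k) \<omega>) * indicator {..T} (jump_time (Suc k) \<omega>) \<partial>R) =
    (\<integral>\<^sup>+\<omega>. (\<integral>\<^sup>+r. H (\<omega>, r) * \<kappa> (\<omega>, r) * indicator (level k \<omega>) r \<partial>lborel) \<partial>R)"
proof -
  note pR = has_intensityD(1)[OF int] and sR[measurable_cong] = has_intensityD(2)[OF int] and spR = has_intensityD(3)[OF int]
    and k = has_intensityD(4)[OF int]
  interpret R: prob_space R by (rule pR)
  interpret P: pair_sigma_finite R lborel ..
  have mp: "measurable (R \<Otimes>\<^sub>M lborel) X = measurable (M \<Otimes>\<^sub>M borel) X" for X :: "'c measure"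
    by (intro measurable_cong_sets sets_pair_measure_cong) (auto simp: sR)
  have [measurable]: "jump_time j \<in> borel_measurable R" for j
    using jump_time_measurable[of j] sR by (simp cong: measurable_cong_sets)
  have prog[measurable]: "(\<lambda>(\<omega>, r). (\<omega>, min r T)) \<in> measurable (R \<Otimes>\<^sub>M lborel) pred_sigma"
    unfolding mp by (rule progressive_M[OF T_nonneg])
  have gr[measurable]: "(\<lambda>\<omega>. (\<omega>, min (jump_time (Suc k) \<omega>) T)) \<in> measurable R pred_sigma"
    using F_measurable_M[OF graph_measurable[OF jump_time_measurable_F T_nonneg, of "Suc k"]] sR
    by (simp cong: measurable_cong_sets)
  have lev[measurable]: "{x \<in> space (R \<Otimes>\<^sub>M lborel). snd x \<in> level k (fst x)} \<in> sets (R \<Otimes>\<^sub>M lborel)"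
    unfolding level_def mem_Collect_eq by measurable
  define f1 where "f1 = (\<lambda>\<omega>. indicator {..T} (jump_time (Suc k) \<omega>) :: ennreal)"
  define f2 where "f2 = (\<lambda>x. indicator (level k (fst x)) (snd x) * \<kappa> (fst x, min (snd x) T) :: ennreal)"
  have f1[measurable]: "f1 \<in> borel_measurable R" unfolding f1_def by measurable
  have km[measurable]: "(\<lambda>x. \<kappa> (fst x, min (snd x) T)) \<in> borel_measurable (R \<Otimes>\<^sub>M lborel)"
    using measurable_compose[OF prog k] by (simp add: case_prod_beta')
  have f2[measurable]: "f2 \<in> borel_measurable (R \<Otimes>\<^sub>M lborel)" unfolding f2_def by measurable
  \<comment> \<open>the two sides of the claim, as measures of predictable sets\<close>
  define n1 where "n1 = distr (density R f1) pred_sigma (\<lambda>\<omega>. (\<omega>, min (jump_time (Suc k) \<omega>) T))"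
  define n2 where "n2 = distr (density (R \<Otimes>\<^sub>M lborel) f2) pred_sigma (\<lambda>(\<omega>, r). (\<omega>, min r T))"
  have i1: "(\<integral>\<^sup>+x. G x \<partial>n1) = (\<integral>\<^sup>+\<omega>. G (\<omega>, jump_time (Suc k) \<omega>) * indicator {..T} (jump_time (Suc k) \<omega>) \<partial>R)"
    if G[measurable]: "G \<in> borel_measurable pred_sigma" for G
  proof -
    have "(\<integral>\<^sup>+x. G x \<partial>n1) = (\<integral>\<^sup>+\<omega>. f1 \<omega> * G (\<omega>, min (jump_time (Suc k) \<omega>) T) \<partial>R)"
      unfolding n1_def by (subst nn_integral_distr) (auto simp: nn_integral_density)
    also have "\<dots> = (\<integral>\<^sup>+\<omega>. G (\<omega>, jump_time (Suc k) \<omega>) * indicator {..T} (jump_time (Suc k) \<omega>) \<partial>R)"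
      unfolding f1_def by (intro nn_integral_cong) (auto split: split_indicator simp: min_def)
    finally show ?thesis .
  qed
  have i2: "(\<integral>\<^sup>+x. G x \<partial>n2) = (\<integral>\<^sup>+\<omega>. (\<integral>\<^sup>+r. G (\<omega>, r) * \<kappa> (\<omega>, r) * indicator (level k \<omega>) r \<partial>lborel) \<partial>R)"
    if G[measurable]: "G \<in> borel_measurable pred_sigma" for G
  proof -
    have Gm[measurable]: "(\<lambda>x. G (case x of (\<omega>, r) \<Rightarrow> (\<omega>, min r T))) \<in> borel_measurable (R \<Otimes>\<^sub>M lborel)"
      by (rule measurable_compose[OF prog G])
    have "(\<integral>\<^sup>+x. G x \<partial>n2) = (\<integral>\<^sup>+x. f2 x * G (case x of (\<omega>, r) \<Rightarrow> (\<omega>, min r T)) \<partial>(R \<Otimes>\<^sub>M lborel))"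
      unfolding n2_def by (subst nn_integral_distr) (auto simp: nn_integral_density)
    also have "\<dots> = (\<integral>\<^sup>+\<omega>. (\<integral>\<^sup>+r. f2 (\<omega>, r) * G (\<omega>, min r T) \<partial>lborel) \<partial>R)"
      by (subst lborel.nn_integral_fst[symmetric]) auto
    also have "\<dots> = (\<integral>\<^sup>+\<omega>. (\<integral>\<^sup>+r. G (\<omega>, r) * \<kappa> (\<omega>, r) * indicator (level k \<omega>) r \<partial>lborel) \<partial>R)"
      unfolding f2_def by (intro nn_integral_cong) (auto split: split_indicator simp: min_def level_def mult.commute)
    finally show ?thesis .
  qed
  have "n1 = n2"
  proof (rule measure_eqI_generator_eq)
    let ?E = "{B \<times> {a<..b} | a b B. B \<in> sets (F (max 0 a))}"
    show "Int_stable ?E"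
    proof (rule Int_stableI)
      fix X Y assume "X \<in> ?E" "Y \<in> ?E"
      then obtain a b B a' b' B' where X: "X = B \<times> {a<..b}" "B \<in> sets (F (max 0 a))"
        and Y: "Y = B' \<times> {a'<..b'}" "B' \<in> sets (F (max 0 a'))" by blast
      have "X \<inter> Y = (B \<inter> B') \<times> {max a a'<..min b b'}" unfolding X Y by auto
      moreover have "B \<inter> B' \<in> sets (F (max 0 (max a a')))"
      proof (rule sets.Int)
        have "max 0 a \<le> max 0 (max a a')" "max 0 a' \<le> max 0 (max a a')" by auto
        then show "B \<in> sets (F (max 0 (max a a')))" "B' \<in> sets (F (max 0 (max a a')))"
          using X(2) Y(2) F_mono by blast+
      qed
      ultimately show "X \<inter> Y \<in> ?E" by blast
    qed
    show "?E \<subseteq> Pow (space M \<times> UNIV)" by (auto dest: F_sets_le)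
    show "sets n1 = sigma_sets (space M \<times> UNIV) ?E" "sets n2 = sigma_sets (space M \<times> UNIV) ?E"
      unfolding n1_def n2_def by (simp_all add: sets_pred_sigma)
    let ?A = "\<lambda>i::nat. space M \<times> {- real i<..real i}"
    show "range ?A \<subseteq> ?E" by (auto intro!: exI) (metis sets.top space_F)
    show "(\<Union>i. ?A i) = space M \<times> UNIV"
    proof -
      have "\<exists>i::nat. - real i < r \<and> r \<le> real i" for r
        using reals_Archimedean2[of "\<bar>r\<bar>"] by (auto simp: abs_less_iff intro: less_imp_le)
           (metis less_imp_le minus_less_iff)
      then show ?thesis by auto
    qed
    show "emeasure n1 (?A i) \<noteq> \<infinity>" for i
    proof -
      have A: "?A i \<in> sets pred_sigma" by (intro pred_sigma_rect) (metis sets.top space_F)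
      then have "emeasure n1 (?A i) = (\<integral>\<^sup>+x. indicator (?A i) x \<partial>n1)"
        by (intro nn_integral_indicator[symmetric]) (simp add: n1_def)
      also have "\<dots> \<le> (\<integral>\<^sup>+\<omega>. 1 \<partial>R)"
        unfolding i1[OF borel_measurable_indicator[OF A]]
        by (intro nn_integral_mono) (auto split: split_indicator)
      also have "\<dots> < \<infinity>" by (simp add: R.emeasure_space_1)
      finally show ?thesis by simp
    qed
    fix X assume "X \<in> ?E"
    then obtain a b B where X: "X = B \<times> {a<..b}" "B \<in> sets (F (max 0 a))" by blast
    have XP: "X \<in> sets pred_sigma" unfolding X by (rule pred_sigma_rect[OF X(2)])
    have e1: "emeasure n1 X = (\<integral>\<^sup>+\<omega>. indicator X (\<omega>, jump_time (Suc k) \<omega>) * indicator {..T} (jump_time (Suc k) \<omega>) \<partial>R)"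
      using i1[of "indicator X"] XP by (simp add: n1_def)
    have e2: "emeasure n2 X = (\<integral>\<^sup>+\<omega>. (\<integral>\<^sup>+r. indicator X (\<omega>, r) * \<kappa> (\<omega>, r) * indicator (level k \<omega>) r \<partial>lborel) \<partial>R)"
      using i2[of "indicator X"] XP by (simp add: n2_def)
    define a' where "a' = max 0 a"
    define b' where "b' = min b T"
    have pos: "\<omega> \<in> space R \<Longrightarrow> 0 < jump_time (Suc k) \<omega>" for \<omega> using jump_time_pos[of \<omega> "Suc k"] spR by simp
    have posl: "r \<in> level k \<omega> \<Longrightarrow> 0 < r" for r \<omega> using jump_time_bounds(1)[of k \<omega>] by (auto simp: level_def)
    have e1': "emeasure n1 X = (\<integral>\<^sup>+\<omega>. indicator B \<omega> * indicator {a'<..b'} (jump_time (Suc k) \<omega>) \<partial>R)"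
      unfolding e1 unfolding X a'_def b'_def using pos by (intro nn_integral_cong) (auto split: split_indicator)
    have "indicator X (\<omega>, r) * \<kappa> (\<omega>, r) * indicator (level k \<omega>) r = indicator B \<omega> * (\<kappa> (\<omega>, r) * indicator (level k \<omega> \<inter> {a'<..b'}) r)" for \<omega> r
      unfolding X a'_def b'_def using posl[of r \<omega>] by (auto split: split_indicator simp: level_def)
    then have e2': "emeasure n2 X = (\<integral>\<^sup>+\<omega>. (\<integral>\<^sup>+r. indicator B \<omega> * (\<kappa> (\<omega>, r) * indicator (level k \<omega> \<inter> {a'<..b'}) r) \<partial>lborel) \<partial>R)"
      unfolding e2 by simp
    also have "\<dots> = (\<integral>\<^sup>+\<omega>. indicator B \<omega> * (\<integral>\<^sup>+r. \<kappa> (\<omega>, r) * indicator (level k \<omega> \<inter> {a'<..b'}) r \<partial>lborel) \<partial>R)"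
      by (intro nn_integral_cong) (auto split: split_indicator)
    finally have e2'': "emeasure n2 X = \<dots>" .
    show "emeasure n1 X = emeasure n2 X"
    proof (cases "a' \<le> b'")
      case True
      have X2: "B \<in> sets (F a')" using X(2) by (simp add: a'_def)
      show ?thesis unfolding e1' e2''
        by (rule jump_compensator_rect[OF int _ True _ X2]) (auto simp: a'_def b'_def)
    next
      case False
      then show ?thesis unfolding e1' e2'' by simp
    qed
  qed
  then show ?thesis using i1[OF H] i2[OF H] by simp
qed

end

section \<open>Exponentials of cumulative intensities\<close>

text \<open>
  Integration by parts for an increasing \<open>X\<close> and a decreasing \<open>Y\<close>, as Tonelli's theorem on the
  triangle \<open>r \<le> s\<close>. All terms are arranged so that no subtraction occurs.
\<close>

lemma nn_integral_parts:
  fixes x y :: "real \<Rightarrow> ennreal" and X Y :: "real \<Rightarrow> ennreal"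
  assumes [measurable]: "x \<in> borel_measurable borel" "y \<in> borel_measurable borel" 
    and X: "\<And>s. \<alpha> \<le> s \<Longrightarrow> s \<le> v \<Longrightarrow> X s = X \<alpha> + (\<integral>\<^sup>+r\<in>{\<alpha><..s}. x r \<partial>lborel)"
    and Y: "\<And>r. \<alpha> \<le> r \<Longrightarrow> r \<le> v \<Longrightarrow> Y r = Y v + (\<integral>\<^sup>+s\<in>{r<..v}. y s \<partial>lborel)"
    and le: "\<alpha> \<le> v"
  shows "X v * Y v + (\<integral>\<^sup>+s\<in>{\<alpha><..v}. X s * y s \<partial>lborel) = X \<alpha> * Y \<alpha> + (\<integral>\<^sup>+r\<in>{\<alpha><..v}. x r * Y r \<partial>lborel)"
proof -
  let ?t = "indicator {(r, s). \<alpha> < r \<and> r \<le> s \<and> s \<le> v} :: real \<times> real \<Rightarrow> ennreal"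
  \<comment> \<open>the integral of \<open>x r * y s\<close> over the triangle\<close>
  let ?d = "\<integral>\<^sup>+s. \<integral>\<^sup>+r. x r * y s * ?t (r, s) \<partial>lborel \<partial>lborel"
  have [measurable]: "{(r, s). \<alpha> < r \<and> r \<le> s \<and> s \<le> v} \<in> sets (borel \<Otimes>\<^sub>M (borel :: real measure))"
  proof -
    have "{(r, s). \<alpha> < r \<and> r \<le> s \<and> s \<le> v} =
      {p \<in> space (borel \<Otimes>\<^sub>M borel). \<alpha> < fst p \<and> fst p \<le> snd p \<and> snd p \<le> v}"
      by (auto simp: space_pair_measure)
    also have "\<dots> \<in> sets (borel \<Otimes>\<^sub>M (borel :: real measure))" by measurable
    finally show ?thesis .
  qed
  have swap: "?d = (\<integral>\<^sup>+r. \<integral>\<^sup>+s. x r * y s * ?t (r, s) \<partial>lborel \<partial>lborel)"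
    by (rule lborel_pair.Fubini') measurable
  have "(\<integral>\<^sup>+s\<in>{\<alpha><..v}. X s * y s \<partial>lborel) =
    (\<integral>\<^sup>+s. X \<alpha> * (y s * indicator {\<alpha><..v} s) + (\<integral>\<^sup>+r. x r * y s * ?t (r, s) \<partial>lborel) \<partial>lborel)"
  proof (intro nn_integral_cong)
    fix s
    show "X s * y s * indicator {\<alpha><..v} s = X \<alpha> * (y s * indicator {\<alpha><..v} s) +
      (\<integral>\<^sup>+r. x r * y s * ?t (r, s) \<partial>lborel)"
    proof (cases "s \<in> {\<alpha><..v}")
      case True
      have "(\<integral>\<^sup>+r. x r * y s * ?t (r, s) \<partial>lborel) =
        (\<integral>\<^sup>+r. (x r * indicator {\<alpha><..s} r) * y s \<partial>lborel)"
        using True by (intro nn_integral_cong) (auto split: split_indicator)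
      also have "\<dots> = (\<integral>\<^sup>+r\<in>{\<alpha><..s}. x r \<partial>lborel) * y s"
        by (rule nn_integral_multc) measurable
      finally show ?thesis using True X[of s] by (simp add: distrib_right)
    next
      case False
      then have "(\<integral>\<^sup>+r. x r * y s * ?t (r, s) \<partial>lborel) = (\<integral>\<^sup>+r. 0 \<partial>(lborel :: real measure))"
        by (intro nn_integral_cong) (auto split: split_indicator)
      with False show ?thesis by simp
    qed
  qed
  also have "\<dots> = X \<alpha> * (\<integral>\<^sup>+s\<in>{\<alpha><..v}. y s \<partial>lborel) + ?d"
    by (subst nn_integral_add) (simp_all add: nn_integral_cmult)
  finally have e1: "(\<integral>\<^sup>+s\<in>{\<alpha><..v}. X s * y s \<partial>lborel) = X \<alpha> * (\<integral>\<^sup>+s\<in>{\<alpha><..v}. y s \<partial>lborel) + ?d" .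
  have "(\<integral>\<^sup>+r\<in>{\<alpha><..v}. x r * Y r \<partial>lborel) =
    (\<integral>\<^sup>+r. (x r * indicator {\<alpha><..v} r) * Y v + (\<integral>\<^sup>+s. x r * y s * ?t (r, s) \<partial>lborel) \<partial>lborel)"
  proof (intro nn_integral_cong)
    fix r
    show "x r * Y r * indicator {\<alpha><..v} r = (x r * indicator {\<alpha><..v} r) * Y v +
      (\<integral>\<^sup>+s. x r * y s * ?t (r, s) \<partial>lborel)"
    proof (cases "r \<in> {\<alpha><..v}")
      case True
      have "(\<integral>\<^sup>+s. x r * y s * ?t (r, s) \<partial>lborel) =
        (\<integral>\<^sup>+s. x r * (y s * indicator {r<..v} s) \<partial>lborel)"
        by (rule nn_integral_cong_AE, rule AE_mp[OF AE_lborel_singleton[of r]], rule AE_I2)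
          (use True in \<open>auto split: split_indicator simp: mult.assoc\<close>)
      also have "\<dots> = x r * (\<integral>\<^sup>+s\<in>{r<..v}. y s \<partial>lborel)"
        by (rule nn_integral_cmult) measurable
      finally show ?thesis using True Y[of r] by (simp add: distrib_left)
    next
      case False
      then have "(\<integral>\<^sup>+s. x r * y s * ?t (r, s) \<partial>lborel) = (\<integral>\<^sup>+s. 0 \<partial>(lborel :: real measure))"
        by (intro nn_integral_cong) (auto split: split_indicator)
      with False show ?thesis by simp
    qed
  qed
  also have "\<dots> = (\<integral>\<^sup>+r\<in>{\<alpha><..v}. x r \<partial>lborel) * Y v + ?d"
    unfolding swap by (subst nn_integral_add) (simp_all add: nn_integral_multc)
  finally have e2: "(\<integral>\<^sup>+r\<in>{\<alpha><..v}. x r * Y r \<partial>lborel) = (\<integral>\<^sup>+r\<in>{\<alpha><..v}. x r \<partial>lborel) * Y v + ?d" .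
  have ring: "(a + ix) * b + (a * iy + d) = a * (b + iy) + (ix * b + d)" for a b d ix iy :: ennreal
    by (simp add: distrib_left distrib_right add_ac)
  show ?thesis
    unfolding e1 e2 X[OF le order_refl] Y[OF order_refl le] by (rule ring)
qed

context counting_process
begin

lemma cumul_add:
  assumes w: "\<omega> \<in> space M" and k: "\<kappa> \<in> borel_measurable pred_sigma" and "0 \<le> s" "s \<le> v"
  shows "cumul \<kappa> \<omega> v = cumul \<kappa> \<omega> s + (\<integral>\<^sup>+r\<in>{s<..v}. \<kappa> (\<omega>, r) \<partial>lborel)"
proof -
  have [measurable]: "(\<lambda>r. \<kappa> (\<omega>, r)) \<in> borel_measurable borel"
    by (rule measurable_compose[OF section_pred_sigma[OF w] k])
  show ?thesis unfolding cumul_def using assms(3,4)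
    by (subst nn_integral_add[symmetric]) (auto intro!: nn_integral_cong split: split_indicator)
qed

lemma cumul_time_measurable:
  assumes w: "\<omega> \<in> space M" and k: "\<kappa> \<in> borel_measurable pred_sigma"
  shows "cumul \<kappa> \<omega> \<in> borel_measurable borel"
proof -
  have [measurable]: "(\<lambda>r. \<kappa> (\<omega>, r)) \<in> borel_measurable borel"
    by (rule measurable_compose[OF section_pred_sigma[OF w] k])
  have "cumul \<kappa> \<omega> = (\<lambda>u. \<integral>\<^sup>+r. \<kappa> (\<omega>, r) * (if 0 < r \<and> r \<le> u then 1 else 0) \<partial>lborel)"
    unfolding cumul_def by (intro ext nn_integral_cong) (auto split: split_indicator)
  also have "\<dots> \<in> borel_measurable borel" by measurable
  finally show ?thesis .
qed

text \<open>
  The cumulative intensity maps the measure with density \<open>\<kappa>\<close> to Lebesgue measure, because by continuity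
  it passes through every value between its end points. Applied to exponentials this is the
  fundamental theorem of calculus for a merely integrable \<open>\<kappa>\<close>.
\<close>

lemma clock_change:
  fixes g :: "real \<Rightarrow> ennreal"
  assumes w: "\<omega> \<in> space M" and k: "\<kappa> \<in> borel_measurable pred_sigma" and fin: "cumul \<kappa> \<omega> v < \<infinity>"
    and le: "0 \<le> \<alpha>" "\<alpha> \<le> v" and g[measurable]: "g \<in> borel_measurable borel"
  shows "(\<integral>\<^sup>+r\<in>{\<alpha><..v}. g (enn2real (cumul \<kappa> \<omega> r)) * \<kappa> (\<omega>, r) \<partial>lborel) =
    (\<integral>\<^sup>+x\<in>{enn2real (cumul \<kappa> \<omega> \<alpha>)<..enn2real (cumul \<kappa> \<omega> v)}. g x \<partial>lborel)"
proof -
  define A where "A = (\<lambda>r. enn2real (cumul \<kappa> \<omega> r))"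
  have [measurable]: "(\<lambda>r. \<kappa> (\<omega>, r)) \<in> borel_measurable borel"
    by (rule measurable_compose[OF section_pred_sigma[OF w] k])
  have f: "cumul \<kappa> \<omega> r < \<infinity>" if "r \<le> v" for r using cumul_mono[OF that] fin by (rule order.strict_trans1)
  have Amono: "A r \<le> A s" if "r \<le> s" "s \<le> v" for r s
    unfolding A_def using cumul_mono[OF that(1)] f[OF that(2)] by (intro enn2real_mono) auto
  have Ameas[measurable]: "A \<in> borel_measurable borel"
  proof -
    show ?thesis unfolding A_def using cumul_time_measurable[OF w k] by measurable
  qed
  have Acont: "continuous_on {\<alpha>..v} A"
    unfolding continuous_on_sequentially
  proof (intro ballI allI impI, elim conjE)
    fix l x assume l: "l \<in> {\<alpha>..v}" and x: "\<forall>n. x n \<in> {\<alpha>..v}" "x \<longlonglongrightarrow> l"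
    have "(\<lambda>m. cumul \<kappa> \<omega> (x m)) \<longlonglongrightarrow> cumul \<kappa> \<omega> l"
      using x by (intro cumul_tendsto[OF w k fin]) auto
    then show "(A \<circ> x) \<longlonglongrightarrow> A l" unfolding A_def comp_def using f[of l] l
      by (intro tendsto_enn2real) auto
  qed
  have Aeq: "cumul \<kappa> \<omega> r = ennreal (A r)" "0 \<le> A r" if "r \<le> v" for r
    using f[OF that] by (simp_all add: A_def less_top)
  have incr: "(\<integral>\<^sup>+r\<in>{s<..v}. \<kappa> (\<omega>, r) \<partial>lborel) = ennreal (A v - A s)" if "0 \<le> s" "s \<le> v" for s
  proof -
    have "ennreal (A v) = ennreal (A s) + (\<integral>\<^sup>+r\<in>{s<..v}. \<kappa> (\<omega>, r) \<partial>lborel)"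
      using cumul_add[OF w k that] Aeq that by simp
    then have "ennreal (A v) - ennreal (A s) = (\<integral>\<^sup>+r\<in>{s<..v}. \<kappa> (\<omega>, r) \<partial>lborel)"
      by (metis ennreal_add_diff_cancel_left ennreal_neq_top)
    then show ?thesis using Aeq(2)[OF that(2)] by (simp add: ennreal_minus)
  qed
  define d where "d = density lborel (\<lambda>r. indicator {\<alpha><..v} r * \<kappa> (\<omega>, r))"
  have "distr d borel A = density lborel (indicator {A \<alpha><..A v})"
  proof (rule measure_eqI_lessThan)
    fix x
    have [measurable]: "A -` {x<..} \<in> sets borel" using measurable_sets_borel[OF Ameas, of "{x<..}"] by simp
    have "emeasure (distr d borel A) {x<..} = emeasure d (A -` {x<..})"
      by (subst emeasure_distr) (auto simp: d_def)
    also have "\<dots> = (\<integral>\<^sup>+r. indicator {\<alpha><..v} r * \<kappa> (\<omega>, r) * indicator (A -` {x<..}) r \<partial>lborel)"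
      unfolding d_def by (subst emeasure_density) auto
    finally have e: "emeasure (distr d borel A) {x<..} = \<dots>" .
    have ex: "\<exists>s. \<alpha> \<le> s \<and> s \<le> v \<and> (\<forall>r. \<alpha> < r \<longrightarrow> r \<le> v \<longrightarrow> (x < A r \<longleftrightarrow> s < r)) \<and> A s = max (A \<alpha>) (min x (A v))"
    proof -
      consider "x < A \<alpha>" | "A v \<le> x" | "A \<alpha> \<le> x" "x < A v" by linarith
      then show ?thesis
      proof cases
        case 1
        have "x < A r" if "\<alpha> < r" "r \<le> v" for r using Amono[of \<alpha> r] that 1 by simp
        with 1 show ?thesis using le by (intro exI[of _ \<alpha>]) auto
      next
        case 2
        have "A r \<le> x" if "r \<le> v" for r using Amono[of r v] that 2 by simp
        with 2 show ?thesis using le Amono[OF le(2)]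
          by (intro exI[of _ v]) (auto simp: not_less[symmetric])
      next
        case 3
        define S where "S = {r\<in>{\<alpha>..v}. A r \<le> x}"
        have cS: "closed S" unfolding S_def
          using continuous_closed_preimage[OF Acont, of "{..x}"] by (simp add: vimage_def Int_def conj_commute)
        have S0: "S \<noteq> {}" "bdd_above S" using 3 le by (auto simp: S_def intro!: bdd_aboveI[of _ v])
        define s where "s = Sup S"
        have sS: "s \<in> S" unfolding s_def by (rule closed_contains_Sup[OF S0 cS])
        obtain r0 where r0: "\<alpha> \<le> r0" "r0 \<le> v" "A r0 = x"
          using IVT'[of A \<alpha> x v] 3 le Acont by auto
        have "r0 \<le> s" unfolding s_def using r0 S0 by (intro cSup_upper) (auto simp: S_def)
        then have As: "A s = x" using sS r0 Amono[of r0 s] by (auto simp: S_def)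
        have "x < A r \<longleftrightarrow> s < r" if "\<alpha> < r" "r \<le> v" for r
        proof
          assume "x < A r" then show "s < r" using Amono[of r s] sS As by (auto simp: S_def not_le[symmetric])
        next
          assume "s < r"
          then have "r \<notin> S" unfolding s_def using cSup_upper[OF _ S0(2), of r] by (auto simp: not_le[symmetric])
          then show "x < A r" using that by (auto simp: S_def)
        qed
        then show ?thesis using sS As 3 by (intro exI[of _ s]) (auto simp: S_def)
      qed
    qed
    then obtain s where s: "\<alpha> \<le> s" "s \<le> v" "\<And>r. \<alpha> < r \<Longrightarrow> r \<le> v \<Longrightarrow> (x < A r \<longleftrightarrow> s < r)"
      "A s = max (A \<alpha>) (min x (A v))" by blast
    have "(\<integral>\<^sup>+r. indicator {\<alpha><..v} r * \<kappa> (\<omega>, r) * indicator (A -` {x<..}) r \<partial>lborel) =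
       (\<integral>\<^sup>+r\<in>{s<..v}. \<kappa> (\<omega>, r) \<partial>lborel)"
      by (intro nn_integral_cong) (use s in \<open>auto split: split_indicator\<close>)
    also have "\<dots> = ennreal (A v - A s)" using s le by (intro incr) auto
    finally have l: "emeasure (distr d borel A) {x<..} = ennreal (A v - A s)" using e by simp
    then show "emeasure (distr d borel A) {x<..} < \<infinity>" by simp
    have "emeasure (density lborel (indicator {A \<alpha><..A v})) {x<..} = (\<integral>\<^sup>+r. indicator {max (A \<alpha>) x<..A v} r \<partial>lborel)"
    proof (subst emeasure_density)
      show "(\<integral>\<^sup>+r\<in>{x<..}. indicator {A \<alpha><..A v} r \<partial>lborel) = (\<integral>\<^sup>+r. indicator {max (A \<alpha>) x<..A v} r \<partial>lborel)"
        by (rule nn_integral_cong) (auto split: split_indicator)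
    qed auto
    also have "\<dots> = ennreal (A v - A s)"
      using s(4) Amono[OF le(2)] by (auto simp: max_def min_def)
    finally show "emeasure (distr d borel A) {x<..} = emeasure (density lborel (indicator {A \<alpha><..A v})) {x<..}"
      unfolding l ..
  qed (auto simp: d_def)
  then have "(\<integral>\<^sup>+x. g x \<partial>distr d borel A) = (\<integral>\<^sup>+x. g x \<partial>density lborel (indicator {A \<alpha><..A v}))" by simp
  also have "(\<integral>\<^sup>+x. g x \<partial>distr d borel A) = (\<integral>\<^sup>+r\<in>{\<alpha><..v}. g (A r) * \<kappa> (\<omega>, r) \<partial>lborel)"
    by (subst nn_integral_distr) (auto simp: d_def nn_integral_density intro!: nn_integral_cong simp: mult_ac)
  also have "(\<integral>\<^sup>+x. g x \<partial>density lborel (indicator {A \<alpha><..A v})) = (\<integral>\<^sup>+x\<in>{A \<alpha><..A v}. g x \<partial>lborel)"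
    by (subst nn_integral_density) (auto intro!: nn_integral_cong simp: mult.commute)
  finally show ?thesis unfolding A_def .
qed

text \<open>
  The growth of a likelihood ratio between jumps.
\<close>

definition expo :: "('a \<times> real \<Rightarrow> ennreal) \<Rightarrow> ('a \<times> real \<Rightarrow> ennreal) \<Rightarrow> 'a \<times> real \<Rightarrow> ennreal" where
  "expo \<kappa> \<kappa>' x = ennreal (exp (enn2real (cumul \<kappa> (fst x) (snd x)) - enn2real (cumul \<kappa>' (fst x) (snd x))))"

text \<open>
  Between jumps the exponential of \<open>A - A'\<close> has derivative \<open>\<kappa> - \<kappa>'\<close> times itself. The two
  factors \<open>exp A\<close> and \<open>exp (- A')\<close> are monotone and obey the change of clock, and integration by
  parts combines them.
\<close>

lemma expo_ftc:
  assumes w: "\<omega> \<in> space M" and k: "\<kappa> \<in> borel_measurable pred_sigma" "\<kappa>' \<in> borel_measurable pred_sigma"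
    and fin: "cumul \<kappa> \<omega> v < \<infinity>" "cumul \<kappa>' \<omega> v < \<infinity>" and le: "0 \<le> \<alpha>" "\<alpha> \<le> v"
  shows "expo \<kappa> \<kappa>' (\<omega>, v) + (\<integral>\<^sup>+r\<in>{\<alpha><..v}. expo \<kappa> \<kappa>' (\<omega>, r) * \<kappa>' (\<omega>, r) \<partial>lborel) =
    expo \<kappa> \<kappa>' (\<omega>, \<alpha>) + (\<integral>\<^sup>+r\<in>{\<alpha><..v}. expo \<kappa> \<kappa>' (\<omega>, r) * \<kappa> (\<omega>, r) \<partial>lborel)"
proof -
  have [measurable]: "(\<lambda>r. \<kappa> (\<omega>, r)) \<in> borel_measurable borel" "(\<lambda>r. \<kappa>' (\<omega>, r)) \<in> borel_measurable borel"
    by (rule measurable_compose[OF section_pred_sigma[OF w]], fact)+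
  define A where "A = (\<lambda>r. enn2real (cumul \<kappa> \<omega> r))"
  define A' where "A' = (\<lambda>r. enn2real (cumul \<kappa>' \<omega> r))"
  have [measurable]: "A \<in> borel_measurable borel" "A' \<in> borel_measurable borel"
    unfolding A_def A'_def using cumul_time_measurable[OF w k(1)] cumul_time_measurable[OF w k(2)] by measurable
  have f: "cumul \<kappa> \<omega> r < \<infinity>" "cumul \<kappa>' \<omega> r < \<infinity>" if "r \<le> v" for r
    using cumul_mono[OF that] fin order.strict_trans1 by blast+
  have Am: "A r \<le> A s" "A' r \<le> A' s" if "r \<le> s" "s \<le> v" for r s
    unfolding A_def A'_def using cumul_mono[OF that(1)] f[OF that(2)] by (auto intro!: enn2real_mono)
  have I: "(\<integral>\<^sup>+x\<in>{a<..b}. g x \<partial>lborel) = ennreal (G b - G a)"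
    if "a \<le> b" "\<And>x. (G has_real_derivative h x) (at x)" "\<And>x. 0 \<le> h x" "h \<in> borel_measurable borel" "g = (\<lambda>x. ennreal (h x))" for a b :: real and g G h
  proof -
    have "(\<integral>\<^sup>+x\<in>{a<..b}. g x \<partial>lborel) = (\<integral>\<^sup>+x. ennreal (h x) * indicator {a..b} x \<partial>lborel)"
      unfolding that(5) 
      by (rule nn_integral_cong_AE, rule AE_mp[OF AE_lborel_singleton[of a]], rule AE_I2) (auto split: split_indicator)
    also have "\<dots> = ennreal (G b - G a)"
      using that by (intro nn_integral_FTC_Icc) auto
    finally show ?thesis .
  qed
  have "ennreal (exp (A v)) * ennreal (exp (- A' v)) +
    (\<integral>\<^sup>+s\<in>{\<alpha><..v}. ennreal (exp (A s)) * (ennreal (exp (- A' s)) * \<kappa>' (\<omega>, s)) \<partial>lborel) =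
    ennreal (exp (A \<alpha>)) * ennreal (exp (- A' \<alpha>)) + (\<integral>\<^sup>+r\<in>{\<alpha><..v}. (ennreal (exp (A r)) * \<kappa> (\<omega>, r)) * ennreal (exp (- A' r)) \<partial>lborel)"
  proof (rule nn_integral_parts[OF _ _ _ _ le(2)])
    fix s assume s: "\<alpha> \<le> s" "s \<le> v"
    have "(\<integral>\<^sup>+r\<in>{\<alpha><..s}. ennreal (exp (A r)) * \<kappa> (\<omega>, r) \<partial>lborel) = (\<integral>\<^sup>+x\<in>{A \<alpha><..A s}. ennreal (exp x) \<partial>lborel)"
      unfolding A_def using s le f[OF s(2)] by (intro clock_change[OF w k(1)]) auto
    also have "\<dots> = ennreal (exp (A s) - exp (A \<alpha>))"
      by (rule I[where h = exp]) (use Am[OF s] in \<open>auto intro!: derivative_eq_intros\<close>)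
    finally show "ennreal (exp (A s)) = ennreal (exp (A \<alpha>)) + (\<integral>\<^sup>+r\<in>{\<alpha><..s}. ennreal (exp (A r)) * \<kappa> (\<omega>, r) \<partial>lborel)"
      using Am[OF s] by (simp add: ennreal_plus[symmetric] del: ennreal_plus)
    have "(\<integral>\<^sup>+r\<in>{s<..v}. ennreal (exp (- A' r)) * \<kappa>' (\<omega>, r) \<partial>lborel) = (\<integral>\<^sup>+x\<in>{A' s<..A' v}. ennreal (exp (- x)) \<partial>lborel)"
      unfolding A'_def using s le f[OF order_refl] 
      by (intro clock_change[OF w k(2), where g = "\<lambda>x. ennreal (exp (- x))"]) auto
    also have "\<dots> = ennreal ((- exp (- A' v)) - (- exp (- A' s)))"
      by (rule I[where h = "\<lambda>x. exp (- x)"]) (use Am[OF s(2) order_refl] in \<open>auto intro!: derivative_eq_intros\<close>)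
    finally show "ennreal (exp (- A' s)) = ennreal (exp (- A' v)) + (\<integral>\<^sup>+r\<in>{s<..v}. ennreal (exp (- A' r)) * \<kappa>' (\<omega>, r) \<partial>lborel)"
      using Am[OF s(2) order_refl] by (simp add: ennreal_plus[symmetric] del: ennreal_plus)
  qed measurable
  moreover have E: "ennreal (exp (A r)) * ennreal (exp (- A' r)) = expo \<kappa> \<kappa>' (\<omega>, r)" for r
    by (simp add: expo_def A_def A'_def ennreal_mult[symmetric] exp_add[symmetric])
  moreover have "ennreal (exp (A r)) * (ennreal (exp (- A' r)) * y) = expo \<kappa> \<kappa>' (\<omega>, r) * y" for r y
    unfolding E[symmetric] by (rule mult.assoc[symmetric])
  moreover have "(ennreal (exp (A r)) * y) * ennreal (exp (- A' r)) = expo \<kappa> \<kappa>' (\<omega>, r) * y" for r y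
    unfolding E[symmetric] by (simp only: mult_ac)
  ultimately show ?thesis by (simp only:)
qed

end

section \<open>Expectations between consecutive jumps\<close>

context counting_process
begin

lemma jump_graph_measurable: "(\<lambda>\<omega>. (\<omega>, jump_time k \<omega>)) \<in> measurable M pred_sigma"
proof -
  have "(\<lambda>\<omega>. (\<omega>, min (jump_time k \<omega>) (T + 1))) \<in> measurable (F (T + 1)) pred_sigma"
    using T_nonneg by (intro graph_measurable F_measurable_mono[OF _ jump_time_measurable_F]) auto
  then show ?thesis using jump_time_bounds(2)[of k] F_measurable_M by (simp add: min_absorb1)
qed

text \<open>
  By left continuity the cumulative intensity is the supremum of its values at earlier rational times.
\<close>

lemma cumul_pred_sigma:
  assumes k: "\<kappa> \<in> borel_measurable pred_sigma"
  shows "(\<lambda>x. cumul \<kappa> (fst x) (snd x)) \<in> borel_measurable pred_sigma"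
proof -
  let ?k = "\<lambda>\<omega> u n r. \<kappa> (\<omega>, r) * indicator {0<..u - 1 / real (Suc n)} r"
  let ?Q = "\<rat> \<inter> {0<..} :: real set"
  have 1: "(\<lambda>x. if q < snd x then cumul \<kappa> (fst x) q else 0) \<in> borel_measurable pred_sigma" if q: "0 < q" for q
  proof (rule borel_measurableI_greater)
    fix y
    have "{x \<in> space pred_sigma. y < (if q < snd x then cumul \<kappa> (fst x) q else 0)} =
      {\<omega> \<in> space M. y < cumul \<kappa> \<omega> q} \<times> {q<..}"
      by auto
    also have "\<dots> \<in> sets pred_sigma"
    proof (rule pred_sigma_rect_greater)
      have [measurable]: "(\<lambda>\<omega>. cumul \<kappa> \<omega> q) \<in> borel_measurable (F q)"
        using q by (intro cumul_F_measurable[OF k]) auto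
      have "{\<omega> \<in> space (F q). y < cumul \<kappa> \<omega> q} \<in> sets (F q)" by measurable
      then show "{\<omega> \<in> space M. y < cumul \<kappa> \<omega> q} \<in> sets (F (max 0 q))" using q by simp
    qed
    finally show "{x \<in> space pred_sigma. y < (if q < snd x then cumul \<kappa> (fst x) q else 0)} \<in> sets pred_sigma" .
  qed
  have eq: "cumul \<kappa> (fst x) (snd x) = (SUP q\<in>?Q. if q < snd x then cumul \<kappa> (fst x) q else 0)"
    if x: "x \<in> space pred_sigma" for x
  proof (rule antisym)
    obtain \<omega> u where xe: "x = (\<omega>, u)" "\<omega> \<in> space M" using x by auto
    let ?S = "SUP q\<in>?Q. if q < snd x then cumul \<kappa> (fst x) q else 0"
    show "?S \<le> cumul \<kappa> (fst x) (snd x)"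
      by (intro SUP_least) (auto intro: cumul_mono)
    have [measurable]: "(\<lambda>r. \<kappa> (\<omega>, r)) \<in> borel_measurable borel"
      by (rule measurable_compose[OF section_pred_sigma[OF xe(2)] k])
    show "cumul \<kappa> (fst x) (snd x) \<le> ?S"
    proof (cases "0 < u")
      case False
      then have "{0<..u} = {}" by auto
      then show ?thesis by (simp add: cumul_def xe)
    next
      case u: True
      have "cumul \<kappa> \<omega> u = (\<integral>\<^sup>+r. (SUP n. ?k \<omega> u n r) \<partial>lborel)"
        unfolding cumul_def
      proof (rule nn_integral_cong_AE, rule AE_mp[OF AE_lborel_singleton[of u]], rule AE_I2, rule impI)
        fix r assume "r \<noteq> u"
        show "\<kappa> (\<omega>, r) * indicator {0<..u} r = (SUP n. ?k \<omega> u n r)"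
        proof (cases "0 < r \<and> r < u")
          case True
          then obtain n where "inverse (real (Suc n)) < u - r" using reals_Archimedean[of "u - r"] by auto
          then have n: "r \<le> u - 1 / real (Suc n)" by (simp add: inverse_eq_divide)
          have "(SUP n. ?k \<omega> u n r) = \<kappa> (\<omega>, r)"
          proof (rule antisym)
            show "(SUP n. ?k \<omega> u n r) \<le> \<kappa> (\<omega>, r)"
              by (intro SUP_least) (auto split: split_indicator)
            show "\<kappa> (\<omega>, r) \<le> (SUP n. ?k \<omega> u n r)"
              using True n by (intro SUP_upper2[of n]) auto
          qed
          then show ?thesis using True by simp
        next
          case False
          have "1 / real (Suc n) > 0" for n by simp
          then have "r \<notin> {0<..u - 1 / real (Suc n)}" for n using False \<open>r \<noteq> u\<close> u
            by (smt (verit) greaterThanAtMost_iff)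
          then show ?thesis using False \<open>r \<noteq> u\<close> by (auto split: split_indicator)
        qed
      qed
      also have "\<dots> = (SUP n. cumul \<kappa> \<omega> (u - 1 / real (Suc n)))"
        unfolding cumul_def
      proof (rule nn_integral_monotone_convergence_SUP)
        show "incseq (\<lambda>n r. ?k \<omega> u n r)"
        proof (intro incseq_SucI le_funI)
          fix n r
          have "1 / real (Suc (Suc n)) \<le> 1 / real (Suc n)" by (intro divide_left_mono) auto
          then show "?k \<omega> u n r \<le> \<kappa> (\<omega>, r) * indicator {0<..u - 1 / real (Suc (Suc n))} r"
            by (auto split: split_indicator)
        qed
      qed measurable
      also have "\<dots> \<le> ?S"
      proof (rule SUP_least)
        fix n
        have "max 0 (u - 1 / real (Suc n)) < u" using u by (auto simp: max_def)
        then obtain q where q: "q \<in> \<rat>" "max 0 (u - 1 / real (Suc n)) < q" "q < u"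
          using Rats_dense_in_real[of "max 0 (u - 1 / real (Suc n))" u] by auto
        then have "cumul \<kappa> \<omega> (u - 1 / real (Suc n)) \<le> cumul \<kappa> \<omega> q" by (intro cumul_mono) auto
        then show "cumul \<kappa> \<omega> (u - 1 / real (Suc n)) \<le> ?S"
          using q by (intro SUP_upper2[of q]) (auto simp: xe)
      qed
      finally show ?thesis by (simp add: xe)
    qed
  qed
  have "(\<lambda>x. cumul \<kappa> (fst x) (snd x)) \<in> borel_measurable pred_sigma \<longleftrightarrow>
    (\<lambda>x. SUP q\<in>?Q. if q < snd x then cumul \<kappa> (fst x) q else 0) \<in> borel_measurable pred_sigma"
    by (rule measurable_cong) (rule eq)
  also have "\<dots>"
    by (rule borel_measurable_SUP) (auto intro: 1 countable_rat countable_subset[OF _ countable_rat])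
  finally show ?thesis .
qed

lemma expo_pred_sigma[measurable]:
  assumes k: "\<kappa> \<in> borel_measurable pred_sigma" "\<kappa>' \<in> borel_measurable pred_sigma"
  shows "expo \<kappa> \<kappa>' \<in> borel_measurable pred_sigma"
  unfolding expo_def using cumul_pred_sigma[OF k(1)] cumul_pred_sigma[OF k(2)] by measurable

text \<open>
  The value of \<open>w\<close> is known at the \<open>k\<close>-th jump: shown from that jump on, it is a predictable process.
\<close>

definition prior :: "nat \<Rightarrow> ('a \<Rightarrow> ennreal) \<Rightarrow> bool" where
  "prior k w \<longleftrightarrow> (\<lambda>x. w (fst x) * indicator {x. jump_time k (fst x) < snd x} x) \<in> borel_measurable pred_sigma"

lemma prior_measurable:
  assumes "prior k w" shows "w \<in> borel_measurable M"
proof -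
  \<comment> \<open>all jump times are at most \<open>T + 1\<close>, so time \<open>T + 2\<close> sees all of \<open>w\<close>\<close>
  have "(\<lambda>\<omega>. (\<omega>, T + 2)) \<in> measurable M pred_sigma"
    using F_measurable_M[OF pred_sigma_snd_const[of "T + 2"]] T_nonneg by simp
  from measurable_compose[OF this assms[unfolded prior_def]]
  have "(\<lambda>\<omega>. w \<omega> * indicator {x. jump_time k (fst x) < snd x} (\<omega>, T + 2)) \<in> borel_measurable M" by simp
  moreover have "jump_time k \<omega> < T + 2" for \<omega> using jump_time_bounds(2)[of k \<omega>] by simp
  ultimately show ?thesis by simp
qed

lemma prior_min:
  assumes "prior k w" shows "prior k (\<lambda>\<omega>. min (w \<omega>) c)"
proof -
  have "(\<lambda>x. min (w (fst x)) c * indicator {x. jump_time k (fst x) < snd x} x) =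
    (\<lambda>x. min (w (fst x) * indicator {x. jump_time k (fst x) < snd x} x) c)"
    by (auto split: split_indicator)
  then show ?thesis using assms unfolding prior_def by simp
qed

text \<open>
  Follow \<open>e\<close> from the \<open>k\<close>-th jump to the next jump or to \<open>u\<close>, whichever comes first. If \<open>u\<close> comes first,
  there are exactly \<open>k\<close> jumps up to \<open>u\<close>; if the jump comes first, \<open>jump_compensator\<close> replaces the
  value at the jump by an integral.
\<close>

lemma split_at_next_jump:
  assumes int: "has_intensity R \<kappa>" and e: "e \<in> borel_measurable pred_sigma" and w: "prior k w" and u: "0 \<le> u" "u \<le> T"
  shows "(\<integral>\<^sup>+\<omega>. w \<omega> * e (\<omega>, min u (jump_time (Suc k) \<omega>)) * indicator {..u} (jump_time k \<omega>) \<partial>R) =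
    (\<integral>\<^sup>+\<omega>. w \<omega> * e (\<omega>, u) * indicator {real k} (N \<omega> u) \<partial>R) +
    (\<integral>\<^sup>+\<omega>. (\<integral>\<^sup>+r. w \<omega> * (e (\<omega>, r) * \<kappa> (\<omega>, r)) * indicator (level k \<omega> \<inter> {..u}) r \<partial>lborel) \<partial>R)"
proof -
  note sR[measurable_cong] = has_intensityD(2)[OF int] and spR = has_intensityD(3)[OF int]
  have [measurable]: "jump_time j \<in> borel_measurable R" for j
    using jump_time_measurable[of j] sR by (simp cong: measurable_cong_sets)
  have [measurable]: "w \<in> borel_measurable R" using prior_measurable[OF w] sR by (simp cong: measurable_cong_sets)
  have [measurable]: "(\<lambda>\<omega>. N \<omega> u) \<in> borel_measurable R" using N_measurable[OF u(1)] sR by (simp cong: measurable_cong_sets)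
  have [measurable]: "(\<lambda>\<omega>. e (\<omega>, u)) \<in> borel_measurable R"
    using F_measurable_M[OF measurable_compose[OF pred_sigma_snd_const[OF u(1)] e]] sR by (simp cong: measurable_cong_sets)
  have [measurable]: "(\<lambda>\<omega>. e (\<omega>, jump_time j \<omega>)) \<in> borel_measurable R" for j
    using measurable_compose[OF jump_graph_measurable e] sR by (simp cong: measurable_cong_sets)
  define H where "H = (\<lambda>x. (w (fst x) * indicator {x. jump_time k (fst x) < snd x} x) * (e x * indicator {..u} (snd x)))"
  have H: "H \<in> borel_measurable pred_sigma"
    unfolding H_def using w[unfolded prior_def] e by measurable
  have "(\<integral>\<^sup>+\<omega>. w \<omega> * e (\<omega>, min u (jump_time (Suc k) \<omega>)) * indicator {..u} (jump_time k \<omega>) \<partial>R) =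
    (\<integral>\<^sup>+\<omega>. w \<omega> * e (\<omega>, u) * indicator {real k} (N \<omega> u) +
      w \<omega> * e (\<omega>, jump_time (Suc k) \<omega>) * indicator {..u} (jump_time (Suc k) \<omega>) \<partial>R)"
  proof (intro nn_integral_cong)
    fix \<omega> assume "\<omega> \<in> space R"
    then have "N \<omega> u = real k \<longleftrightarrow> jump_time k \<omega> \<le> u \<and> u < jump_time (Suc k) \<omega>"
      using N_eq_iff[OF _ u] spR by simp
    then show "w \<omega> * e (\<omega>, min u (jump_time (Suc k) \<omega>)) * indicator {..u} (jump_time k \<omega>) =
      w \<omega> * e (\<omega>, u) * indicator {real k} (N \<omega> u) +
      w \<omega> * e (\<omega>, jump_time (Suc k) \<omega>) * indicator {..u} (jump_time (Suc k) \<omega>)"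
      using jump_time_mono[of k "Suc k" \<omega>] by (auto split: split_indicator simp: min_def)
  qed
  also have "\<dots> = (\<integral>\<^sup>+\<omega>. w \<omega> * e (\<omega>, u) * indicator {real k} (N \<omega> u) \<partial>R) +
      (\<integral>\<^sup>+\<omega>. w \<omega> * e (\<omega>, jump_time (Suc k) \<omega>) * indicator {..u} (jump_time (Suc k) \<omega>) \<partial>R)"
    by (rule nn_integral_add) measurable
  also have "(\<integral>\<^sup>+\<omega>. w \<omega> * e (\<omega>, jump_time (Suc k) \<omega>) * indicator {..u} (jump_time (Suc k) \<omega>) \<partial>R) =
    (\<integral>\<^sup>+\<omega>. H (\<omega>, jump_time (Suc k) \<omega>) * indicator {..T} (jump_time (Suc k) \<omega>) \<partial>R)"
  proof (intro nn_integral_cong)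
    fix \<omega> assume "\<omega> \<in> space R"
    then have "jump_time k \<omega> < jump_time (Suc k) \<omega>" if "jump_time (Suc k) \<omega> \<le> u"
      using jump_time_strict[of \<omega> k] jump_time_mono[of k "Suc k" \<omega>] that u spR by auto
    then show "w \<omega> * e (\<omega>, jump_time (Suc k) \<omega>) * indicator {..u} (jump_time (Suc k) \<omega>) =
       H (\<omega>, jump_time (Suc k) \<omega>) * indicator {..T} (jump_time (Suc k) \<omega>)"
      unfolding H_def using u by (auto split: split_indicator)
  qed
  also have "\<dots> = (\<integral>\<^sup>+\<omega>. (\<integral>\<^sup>+r. H (\<omega>, r) * \<kappa> (\<omega>, r) * indicator (level k \<omega>) r \<partial>lborel) \<partial>R)"
    by (rule jump_compensator[OF int H])
  also have "\<dots> = (\<integral>\<^sup>+\<omega>. (\<integral>\<^sup>+r. w \<omega> * (e (\<omega>, r) * \<kappa> (\<omega>, r)) * indicator (level k \<omega> \<inter> {..u}) r \<partial>lborel) \<partial>R)"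
    unfolding H_def by (intro nn_integral_cong) (auto split: split_indicator simp: level_def mult.assoc)
  finally show ?thesis .
qed

lemma level_Int_atMost:
  "u \<le> T \<Longrightarrow> level k \<omega> \<inter> {..u} = {jump_time k \<omega><..min u (jump_time (Suc k) \<omega>)}"
  unfolding level_def by auto

lemma inner_measurable:
  assumes sR: "sets R = sets M" and G: "G \<in> borel_measurable pred_sigma" and u: "0 \<le> u" "u \<le> T"
    and w: "w \<in> borel_measurable M"
  shows "(\<lambda>\<omega>. \<integral>\<^sup>+r. w \<omega> * G (\<omega>, r) * indicator (level k \<omega> \<inter> {..u}) r \<partial>lborel) \<in> borel_measurable R"
proof -
  have 1: "(\<lambda>x. G (fst x, min (snd x) u)) \<in> borel_measurable (M \<Otimes>\<^sub>M lborel)"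
    using measurable_compose[OF progressive_M[OF u(1)] G]
    by (simp add: case_prod_beta' cong: measurable_cong_sets)
  note [measurable] = 1 w jump_time_measurable
  have "(\<lambda>\<omega>. \<integral>\<^sup>+r. w \<omega> * G (\<omega>, min r u) *
     (if jump_time k \<omega> < r \<and> r \<le> jump_time (Suc k) \<omega> \<and> r \<le> T \<and> r \<le> u then 1 else 0) \<partial>lborel) \<in> borel_measurable M"
    by measurable
  also have "(\<lambda>\<omega>. \<integral>\<^sup>+r. w \<omega> * G (\<omega>, min r u) *
     (if jump_time k \<omega> < r \<and> r \<le> jump_time (Suc k) \<omega> \<and> r \<le> T \<and> r \<le> u then 1 else 0) \<partial>lborel) =
    (\<lambda>\<omega>. \<integral>\<^sup>+r. w \<omega> * G (\<omega>, r) * indicator (level k \<omega> \<inter> {..u}) r \<partial>lborel)"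
    by (intro ext nn_integral_cong) (auto split: split_indicator simp: level_def min_def)
  finally show ?thesis using sR by (simp cong: measurable_cong_sets)
qed

text \<open>
  Dropping the exponential once the cumulative intensity exceeds \<open>n\<close> keeps expectations finite.
\<close>

definition expo_cut :: "nat \<Rightarrow> ('a \<times> real \<Rightarrow> ennreal) \<Rightarrow> ('a \<times> real \<Rightarrow> ennreal) \<Rightarrow> 'a \<times> real \<Rightarrow> ennreal" where
  "expo_cut n \<kappa> \<kappa>' x = (if cumul \<kappa> (fst x) (snd x) \<le> of_nat n then expo \<kappa> \<kappa>' x else 0)"

lemma expo_cut_pred_sigma:
  assumes k: "\<kappa> \<in> borel_measurable pred_sigma" "\<kappa>' \<in> borel_measurable pred_sigma"
  shows "expo_cut n \<kappa> \<kappa>' \<in> borel_measurable pred_sigma"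
  unfolding expo_cut_def using cumul_pred_sigma[OF k(1)] expo_pred_sigma[OF k] by measurable

lemma expo_cut_bound: "expo_cut n \<kappa> \<kappa>' x \<le> ennreal (exp (real n))"
proof (cases "cumul \<kappa> (fst x) (snd x) \<le> of_nat n")
  case True
  then have "enn2real (cumul \<kappa> (fst x) (snd x)) \<le> real n"
    by (metis enn2real_leI ennreal_of_nat_eq_real_of_nat of_nat_0_le_iff)
  then have "enn2real (cumul \<kappa> (fst x) (snd x)) - enn2real (cumul \<kappa>' (fst x) (snd x)) \<le> real n"
    using enn2real_nonneg[of "cumul \<kappa>' (fst x) (snd x)"] by linarith
  then show ?thesis using True by (simp add: expo_cut_def expo_def ennreal_leI)
qed (simp add: expo_cut_def)

text \<open>
  The truncated exponential satisfies \<open>expo_ftc\<close> up to the last time at which the cumulative intensity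
  is at most \<open>n\<close>. After that it vanishes, which turns the equation into an inequality.
\<close>

lemma expo_cut_ftc:
  assumes w: "\<omega> \<in> space M" and k: "\<kappa> \<in> borel_measurable pred_sigma" "\<kappa>' \<in> borel_measurable pred_sigma"
    and fin: "cumul \<kappa> \<omega> v < \<infinity>" "cumul \<kappa>' \<omega> v < \<infinity>" and le: "0 \<le> \<alpha>" "\<alpha> \<le> v"
  shows "expo_cut n \<kappa> \<kappa>' (\<omega>, v) + (\<integral>\<^sup>+r\<in>{\<alpha><..v}. expo_cut n \<kappa> \<kappa>' (\<omega>, r) * \<kappa>' (\<omega>, r) \<partial>lborel) \<le>
    expo_cut n \<kappa> \<kappa>' (\<omega>, \<alpha>) + (\<integral>\<^sup>+r\<in>{\<alpha><..v}. expo_cut n \<kappa> \<kappa>' (\<omega>, r) * \<kappa> (\<omega>, r) \<partial>lborel)"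
proof -
  have upto: "expo_cut n \<kappa> \<kappa>' (\<omega>, s) + (\<integral>\<^sup>+r\<in>{\<alpha><..s}. expo_cut n \<kappa> \<kappa>' (\<omega>, r) * \<kappa>' (\<omega>, r) \<partial>lborel) =
    expo_cut n \<kappa> \<kappa>' (\<omega>, \<alpha>) + (\<integral>\<^sup>+r\<in>{\<alpha><..s}. expo_cut n \<kappa> \<kappa>' (\<omega>, r) * \<kappa> (\<omega>, r) \<partial>lborel)"
    if s: "\<alpha> \<le> s" "s \<le> v" "cumul \<kappa> \<omega> s \<le> of_nat n" for s
  proof -
    have eq: "expo_cut n \<kappa> \<kappa>' (\<omega>, r) = expo \<kappa> \<kappa>' (\<omega>, r)" if "r \<le> s" for r
      using cumul_mono[OF that, of \<kappa> \<omega>] s(3) by (auto simp: expo_cut_def intro: order_trans)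
    have I: "(\<integral>\<^sup>+r\<in>{\<alpha><..s}. expo_cut n \<kappa> \<kappa>' (\<omega>, r) * h r \<partial>lborel) = (\<integral>\<^sup>+r\<in>{\<alpha><..s}. expo \<kappa> \<kappa>' (\<omega>, r) * h r \<partial>lborel)" for h
      by (intro nn_integral_cong) (auto simp: eq split: split_indicator)
    have "cumul \<kappa> \<omega> s < \<infinity>" "cumul \<kappa>' \<omega> s < \<infinity>"
      using cumul_mono[OF s(2)] fin order.strict_trans1 by blast+
    from expo_ftc[OF w k this le(1) s(1)] show ?thesis
      unfolding I eq[OF order_refl] eq[OF s(1)] .
  qed
  show ?thesis
  proof (cases "cumul \<kappa> \<omega> v \<le> of_nat n")
    case True
    then show ?thesis using upto[OF le(2) order_refl] by simp
  next
    case v: False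
    show ?thesis
    proof (cases "cumul \<kappa> \<omega> \<alpha> \<le> of_nat n")
      case False
      then have z: "expo_cut n \<kappa> \<kappa>' (\<omega>, r) = 0" if "\<alpha> \<le> r" for r
        using cumul_mono[OF that, of \<kappa> \<omega>] by (auto simp: expo_cut_def intro: order_trans)
      have "(\<integral>\<^sup>+r\<in>{\<alpha><..v}. expo_cut n \<kappa> \<kappa>' (\<omega>, r) * \<kappa>' (\<omega>, r) \<partial>lborel) = (\<integral>\<^sup>+r. 0 \<partial>(lborel :: real measure))"
        by (intro nn_integral_cong) (auto simp: z split: split_indicator)
      then show ?thesis using z[OF le(2)] by simp
    next
      case a: True
      define S where "S = {r\<in>{\<alpha>..v}. cumul \<kappa> \<omega> r \<le> of_nat n}"
      define s where "s = Sup S"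
      have S: "\<alpha> \<in> S" "bdd_above S" using a le by (auto simp: S_def intro!: bdd_aboveI[of _ v])
      have s: "\<alpha> \<le> s" "s \<le> v" unfolding s_def using S
        by (auto intro!: cSup_upper cSup_least simp: S_def)
      have "cumul \<kappa> \<omega> s \<le> of_nat n"
      proof -
        have ex: "\<exists>y. y \<in> S \<and> s - 1 / real (Suc m) < y" for m
          unfolding s_def using S less_cSupD[of S "Sup S - 1 / real (Suc m)"] by force
        define x where "x = (\<lambda>m. SOME y. y \<in> S \<and> s - 1 / real (Suc m) < y)"
        have x: "x m \<in> S" "s - 1 / real (Suc m) < x m" for m
          using someI_ex[OF ex[of m]] by (auto simp: x_def)
        have xs: "x m \<le> s" for m unfolding s_def using x(1)[of m] S(2) by (rule cSup_upper)
        have "x \<longlonglongrightarrow> s"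
        proof (rule tendsto_sandwich[where f = "\<lambda>m. s - 1 / real (Suc m)" and h = "\<lambda>_. s"])
          show "(\<lambda>m. s - 1 / real (Suc m)) \<longlonglongrightarrow> s"
            using tendsto_diff[OF tendsto_const LIMSEQ_inverse_real_of_nat, of s] by (simp add: inverse_eq_divide)
        qed (use x(2) xs in \<open>auto simp del: of_nat_Suc intro!: always_eventually less_imp_le\<close>)
        then have "(\<lambda>m. cumul \<kappa> \<omega> (x m)) \<longlonglongrightarrow> cumul \<kappa> \<omega> s"
          using x(1) by (intro cumul_tendsto[OF w k(1) fin(1)]) (auto simp: S_def)
        then show ?thesis by (rule LIMSEQ_le_const2) (use x(1) in \<open>auto simp: S_def\<close>)
      qed
      note eq = upto[OF s this]
      have z: "expo_cut n \<kappa> \<kappa>' (\<omega>, r) = 0" if "s < r" "r \<le> v" for r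
      proof -
        have "r \<notin> S" unfolding s_def using that S(2) cSup_upper[of r S] by (auto simp: s_def not_le[symmetric])
        then show ?thesis using that s by (auto simp: S_def expo_cut_def)
      qed
      have I: "(\<integral>\<^sup>+r\<in>{\<alpha><..v}. expo_cut n \<kappa> \<kappa>' (\<omega>, r) * h r \<partial>lborel) = (\<integral>\<^sup>+r\<in>{\<alpha><..s}. expo_cut n \<kappa> \<kappa>' (\<omega>, r) * h r \<partial>lborel)" for h
        using s by (intro nn_integral_cong) (auto simp: z split: split_indicator)
      have "expo_cut n \<kappa> \<kappa>' (\<omega>, v) = 0" using v by (simp add: expo_cut_def)
      then show ?thesis unfolding I eq[symmetric] by simp
    qed
  qed
qed

text \<open>
  The integral of \<open>e \<kappa>\<close> over the level arises once from \<open>split_at_next_jump\<close> and once from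
  \<open>expo_cut_ftc\<close>. Truncation makes it finite, so it cancels.
\<close>

lemma one_jump_truncated:
  assumes int: "has_intensity R \<kappa>" and k': "\<kappa>' \<in> borel_measurable pred_sigma"
    and fin': "AE \<omega> in R. cumul \<kappa>' \<omega> T < \<infinity>" and w: "prior k w" and u: "0 \<le> u" "u \<le> T"
    and wn: "\<And>\<omega>. w \<omega> \<le> of_nat n"
  shows "(\<integral>\<^sup>+\<omega>. w \<omega> * expo_cut n \<kappa> \<kappa>' (\<omega>, u) * indicator {real k} (N \<omega> u) +
      (\<integral>\<^sup>+r. w \<omega> * (expo_cut n \<kappa> \<kappa>' (\<omega>, r) * \<kappa>' (\<omega>, r)) * indicator (level k \<omega> \<inter> {..u}) r \<partial>lborel) \<partial>R)
    \<le> (\<integral>\<^sup>+\<omega>. w \<omega> * expo_cut n \<kappa> \<kappa>' (\<omega>, jump_time k \<omega>) * indicator {..u} (jump_time k \<omega>) \<partial>R)"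
    (is "(\<integral>\<^sup>+\<omega>. ?X \<omega> + ?Y \<omega> \<partial>R) \<le> (\<integral>\<^sup>+\<omega>. ?V \<omega> \<partial>R)")
proof -
  let ?e = "expo_cut n \<kappa> \<kappa>'"
  note pR = has_intensityD(1)[OF int] and sR = has_intensityD(2)[OF int] and spR = has_intensityD(3)[OF int]
    and k = has_intensityD(4)[OF int] and fin = has_intensityD(5)[OF int T_nonneg]
  interpret R: prob_space R by (rule pR)
  note wM = prior_measurable[OF w]
  have mR: "f \<in> borel_measurable R" if "f \<in> borel_measurable M" for f :: "'a \<Rightarrow> 'c::topological_space"
    using that sR by (simp cong: measurable_cong_sets)
  note eP = expo_cut_pred_sigma[OF k k', of n]
  let ?Z = "\<lambda>\<omega>. \<integral>\<^sup>+r. w \<omega> * (?e (\<omega>, r) * \<kappa> (\<omega>, r)) * indicator (level k \<omega> \<inter> {..u}) r \<partial>lborel"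
  let ?W = "\<lambda>\<omega>. w \<omega> * ?e (\<omega>, min u (jump_time (Suc k) \<omega>)) * indicator {..u} (jump_time k \<omega>)"
  have [measurable]: "?Y \<in> borel_measurable R" "?Z \<in> borel_measurable R"
    using eP k k' by (intro inner_measurable[OF sR _ u wM]; measurable)+
  note [measurable] = mR[OF wM] mR[OF jump_time_measurable] mR[OF N_measurable[OF u(1)]]
    mR[OF F_measurable_M[OF measurable_compose[OF pred_sigma_snd_const[OF u(1)] eP]]]
    mR[OF measurable_compose[OF jump_graph_measurable eP]]
  have [measurable]: "?W \<in> borel_measurable R"
  proof -
    have "?e (\<omega>, min u (jump_time (Suc k) \<omega>)) = (if u \<le> jump_time (Suc k) \<omega> then ?e (\<omega>, u) else ?e (\<omega>, jump_time (Suc k) \<omega>))" for \<omega>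
      by (simp add: min_def)
    then show ?thesis by simp
  qed
  have split: "(\<integral>\<^sup>+\<omega>. ?W \<omega> \<partial>R) = (\<integral>\<^sup>+\<omega>. ?X \<omega> \<partial>R) + (\<integral>\<^sup>+\<omega>. ?Z \<omega> \<partial>R)"
    by (rule split_at_next_jump[OF int eP w u])
  have "(\<integral>\<^sup>+\<omega>. ?W \<omega> \<partial>R) \<le> (\<integral>\<^sup>+\<omega>. of_nat n * ennreal (exp (real n)) * 1 \<partial>R)"
    by (intro nn_integral_mono mult_mono wn expo_cut_bound) (auto split: split_indicator)
  also have "\<dots> < \<infinity>"
    by (simp add: R.emeasure_space_1 ennreal_mult_less_top of_nat_less_top)
  finally have Zfin: "(\<integral>\<^sup>+\<omega>. ?Z \<omega> \<partial>R) \<noteq> \<infinity>" unfolding split by auto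
  have WY: "(\<integral>\<^sup>+\<omega>. ?W \<omega> + ?Y \<omega> \<partial>R) = (\<integral>\<^sup>+\<omega>. ?W \<omega> \<partial>R) + (\<integral>\<^sup>+\<omega>. ?Y \<omega> \<partial>R)"
    by (rule nn_integral_add) measurable
  have VZ: "(\<integral>\<^sup>+\<omega>. ?V \<omega> + ?Z \<omega> \<partial>R) = (\<integral>\<^sup>+\<omega>. ?V \<omega> \<partial>R) + (\<integral>\<^sup>+\<omega>. ?Z \<omega> \<partial>R)"
    by (rule nn_integral_add) measurable
  have "(\<integral>\<^sup>+\<omega>. ?W \<omega> + ?Y \<omega> \<partial>R) \<le> (\<integral>\<^sup>+\<omega>. ?V \<omega> + ?Z \<omega> \<partial>R)"
  proof (rule nn_integral_mono_AE)
    show "AE \<omega> in R. ?W \<omega> + ?Y \<omega> \<le> ?V \<omega> + ?Z \<omega>"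
      using fin fin' AE_space
    proof eventually_elim
      case (elim \<omega>)
      then have wM: "\<omega> \<in> space M" by (simp add: spR)
      have [measurable]: "(\<lambda>r. \<kappa> (\<omega>, r)) \<in> borel_measurable borel" "(\<lambda>r. \<kappa>' (\<omega>, r)) \<in> borel_measurable borel"
         "(\<lambda>r. ?e (\<omega>, r)) \<in> borel_measurable borel"
        by (rule measurable_compose[OF section_pred_sigma[OF wM]], fact k k' eP)+
      let ?v = "min u (jump_time (Suc k) \<omega>)"
      have pull: "(\<integral>\<^sup>+r. w \<omega> * (?e (\<omega>, r) * h r) * indicator (level k \<omega> \<inter> {..u}) r \<partial>lborel) =
         w \<omega> * (\<integral>\<^sup>+r\<in>{jump_time k \<omega><..?v}. ?e (\<omega>, r) * h r \<partial>lborel)"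
        if [measurable]: "h \<in> borel_measurable borel" for h
        unfolding level_Int_atMost[OF u(2)] by (subst nn_integral_cmult[symmetric]) (auto simp: mult.assoc)
      have z: "(\<integral>\<^sup>+r\<in>{jump_time k \<omega><..?v}. ?e (\<omega>, r) * h r \<partial>lborel) = 0" if "\<not> jump_time k \<omega> \<le> u" for h
        using that by (simp add: greaterThanAtMost_empty)
      have "?e (\<omega>, ?v) + (\<integral>\<^sup>+r\<in>{jump_time k \<omega><..?v}. ?e (\<omega>, r) * \<kappa>' (\<omega>, r) \<partial>lborel) \<le>
         ?e (\<omega>, jump_time k \<omega>) + (\<integral>\<^sup>+r\<in>{jump_time k \<omega><..?v}. ?e (\<omega>, r) * \<kappa> (\<omega>, r) \<partial>lborel)" if "jump_time k \<omega> \<le> u"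
      proof (rule expo_cut_ftc[OF wM k k'])
        show "cumul \<kappa> \<omega> ?v < \<infinity>" "cumul \<kappa>' \<omega> ?v < \<infinity>"
          using elim u order.strict_trans1[OF cumul_mono[of ?v T]] by auto
      qed (use that jump_time_bounds(1) jump_time_mono[of k "Suc k" \<omega>] in auto)
      then show ?case unfolding pull[OF \<open>(\<lambda>r. \<kappa> (\<omega>, r)) \<in> borel_measurable borel\<close>] pull[OF \<open>(\<lambda>r. \<kappa>' (\<omega>, r)) \<in> borel_measurable borel\<close>]
        using z by (cases "jump_time k \<omega> \<le> u") (auto simp: distrib_left[symmetric] intro: mult_left_mono)
    qed
  qed
  then have "(\<integral>\<^sup>+\<omega>. ?W \<omega> \<partial>R) + (\<integral>\<^sup>+\<omega>. ?Y \<omega> \<partial>R) \<le> (\<integral>\<^sup>+\<omega>. ?V \<omega> \<partial>R) + (\<integral>\<^sup>+\<omega>. ?Z \<omega> \<partial>R)"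
    unfolding WY VZ .
  then have "(\<integral>\<^sup>+\<omega>. ?Z \<omega> \<partial>R) + ((\<integral>\<^sup>+\<omega>. ?X \<omega> \<partial>R) + (\<integral>\<^sup>+\<omega>. ?Y \<omega> \<partial>R)) \<le> (\<integral>\<^sup>+\<omega>. ?Z \<omega> \<partial>R) + (\<integral>\<^sup>+\<omega>. ?V \<omega> \<partial>R)"
    unfolding split by (simp add: ac_simps)
  then have "(\<integral>\<^sup>+\<omega>. ?X \<omega> \<partial>R) + (\<integral>\<^sup>+\<omega>. ?Y \<omega> \<partial>R) \<le> (\<integral>\<^sup>+\<omega>. ?V \<omega> \<partial>R)"
    using Zfin by (simp add: ennreal_add_left_cancel_le)
  then show ?thesis by (subst nn_integral_add) measurable
qed

text \<open>
  Fatou's lemma removes the truncation: for each sample point the truncated integrands are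
  eventually equal to the full ones.
\<close>

lemma one_jump_inequality:
  assumes int: "has_intensity R \<kappa>" and k': "\<kappa>' \<in> borel_measurable pred_sigma"
    and fin': "AE \<omega> in R. cumul \<kappa>' \<omega> T < \<infinity>" and w: "prior k w" and u: "0 \<le> u" "u \<le> T"
    and wfin: "\<And>\<omega>. w \<omega> < \<infinity>"
  shows "(\<integral>\<^sup>+\<omega>. w \<omega> * expo \<kappa> \<kappa>' (\<omega>, u) * indicator {real k} (N \<omega> u) \<partial>R) +
      (\<integral>\<^sup>+\<omega>. (\<integral>\<^sup>+r. w \<omega> * (expo \<kappa> \<kappa>' (\<omega>, r) * \<kappa>' (\<omega>, r)) * indicator (level k \<omega> \<inter> {..u}) r \<partial>lborel) \<partial>R)
    \<le> (\<integral>\<^sup>+\<omega>. w \<omega> * expo \<kappa> \<kappa>' (\<omega>, jump_time k \<omega>) * indicator {..u} (jump_time k \<omega>) \<partial>R)"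
    (is "?X + ?Y \<le> ?V")
proof -
  note sR = has_intensityD(2)[OF int] and k = has_intensityD(4)[OF int] and fin = has_intensityD(5)[OF int T_nonneg]
  note wM = prior_measurable[OF w]
  have mR: "f \<in> borel_measurable R" if "f \<in> borel_measurable M" for f :: "'a \<Rightarrow> 'c::topological_space"
    using that sR by (simp cong: measurable_cong_sets)
  define L where "L = (\<lambda>n \<omega>. min (w \<omega>) (of_nat n) * expo_cut n \<kappa> \<kappa>' (\<omega>, u) * indicator {real k} (N \<omega> u) +
      (\<integral>\<^sup>+r. min (w \<omega>) (of_nat n) * (expo_cut n \<kappa> \<kappa>' (\<omega>, r) * \<kappa>' (\<omega>, r)) * indicator (level k \<omega> \<inter> {..u}) r \<partial>lborel))"
  define L' where "L' = (\<lambda>\<omega>. w \<omega> * expo \<kappa> \<kappa>' (\<omega>, u) * indicator {real k} (N \<omega> u) +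
      (\<integral>\<^sup>+r. w \<omega> * (expo \<kappa> \<kappa>' (\<omega>, r) * \<kappa>' (\<omega>, r)) * indicator (level k \<omega> \<inter> {..u}) r \<partial>lborel))"
  note [measurable] = mR[OF wM] mR[OF N_measurable[OF u(1)]]
  have Lm: "L n \<in> borel_measurable R" for n
  proof -
    note eP = expo_cut_pred_sigma[OF k k', of n]
    note [measurable] = mR[OF F_measurable_M[OF measurable_compose[OF pred_sigma_snd_const[OF u(1)] eP]]]
    have "(\<lambda>\<omega>. \<integral>\<^sup>+r. min (w \<omega>) (of_nat n) * (expo_cut n \<kappa> \<kappa>' (\<omega>, r) * \<kappa>' (\<omega>, r)) * indicator (level k \<omega> \<inter> {..u}) r \<partial>lborel) \<in> borel_measurable R"
      using eP k' wM by (intro inner_measurable[OF sR _ u]; measurable)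
    then show ?thesis unfolding L_def by measurable
  qed
  have "?X + ?Y = (\<integral>\<^sup>+\<omega>. L' \<omega> \<partial>R)"
  proof -
    note eP = expo_pred_sigma[OF k k']
    note [measurable] = mR[OF F_measurable_M[OF measurable_compose[OF pred_sigma_snd_const[OF u(1)] eP]]]
    have [measurable]: "(\<lambda>\<omega>. \<integral>\<^sup>+r. w \<omega> * (expo \<kappa> \<kappa>' (\<omega>, r) * \<kappa>' (\<omega>, r)) * indicator (level k \<omega> \<inter> {..u}) r \<partial>lborel) \<in> borel_measurable R"
      using eP k' wM by (intro inner_measurable[OF sR _ u]; measurable)
    show ?thesis unfolding L'_def by (rule nn_integral_add[symmetric]) measurable
  qed
  also have "\<dots> \<le> (\<integral>\<^sup>+\<omega>. liminf (\<lambda>n. L n \<omega>) \<partial>R)"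
  proof (rule nn_integral_mono_AE)
    show "AE \<omega> in R. L' \<omega> \<le> liminf (\<lambda>n. L n \<omega>)"
      using fin
    proof eventually_elim
      case (elim \<omega>)
      obtain n1 :: nat where n1: "w \<omega> \<le> of_nat n1"
        using ennreal_Ex_less_of_nat[of "w \<omega>"] wfin[of \<omega>] by (auto simp: less_top intro: less_imp_le)
      obtain n2 :: nat where n2: "cumul \<kappa> \<omega> T \<le> of_nat n2"
        using ennreal_Ex_less_of_nat[of "cumul \<kappa> \<omega> T"] elim by (auto simp: less_top intro: less_imp_le)
      have "L n \<omega> = L' \<omega>" if n: "max n1 n2 \<le> n" for n
      proof -
        have "of_nat n1 \<le> (of_nat n :: ennreal)" "of_nat n2 \<le> (of_nat n :: ennreal)" using n by auto
        then have 1: "min (w \<omega>) (of_nat n) = w \<omega>" and 2: "cumul \<kappa> \<omega> T \<le> of_nat n"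
          using n1 n2 by (auto simp: min_def intro: order_trans)
        have 3: "expo_cut n \<kappa> \<kappa>' (\<omega>, r) = expo \<kappa> \<kappa>' (\<omega>, r)" if "r \<le> T" for r
          using order_trans[OF cumul_mono[OF that] 2] by (simp add: expo_cut_def)
        show ?thesis unfolding L_def L'_def 1 using 3 u
          by (intro arg_cong2[where f="(+)"] nn_integral_cong) (auto split: split_indicator)
      qed
      then have "eventually (\<lambda>n. L n \<omega> = L' \<omega>) sequentially"
        unfolding eventually_sequentially by blast
      then have "(\<lambda>n. L n \<omega>) \<longlonglongrightarrow> L' \<omega>" by (rule tendsto_eventually)
      then show ?case by (simp add: lim_imp_Liminf)
    qed
  qed
  also have "\<dots> \<le> liminf (\<lambda>n. \<integral>\<^sup>+\<omega>. L n \<omega> \<partial>R)" by (rule nn_integral_liminf[OF Lm])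
  also have "\<dots> \<le> limsup (\<lambda>n. \<integral>\<^sup>+\<omega>. L n \<omega> \<partial>R)" by (rule Liminf_le_Limsup) simp
  also have "\<dots> \<le> ?V"
  proof (rule Limsup_bounded, rule always_eventually, rule allI)
    fix n
    have "(\<integral>\<^sup>+\<omega>. L n \<omega> \<partial>R) \<le> (\<integral>\<^sup>+\<omega>. min (w \<omega>) (of_nat n) * expo_cut n \<kappa> \<kappa>' (\<omega>, jump_time k \<omega>) * indicator {..u} (jump_time k \<omega>) \<partial>R)"
      unfolding L_def by (rule one_jump_truncated[OF int k' fin' prior_min[OF w] u]) simp
    also have "\<dots> \<le> ?V"
      by (intro nn_integral_mono mult_mono) (auto simp: expo_cut_def)
    finally show "(\<integral>\<^sup>+\<omega>. L n \<omega> \<partial>R) \<le> ?V" .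
  qed
  finally show ?thesis .
qed

text \<open>
  If the cumulative intensity is bounded, \<open>expo_ftc\<close> holds up to \<open>u\<close> with nothing dropped.
\<close>

lemma one_jump_equality:
  assumes int: "has_intensity R \<kappa>" and w: "prior k w" and u: "0 \<le> u" "u \<le> T"
    and w1: "\<And>\<omega>. w \<omega> \<le> 1" and bdd: "\<And>\<omega>. \<omega> \<in> space M \<Longrightarrow> cumul \<kappa> \<omega> T \<le> of_nat n"
  shows "(\<integral>\<^sup>+\<omega>. w \<omega> * expo \<kappa> (\<lambda>_. 0) (\<omega>, u) * indicator {real k} (N \<omega> u) \<partial>R) =
    (\<integral>\<^sup>+\<omega>. w \<omega> * expo \<kappa> (\<lambda>_. 0) (\<omega>, jump_time k \<omega>) * indicator {..u} (jump_time k \<omega>) \<partial>R)"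
    (is "(\<integral>\<^sup>+\<omega>. ?X \<omega> \<partial>R) = (\<integral>\<^sup>+\<omega>. ?V \<omega> \<partial>R)")
proof -
  let ?e = "expo \<kappa> (\<lambda>_. 0)"
  note pR = has_intensityD(1)[OF int] and sR = has_intensityD(2)[OF int] and spR = has_intensityD(3)[OF int]
    and k = has_intensityD(4)[OF int]
  interpret R: prob_space R by (rule pR)
  note wM = prior_measurable[OF w]
  have mR: "f \<in> borel_measurable R" if "f \<in> borel_measurable M" for f :: "'a \<Rightarrow> 'c::topological_space"
    using that sR by (simp cong: measurable_cong_sets)
  have k0: "(\<lambda>_. 0 :: ennreal) \<in> borel_measurable pred_sigma" by simp
  note eP = expo_pred_sigma[OF k k0]
  let ?Z = "\<lambda>\<omega>. \<integral>\<^sup>+r. w \<omega> * (?e (\<omega>, r) * \<kappa> (\<omega>, r)) * indicator (level k \<omega> \<inter> {..u}) r \<partial>lborel"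
  let ?W = "\<lambda>\<omega>. w \<omega> * ?e (\<omega>, min u (jump_time (Suc k) \<omega>)) * indicator {..u} (jump_time k \<omega>)"
  have [measurable]: "?Z \<in> borel_measurable R"
    using eP k by (intro inner_measurable[OF sR _ u wM]; measurable)
  note [measurable] = mR[OF wM] mR[OF jump_time_measurable]
    mR[OF measurable_compose[OF jump_graph_measurable eP]]
  have split: "(\<integral>\<^sup>+\<omega>. ?W \<omega> \<partial>R) = (\<integral>\<^sup>+\<omega>. ?X \<omega> \<partial>R) + (\<integral>\<^sup>+\<omega>. ?Z \<omega> \<partial>R)"
    by (rule split_at_next_jump[OF int eP w u])
  have eb: "?e (\<omega>, r) \<le> ennreal (exp (real n))" if "\<omega> \<in> space R" "r \<le> T" for \<omega> r
  proof -
    have "?e (\<omega>, r) = expo_cut n \<kappa> (\<lambda>_. 0) (\<omega>, r)"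
      using order_trans[OF cumul_mono[OF that(2)] bdd[of \<omega>]] that spR by (simp add: expo_cut_def)
    then show ?thesis using expo_cut_bound by metis
  qed
  have "(\<integral>\<^sup>+\<omega>. ?W \<omega> \<partial>R) \<le> (\<integral>\<^sup>+\<omega>. 1 * ennreal (exp (real n)) * 1 \<partial>R)"
    using u by (intro nn_integral_mono mult_mono w1 eb) (auto split: split_indicator)
  also have "\<dots> < \<infinity>" by (simp add: R.emeasure_space_1 ennreal_mult_less_top)
  finally have Zfin: "(\<integral>\<^sup>+\<omega>. ?Z \<omega> \<partial>R) \<noteq> \<infinity>" unfolding split by auto
  have "(\<integral>\<^sup>+\<omega>. ?W \<omega> \<partial>R) = (\<integral>\<^sup>+\<omega>. ?V \<omega> + ?Z \<omega> \<partial>R)"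
  proof (rule nn_integral_cong)
    fix \<omega> assume "\<omega> \<in> space R"
    then have wM: "\<omega> \<in> space M" by (simp add: spR)
    have [measurable]: "(\<lambda>r. \<kappa> (\<omega>, r)) \<in> borel_measurable borel" "(\<lambda>r. ?e (\<omega>, r)) \<in> borel_measurable borel"
      by (rule measurable_compose[OF section_pred_sigma[OF wM]], fact k eP)+
    let ?v = "min u (jump_time (Suc k) \<omega>)"
    have pull: "?Z \<omega> = w \<omega> * (\<integral>\<^sup>+r\<in>{jump_time k \<omega><..?v}. ?e (\<omega>, r) * \<kappa> (\<omega>, r) \<partial>lborel)"
      unfolding level_Int_atMost[OF u(2)] by (subst nn_integral_cmult[symmetric]) (auto simp: mult.assoc)
    show "?W \<omega> = ?V \<omega> + ?Z \<omega>"
    proof (cases "jump_time k \<omega> \<le> u")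
      case True
      have "?e (\<omega>, ?v) + (\<integral>\<^sup>+r\<in>{jump_time k \<omega><..?v}. ?e (\<omega>, r) * 0 \<partial>lborel) =
         ?e (\<omega>, jump_time k \<omega>) + (\<integral>\<^sup>+r\<in>{jump_time k \<omega><..?v}. ?e (\<omega>, r) * \<kappa> (\<omega>, r) \<partial>lborel)"
      proof (rule expo_ftc[OF wM k k0])
        have "cumul \<kappa> \<omega> ?v \<le> of_nat n" using order_trans[OF cumul_mono bdd[OF wM], of ?v] u by auto
        then show "cumul \<kappa> \<omega> ?v < \<infinity>" by (simp add: order.strict_trans1 of_nat_less_top)
        show "cumul (\<lambda>_. 0) \<omega> ?v < \<infinity>" by (simp add: cumul_def)
      qed (use True jump_time_bounds(1) jump_time_mono[of k "Suc k" \<omega>] in auto)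
      then show ?thesis unfolding pull using True by (simp add: distrib_left)
    next
      case False
      then show ?thesis unfolding pull by (simp add: greaterThanAtMost_empty)
    qed
  qed
  also have "\<dots> = (\<integral>\<^sup>+\<omega>. ?V \<omega> \<partial>R) + (\<integral>\<^sup>+\<omega>. ?Z \<omega> \<partial>R)" by (rule nn_integral_add) measurable
  finally have "(\<integral>\<^sup>+\<omega>. ?Z \<omega> \<partial>R) + (\<integral>\<^sup>+\<omega>. ?X \<omega> \<partial>R) = (\<integral>\<^sup>+\<omega>. ?Z \<omega> \<partial>R) + (\<integral>\<^sup>+\<omega>. ?V \<omega> \<partial>R)"
    unfolding split by (simp add: add.commute)
  then show ?thesis using Zfin by (simp add: ennreal_add_left_cancel)
qed

end

section \<open>Recursion over the number of jumps\<close>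

context counting_process
begin

abbreviation seqs :: "(nat \<Rightarrow> real) measure" where "seqs \<equiv> PiM UNIV (\<lambda>_. borel)"

text \<open>
  A sequence with the later entries constant, so that functions of the first \<open>k\<close> jump times have a
  domain independent of \<open>k\<close>.
\<close>

definition jumps :: "nat \<Rightarrow> 'a \<Rightarrow> nat \<Rightarrow> real" where
  "jumps k \<omega> = (\<lambda>j. if j \<le> k then jump_time j \<omega> else T + 1)"

definition weight :: "('a \<times> real \<Rightarrow> ennreal) \<Rightarrow> nat \<Rightarrow> 'a \<Rightarrow> ennreal" where
  "weight g k \<omega> = (\<Prod>j\<in>{1..k}. g (\<omega>, jump_time j \<omega>))"

lemma weight_0 [simp]: "weight g 0 \<omega> = 1" by (simp add: weight_def)

lemma weight_Suc: "weight g (Suc k) \<omega> = weight g k \<omega> * g (\<omega>, jump_time (Suc k) \<omega>)"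
  by (simp add: weight_def atLeastAtMostSuc_conv mult.commute)

lemma stopped_weight_pred_sigma:
  fixes f :: "(nat \<Rightarrow> real) \<Rightarrow> ennreal" and g :: "'a \<times> real \<Rightarrow> ennreal"
  assumes f: "f \<in> borel_measurable seqs" and g: "g \<in> borel_measurable pred_sigma"
    and h: "\<And>j. (\<lambda>x. h j x) \<in> borel_measurable pred_sigma"
  shows "(\<lambda>x. f (\<lambda>j. h j x) * (\<Prod>j\<in>{1..k}. g (fst x, min (jump_time j (fst x)) (snd x)))) \<in> borel_measurable pred_sigma"
proof -
  have 1: "(\<lambda>x j. h j x) \<in> measurable pred_sigma seqs"
    using h by (intro measurable_PiM_single') auto
  have 2: "(\<lambda>x. g (fst x, min (jump_time j (fst x)) (snd x))) \<in> borel_measurable pred_sigma" for j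
    using measurable_compose[OF stop_measurable g] by (simp add: case_prod_beta')
  show ?thesis
    by (intro borel_measurable_times_ennreal borel_measurable_prod_ennreal measurable_compose[OF 1 f] 2)
qed

lemma min_jump_pred_sigma: "(\<lambda>x. min (jump_time j (fst x)) (snd x)) \<in> borel_measurable pred_sigma"
  using measurable_compose[OF stop_measurable snd_pred_sigma] by (simp add: case_prod_beta')

lemma prior_weight:
  assumes f: "f \<in> borel_measurable seqs" and g: "g \<in> borel_measurable pred_sigma"
  shows "prior k (\<lambda>\<omega>. f (jumps k \<omega>) * weight g k \<omega>)"
proof -
  let ?h = "\<lambda>j x. if j \<le> k then min (jump_time j (fst x)) (snd x) else T + 1"
  have "(\<lambda>x. f (\<lambda>j. ?h j x) * (\<Prod>j\<in>{1..k}. g (fst x, min (jump_time j (fst x)) (snd x)))) \<in> borel_measurable pred_sigma"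
    by (rule stopped_weight_pred_sigma[OF f g]) (use min_jump_pred_sigma in auto)
  moreover have "(\<lambda>x. indicator {x. jump_time k (fst x) < snd x} x :: ennreal) \<in> borel_measurable pred_sigma"
    unfolding borel_measurable_indicator_iff using after_jump_pred_sigma[of k] by (simp add: Int_def conj_commute)
  ultimately have "(\<lambda>x. f (\<lambda>j. ?h j x) * (\<Prod>j\<in>{1..k}. g (fst x, min (jump_time j (fst x)) (snd x))) *
      indicator {x. jump_time k (fst x) < snd x} x) \<in> borel_measurable pred_sigma"
    by (rule borel_measurable_times_ennreal)
  also have "(\<lambda>x. f (\<lambda>j. ?h j x) * (\<Prod>j\<in>{1..k}. g (fst x, min (jump_time j (fst x)) (snd x))) *
      indicator {x. jump_time k (fst x) < snd x} x) =
    (\<lambda>x. f (jumps k (fst x)) * weight g k (fst x) * indicator {x. jump_time k (fst x) < snd x} x)"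
  proof (rule ext)
    fix x :: "'a \<times> real"
    show "f (\<lambda>j. ?h j x) * (\<Prod>j\<in>{1..k}. g (fst x, min (jump_time j (fst x)) (snd x))) *
        indicator {x. jump_time k (fst x) < snd x} x =
      f (jumps k (fst x)) * weight g k (fst x) * indicator {x. jump_time k (fst x) < snd x} x"
    proof (cases "jump_time k (fst x) < snd x")
      case True
      then have m: "min (jump_time j (fst x)) (snd x) = jump_time j (fst x)" if "j \<le> k" for j
        using jump_time_mono[OF that, of "fst x"] by simp
      have "(\<lambda>j. ?h j x) = jumps k (fst x)" unfolding jumps_def using m by auto
      moreover have "(\<Prod>j\<in>{1..k}. g (fst x, min (jump_time j (fst x)) (snd x))) = weight g k (fst x)"
        unfolding weight_def using m by (intro prod.cong) auto
      ultimately show ?thesis by simp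
    qed simp
  qed
  finally show ?thesis unfolding prior_def .
qed

text \<open>
  \<open>jump_compensator\<close> for a function of the first \<open>k + 1\<close> jump times: the last of them becomes an
  integration variable \<open>r\<close>, and the jump factor \<open>g\<close> meets the intensity.
\<close>

lemma jump_step:
  assumes int: "has_intensity R \<kappa>" and f: "f \<in> borel_measurable seqs" and g: "g \<in> borel_measurable pred_sigma"
    and e: "e \<in> borel_measurable pred_sigma" and u: "0 \<le> u" "u \<le> T"
  shows "(\<integral>\<^sup>+\<omega>. (f (jumps (Suc k) \<omega>) * weight g (Suc k) \<omega>) * e (\<omega>, jump_time (Suc k) \<omega>) * indicator {..u} (jump_time (Suc k) \<omega>) \<partial>R) =
    (\<integral>\<^sup>+\<omega>. (\<integral>\<^sup>+r. (f ((jumps k \<omega>)(Suc k := r)) * weight g k \<omega>) * (e (\<omega>, r) * (g (\<omega>, r) * \<kappa> (\<omega>, r))) * indicator (level k \<omega> \<inter> {..u}) r \<partial>lborel) \<partial>R)"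
proof -
  let ?h = "\<lambda>j x. if j \<le> k then min (jump_time j (fst x)) (snd x) else if j = Suc k then snd x else T + 1"
  define H where "H = (\<lambda>x. (f (\<lambda>j. ?h j x) * (\<Prod>j\<in>{1..k}. g (fst x, min (jump_time j (fst x)) (snd x)))) *
     (g x * e x * indicator {..u} (snd x)))"
  have "(\<lambda>x. f (\<lambda>j. ?h j x) * (\<Prod>j\<in>{1..k}. g (fst x, min (jump_time j (fst x)) (snd x)))) \<in> borel_measurable pred_sigma"
    by (rule stopped_weight_pred_sigma[OF f g]) (use min_jump_pred_sigma in auto)
  then have H: "H \<in> borel_measurable pred_sigma" unfolding H_def using g e by measurable
  have m: "min (jump_time j \<omega>) r = jump_time j \<omega>" if "j \<le> k" "jump_time k \<omega> \<le> r" for j \<omega> r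
    using jump_time_mono[OF that(1), of \<omega>] that by simp
  have He: "H (\<omega>, r) = f ((jumps k \<omega>)(Suc k := r)) * weight g k \<omega> * (g (\<omega>, r) * e (\<omega>, r) * indicator {..u} r)"
    if "jump_time k \<omega> \<le> r" for \<omega> r
  proof -
    have "(\<lambda>j. ?h j (\<omega>, r)) = (jumps k \<omega>)(Suc k := r)" unfolding jumps_def using m[OF _ that] by auto
    moreover have "(\<Prod>j\<in>{1..k}. g (\<omega>, min (jump_time j \<omega>) r)) = weight g k \<omega>"
      unfolding weight_def using m[OF _ that] by (intro prod.cong) auto
    ultimately show ?thesis by (simp add: H_def)
  qed
  have upd: "(jumps k \<omega>)(Suc k := jump_time (Suc k) \<omega>) = jumps (Suc k) \<omega>" for \<omega>
    by (auto simp: jumps_def)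
  have "(\<integral>\<^sup>+\<omega>. (f (jumps (Suc k) \<omega>) * weight g (Suc k) \<omega>) * e (\<omega>, jump_time (Suc k) \<omega>) * indicator {..u} (jump_time (Suc k) \<omega>) \<partial>R) =
    (\<integral>\<^sup>+\<omega>. H (\<omega>, jump_time (Suc k) \<omega>) * indicator {..T} (jump_time (Suc k) \<omega>) \<partial>R)"
    using He[OF jump_time_mono[of k "Suc k"]] u
    by (intro nn_integral_cong) (auto simp: upd weight_Suc mult_ac split: split_indicator)
  also have "\<dots> = (\<integral>\<^sup>+\<omega>. (\<integral>\<^sup>+r. H (\<omega>, r) * \<kappa> (\<omega>, r) * indicator (level k \<omega>) r \<partial>lborel) \<partial>R)"
    by (rule jump_compensator[OF int H])
  also have "\<dots> = (\<integral>\<^sup>+\<omega>. (\<integral>\<^sup>+r. (f ((jumps k \<omega>)(Suc k := r)) * weight g k \<omega>) * (e (\<omega>, r) * (g (\<omega>, r) * \<kappa> (\<omega>, r))) * indicator (level k \<omega> \<inter> {..u}) r \<partial>lborel) \<partial>R)"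
  proof (intro nn_integral_cong)
    fix \<omega> r
    show "H (\<omega>, r) * \<kappa> (\<omega>, r) * indicator (level k \<omega>) r = (f ((jumps k \<omega>)(Suc k := r)) * weight g k \<omega>) * (e (\<omega>, r) * (g (\<omega>, r) * \<kappa> (\<omega>, r))) * indicator (level k \<omega> \<inter> {..u}) r"
      using He[of \<omega> r] by (auto simp: level_def mult_ac split: split_indicator)
  qed
  finally show ?thesis .
qed

text \<open>
  The part of an expectation at time \<open>u\<close> that is carried by the paths with exactly \<open>k\<close> jumps.
\<close>

definition slice :: "'a measure \<Rightarrow> ('a \<times> real \<Rightarrow> ennreal) \<Rightarrow> ('a \<times> real \<Rightarrow> ennreal) \<Rightarrow> nat \<Rightarrow> real \<Rightarrow> ((nat \<Rightarrow> real) \<Rightarrow> ennreal) \<Rightarrow> ennreal" where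
  "slice R g e k u f = (\<integral>\<^sup>+\<omega>. (f (jumps k \<omega>) * weight g k \<omega>) * e (\<omega>, u) * indicator {real k} (N \<omega> u) \<partial>R)"

lemma jumps_measurable: "jumps k \<in> measurable M seqs"
  unfolding jumps_def using jump_time_measurable
  by (intro measurable_PiM_single') auto

lemma weight_measurable: "g \<in> borel_measurable pred_sigma \<Longrightarrow> weight g k \<in> borel_measurable M"
  unfolding weight_def using measurable_compose[OF jump_graph_measurable] by measurable

text \<open>
  For a fixed path, \<open>level k\<close> and the set of times with exactly \<open>k\<close> jumps differ only at the two jump
  times. So Tonelli's theorem turns the integral over the level into an integral of slices.
\<close>

lemma slice_swap:
  assumes sf: "prob_space R" "sets R = sets M" and f: "f \<in> borel_measurable seqs" and g: "g \<in> borel_measurable pred_sigma"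
    and e: "e \<in> borel_measurable pred_sigma" and u: "0 \<le> u" "u \<le> T"
  shows "(\<integral>\<^sup>+\<omega>. (\<integral>\<^sup>+r. (f ((jumps k \<omega>)(Suc k := r)) * weight g k \<omega>) * e (\<omega>, r) * indicator (level k \<omega> \<inter> {..u}) r \<partial>lborel) \<partial>R) =
    (\<integral>\<^sup>+r\<in>{0<..u}. slice R g e k r (\<lambda>x. f (x(Suc k := r))) \<partial>lborel)"
proof -
  let ?c = "\<lambda>\<omega> r. f ((jumps k \<omega>)(Suc k := r)) * weight g k \<omega> * e (\<omega>, min r u)"
  let ?i = "\<lambda>\<omega> r. if jump_time k \<omega> \<le> r \<and> r < jump_time (Suc k) \<omega> \<and> 0 < r \<and> r \<le> u then 1 else 0"
  interpret R: prob_space R by (rule sf)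
  interpret P: pair_sigma_finite lborel R ..
  have spR: "space R = space M" using sf(2) by (rule sets_eq_imp_space_eq)
  have mp: "measurable (R \<Otimes>\<^sub>M lborel) X = measurable (M \<Otimes>\<^sub>M borel) X" for X :: "'c measure"
    by (intro measurable_cong_sets sets_pair_measure_cong) (auto simp: sf)
  define J where "J = (\<lambda>x. f ((jumps k (fst x))(Suc k := snd x)) * weight g k (fst x) * e (fst x, min (snd x) u) *
    (if jump_time k (fst x) < snd x \<and> snd x \<le> jump_time (Suc k) (fst x) \<and> snd x \<le> u then 1 else 0))"
  have "(\<lambda>x. (jumps k (fst x))(Suc k := snd x)) \<in> measurable (M \<Otimes>\<^sub>M borel) seqs"
  proof (rule measurable_PiM_single')
    fix j
    have "(\<lambda>x. jumps k (fst x) j) \<in> borel_measurable (M \<Otimes>\<^sub>M borel)"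
      using jump_time_measurable[of j] unfolding jumps_def by measurable
    then show "(\<lambda>x. ((jumps k (fst x))(Suc k := snd x)) j) \<in> borel_measurable (M \<Otimes>\<^sub>M borel)"
      by (cases "j = Suc k") auto
  qed auto
  note 1 = measurable_compose[OF this f]
  have 2: "(\<lambda>x. e (fst x, min (snd x) u)) \<in> borel_measurable (M \<Otimes>\<^sub>M borel)"
    using measurable_compose[OF progressive_M[OF u(1)] e] by (simp add: case_prod_beta')
  have J: "J \<in> borel_measurable (R \<Otimes>\<^sub>M lborel)"
    unfolding mp J_def using 1 2 weight_measurable[OF g] jump_time_measurable by measurable
  have "(\<integral>\<^sup>+\<omega>. (\<integral>\<^sup>+r. (f ((jumps k \<omega>)(Suc k := r)) * weight g k \<omega>) * e (\<omega>, r) * indicator (level k \<omega> \<inter> {..u}) r \<partial>lborel) \<partial>R) =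
    (\<integral>\<^sup>+\<omega>. (\<integral>\<^sup>+r. J (\<omega>, r) \<partial>lborel) \<partial>R)"
    unfolding J_def using u by (intro nn_integral_cong) (auto split: split_indicator simp: level_def min_def)
  also have "\<dots> = (\<integral>\<^sup>+\<omega>. (\<integral>\<^sup>+r. ?c \<omega> r *
      (if N \<omega> r = real k \<and> 0 < r \<and> r \<le> u then 1 else 0) \<partial>lborel) \<partial>R)"
  proof (rule nn_integral_cong)
    fix \<omega> assume "\<omega> \<in> space R"
    then have w: "\<omega> \<in> space M" by (simp add: spR)
    show "(\<integral>\<^sup>+r. J (\<omega>, r) \<partial>lborel) = (\<integral>\<^sup>+r. ?c \<omega> r *
      (if N \<omega> r = real k \<and> 0 < r \<and> r \<le> u then 1 else 0) \<partial>lborel)"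
    proof (rule nn_integral_cong_AE)
      show "AE r in lborel. J (\<omega>, r) = ?c \<omega> r *
        (if N \<omega> r = real k \<and> 0 < r \<and> r \<le> u then 1 else 0)"
        using AE_lborel_singleton[of "jump_time k \<omega>"] AE_lborel_singleton[of "jump_time (Suc k) \<omega>"]
      proof eventually_elim
        case (elim r)
        show ?case
        proof (cases "0 < r \<and> r \<le> u")
          case True
          then have "N \<omega> r = real k \<longleftrightarrow> jump_time k \<omega> < r \<and> r \<le> jump_time (Suc k) \<omega>"
            using N_eq_iff[OF w, of r k] u elim by auto
          then show ?thesis using True by (simp add: J_def)
        next
          case False
          then show ?thesis using jump_time_bounds(1)[of k \<omega>] by (auto simp: J_def)
        qed
      qed
    qed
  qed
  also have "\<dots> = (\<integral>\<^sup>+\<omega>. (\<integral>\<^sup>+r. ?c \<omega> r *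
      ?i \<omega> r \<partial>lborel) \<partial>R)"
    by (intro nn_integral_cong) (use u spR N_eq_iff[of _ _ k] in auto)
  also have "\<dots> = (\<integral>\<^sup>+r. (\<integral>\<^sup>+\<omega>. ?c \<omega> r *
      ?i \<omega> r \<partial>R) \<partial>lborel)"
  proof (rule P.Fubini')
    have "(\<lambda>x. (f ((jumps k (fst x))(Suc k := snd x)) * weight g k (fst x)) * e (fst x, min (snd x) u) *
      (if jump_time k (fst x) \<le> snd x \<and> snd x < jump_time (Suc k) (fst x) \<and> 0 < snd x \<and> snd x \<le> u then 1 else 0))
      \<in> borel_measurable (R \<Otimes>\<^sub>M lborel)"
      unfolding mp using 1 2 weight_measurable[OF g] jump_time_measurable by measurable
    from measurable_compose[OF measurable_pair_swap'[of lborel R] this]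
    show "(\<lambda>(r, \<omega>). ?c \<omega> r *
      ?i \<omega> r) \<in> borel_measurable (lborel \<Otimes>\<^sub>M R)"
      by (simp add: case_prod_beta')
  qed
  also have "\<dots> = (\<integral>\<^sup>+r\<in>{0<..u}. slice R g e k r (\<lambda>x. f (x(Suc k := r))) \<partial>lborel)"
  proof (rule nn_integral_cong)
    fix r
    show "(\<integral>\<^sup>+\<omega>. ?c \<omega> r *
      ?i \<omega> r \<partial>R) =
      slice R g e k r (\<lambda>x. f (x(Suc k := r))) * indicator {0<..u} r"
    proof (cases "r \<in> {0<..u}")
      case True
      then have "(\<integral>\<^sup>+\<omega>. ?c \<omega> r *
        ?i \<omega> r \<partial>R) =
        slice R g e k r (\<lambda>x. f (x(Suc k := r)))"
        unfolding slice_def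
        by (intro nn_integral_cong) (use u spR N_eq_iff[of _ r k] in \<open>auto split: split_indicator\<close>)
      then show ?thesis using True by simp
    next
      case False
      then show ?thesis by auto
    qed
  qed
  finally show ?thesis .
qed

lemma expo_at_0: "expo \<kappa> \<kappa>' (\<omega>, 0) = 1"
  by (simp add: expo_def cumul_def)

lemma slice_0:
  assumes "prob_space R" "sets R = sets M"
  shows "(\<integral>\<^sup>+\<omega>. (f (jumps 0 \<omega>) * weight g 0 \<omega>) * expo \<kappa> \<kappa>' (\<omega>, jump_time 0 \<omega>) * indicator {..u} (jump_time 0 \<omega>) \<partial>R) =
    f (\<lambda>j. if j = 0 then 0 else T + 1) * indicator {..u} 0"
proof -
  interpret R: prob_space R by fact
  have spR: "space R = space M" using assms(2) by (rule sets_eq_imp_space_eq)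
  have "(\<integral>\<^sup>+\<omega>. (f (jumps 0 \<omega>) * weight g 0 \<omega>) * expo \<kappa> \<kappa>' (\<omega>, jump_time 0 \<omega>) * indicator {..u} (jump_time 0 \<omega>) \<partial>R) =
    (\<integral>\<^sup>+\<omega>. f (\<lambda>j. if j = 0 then 0 else T + 1) * indicator {..u} 0 \<partial>R)"
  proof (rule nn_integral_cong)
    fix \<omega> assume "\<omega> \<in> space R"
    then have 0: "jump_time 0 \<omega> = 0" using jump_time_0 spR by simp
    have "jumps 0 \<omega> = (\<lambda>j. if j = 0 then 0 else T + 1)" by (auto simp: jumps_def 0)
    then show "(f (jumps 0 \<omega>) * weight g 0 \<omega>) * expo \<kappa> \<kappa>' (\<omega>, jump_time 0 \<omega>) * indicator {..u} (jump_time 0 \<omega>) =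
      f (\<lambda>j. if j = 0 then 0 else T + 1) * indicator {..u} 0"
      by (simp add: 0 expo_at_0)
  qed
  then show ?thesis by (simp add: R.emeasure_space_1)
qed

lemma upd_measurable:
  assumes f: "f \<in> borel_measurable seqs" shows "(\<lambda>x. f (x(i := r))) \<in> borel_measurable seqs"
proof -
  have "(\<lambda>x. x(i := r)) \<in> measurable seqs seqs"
  proof (rule measurable_PiM_single')
    fix j show "(\<lambda>x. (x(i := r)) j) \<in> borel_measurable seqs"
      by (cases "j = i") (auto intro: measurable_component_singleton)
  qed auto
  from measurable_compose[OF this f] show ?thesis .
qed

lemma weight_finite:
  assumes "\<And>x. g x < \<infinity>" shows "weight g k \<omega> < \<infinity>"
  using assms by (induction k) (auto simp: weight_Suc ennreal_mult_less_top)

text \<open>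
  With \<open>g = 1/\<kappa>\<close> the intensity cancels at the jump, and a recursion without \<open>\<kappa>\<close> remains.
\<close>

lemma slice_step_le:
  assumes int: "has_intensity R \<kappa>" and f: "f \<in> borel_measurable seqs" "\<And>x. f x < \<infinity>"
    and g: "g \<in> borel_measurable pred_sigma" "\<And>x. g x < \<infinity>" and gk: "\<And>x. g x * \<kappa> x = 1" and u: "0 \<le> u" "u \<le> T"
  shows "slice R g (expo \<kappa> (\<lambda>_. 0)) (Suc k) u f \<le>
    (\<integral>\<^sup>+r\<in>{0<..u}. slice R g (expo \<kappa> (\<lambda>_. 0)) k r (\<lambda>x. f (x(Suc k := r))) \<partial>lborel)"
proof -
  note pR = has_intensityD(1)[OF int] and sR = has_intensityD(2)[OF int] and k = has_intensityD(4)[OF int]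
  have k0: "(\<lambda>_. 0 :: ennreal) \<in> borel_measurable pred_sigma" by simp
  note eP = expo_pred_sigma[OF k k0]
  have wf: "f (jumps (Suc k) \<omega>) * weight g (Suc k) \<omega> < \<infinity>" for \<omega>
    using f(2) weight_finite[of g] g(2) by (simp add: ennreal_mult_less_top)
  have "slice R g (expo \<kappa> (\<lambda>_. 0)) (Suc k) u f \<le>
    (\<integral>\<^sup>+\<omega>. (f (jumps (Suc k) \<omega>) * weight g (Suc k) \<omega>) * expo \<kappa> (\<lambda>_. 0) (\<omega>, jump_time (Suc k) \<omega>) * indicator {..u} (jump_time (Suc k) \<omega>) \<partial>R)"
    using one_jump_inequality[OF int k0 _ prior_weight[OF f(1) g(1), of "Suc k"] u wf]
    unfolding slice_def by (simp add: cumul_def)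
  also have "\<dots> = (\<integral>\<^sup>+\<omega>. (\<integral>\<^sup>+r. (f ((jumps k \<omega>)(Suc k := r)) * weight g k \<omega>) * (expo \<kappa> (\<lambda>_. 0) (\<omega>, r) * (g (\<omega>, r) * \<kappa> (\<omega>, r))) * indicator (level k \<omega> \<inter> {..u}) r \<partial>lborel) \<partial>R)"
    by (rule jump_step[OF int f(1) g(1) eP u])
  also have "\<dots> = (\<integral>\<^sup>+\<omega>. (\<integral>\<^sup>+r. (f ((jumps k \<omega>)(Suc k := r)) * weight g k \<omega>) * expo \<kappa> (\<lambda>_. 0) (\<omega>, r) * indicator (level k \<omega> \<inter> {..u}) r \<partial>lborel) \<partial>R)"
    by (simp add: gk)
  also have "\<dots> = (\<integral>\<^sup>+r\<in>{0<..u}. slice R g (expo \<kappa> (\<lambda>_. 0)) k r (\<lambda>x. f (x(Suc k := r))) \<partial>lborel)"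
    by (rule slice_swap[OF pR sR f(1) g(1) eP u])
  finally show ?thesis .
qed

text \<open>
  For intensity \<open>1\<close> the recursion is exact, since the cumulative intensity up to \<open>T\<close> is bounded.
\<close>

lemma slice_step_unit:
  assumes int: "has_intensity R (\<lambda>_. 1)" and f: "f \<in> borel_measurable seqs" "\<And>x. f x \<le> 1" and u: "0 \<le> u" "u \<le> T"
  shows "slice R (\<lambda>_. 1) (expo (\<lambda>_. 1) (\<lambda>_. 0)) (Suc k) u f =
    (\<integral>\<^sup>+r\<in>{0<..u}. slice R (\<lambda>_. 1) (expo (\<lambda>_. 1) (\<lambda>_. 0)) k r (\<lambda>x. f (x(Suc k := r))) \<partial>lborel)"
    and "slice R (\<lambda>_. 1) (expo (\<lambda>_. 1) (\<lambda>_. 0)) 0 u f = f (\<lambda>j. if j = 0 then 0 else T + 1)"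
proof -
  note pR = has_intensityD(1)[OF int] and sR = has_intensityD(2)[OF int]
  have k1: "(\<lambda>_. 1 :: ennreal) \<in> borel_measurable pred_sigma" and k0: "(\<lambda>_. 0 :: ennreal) \<in> borel_measurable pred_sigma" by simp_all
  note eP = expo_pred_sigma[OF k1 k0]
  obtain n where n: "T \<le> real n" using real_arch_simple by blast
  have bdd: "cumul (\<lambda>_. 1) \<omega> T \<le> of_nat n" for \<omega>
    using T_nonneg n by (simp add: cumul_def)
  have w1: "f (jumps j \<omega>) * weight (\<lambda>_. 1) j \<omega> \<le> 1" for j \<omega> using f(2) by (simp add: weight_def)
  have eq: "slice R (\<lambda>_. 1) (expo (\<lambda>_. 1) (\<lambda>_. 0)) j u f =
    (\<integral>\<^sup>+\<omega>. (f (jumps j \<omega>) * weight (\<lambda>_. 1) j \<omega>) * expo (\<lambda>_. 1) (\<lambda>_. 0) (\<omega>, jump_time j \<omega>) * indicator {..u} (jump_time j \<omega>) \<partial>R)" for j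
    unfolding slice_def
    by (rule one_jump_equality[OF int prior_weight[OF f(1) k1] u w1 bdd])
  show "slice R (\<lambda>_. 1) (expo (\<lambda>_. 1) (\<lambda>_. 0)) 0 u f = f (\<lambda>j. if j = 0 then 0 else T + 1)"
    unfolding eq slice_0[OF pR sR] using u by simp
  show "slice R (\<lambda>_. 1) (expo (\<lambda>_. 1) (\<lambda>_. 0)) (Suc k) u f =
    (\<integral>\<^sup>+r\<in>{0<..u}. slice R (\<lambda>_. 1) (expo (\<lambda>_. 1) (\<lambda>_. 0)) k r (\<lambda>x. f (x(Suc k := r))) \<partial>lborel)"
    unfolding eq jump_step[OF int f(1) k1 eP u] slice_swap[OF pR sR f(1) k1 eP u, symmetric] by simp
qed

lemma slice_le:
  assumes Q: "has_intensity Q \<kappa>" and P: "has_intensity P (\<lambda>_. 1)"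
    and g: "g \<in> borel_measurable pred_sigma" "\<And>x. g x < \<infinity>" and gk: "\<And>x. g x * \<kappa> x = 1"
    and f: "f \<in> borel_measurable seqs" "\<And>x. f x \<le> 1" and u: "0 \<le> u" "u \<le> T"
  shows "slice Q g (expo \<kappa> (\<lambda>_. 0)) k u f \<le> slice P (\<lambda>_. 1) (expo (\<lambda>_. 1) (\<lambda>_. 0)) k u f"
  using f u
proof (induction k arbitrary: u f)
  case 0
  have k0: "(\<lambda>_. 0 :: ennreal) \<in> borel_measurable pred_sigma" by simp
  have wf: "f (jumps 0 \<omega>) * weight g 0 \<omega> < \<infinity>" for \<omega>
    using 0(2)[of "jumps 0 \<omega>"] by (simp add: order.strict_trans1[OF _ ennreal_one_less_top])
  have "slice Q g (expo \<kappa> (\<lambda>_. 0)) 0 u f \<le>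
    (\<integral>\<^sup>+\<omega>. (f (jumps 0 \<omega>) * weight g 0 \<omega>) * expo \<kappa> (\<lambda>_. 0) (\<omega>, jump_time 0 \<omega>) * indicator {..u} (jump_time 0 \<omega>) \<partial>Q)"
    using one_jump_inequality[OF Q k0 _ prior_weight[OF 0(1) g(1), of 0] 0(3,4) wf]
    unfolding slice_def by (simp add: cumul_def)
  also have "\<dots> = f (\<lambda>j. if j = 0 then 0 else T + 1)"
    using slice_0[OF has_intensityD(1,2)[OF Q]] 0 by simp
  also have "\<dots> = slice P (\<lambda>_. 1) (expo (\<lambda>_. 1) (\<lambda>_. 0)) 0 u f"
    by (rule slice_step_unit(2)[OF P 0, symmetric])
  finally show ?case .
next
  case (Suc k)
  have ff: "f x < \<infinity>" for x using Suc.prems(2)[of x] by (simp add: order.strict_trans1[OF _ ennreal_one_less_top])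
  have "slice Q g (expo \<kappa> (\<lambda>_. 0)) (Suc k) u f \<le>
    (\<integral>\<^sup>+r\<in>{0<..u}. slice Q g (expo \<kappa> (\<lambda>_. 0)) k r (\<lambda>x. f (x(Suc k := r))) \<partial>lborel)"
    by (rule slice_step_le[OF Q Suc.prems(1) ff g gk Suc.prems(3,4)])
  also have "\<dots> \<le> (\<integral>\<^sup>+r\<in>{0<..u}. slice P (\<lambda>_. 1) (expo (\<lambda>_. 1) (\<lambda>_. 0)) k r (\<lambda>x. f (x(Suc k := r))) \<partial>lborel)"
    using Suc.prems by (intro nn_integral_mono) (auto split: split_indicator intro!: Suc.IH upd_measurable)
  also have "\<dots> = slice P (\<lambda>_. 1) (expo (\<lambda>_. 1) (\<lambda>_. 0)) (Suc k) u f"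
    by (rule slice_step_unit(1)[OF P Suc.prems, symmetric])
  finally show ?case .
qed

text \<open>
  If there are \<open>k\<close> jumps up to \<open>T\<close>, then \<open>N s\<close> is the number of the first \<open>k\<close> jump times in \<open>{..s}\<close>.
  The property passes to generated sigma-algebras.
\<close>

lemma past_factors_through_jumps:
  assumes "B \<in> sets (F T)"
  shows "\<exists>E\<in>sets seqs. \<forall>\<omega>\<in>space M. N \<omega> T = real k \<longrightarrow> (\<omega> \<in> B \<longleftrightarrow> jumps k \<omega> \<in> E)"
  using assms unfolding sets_F
proof (induction rule: sigma_sets.induct)
  case (Basic B)
  then obtain s S where B: "B = (\<lambda>\<omega>. N \<omega> s) -` S \<inter> space M" "0 \<le> s" "s \<le> T" "S \<in> sets borel" by blast
  define c where "c = (\<lambda>x::nat \<Rightarrow> real. \<Sum>j\<in>{1..k}. indicator {..s} (x j) :: real)"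
  have c: "c \<in> borel_measurable seqs" unfolding c_def by measurable
  show ?case
  proof (intro bexI[of _ "c -` S \<inter> space seqs"] ballI impI)
    show "c -` S \<inter> space seqs \<in> sets seqs" using c B(4) by (rule measurable_sets)
    fix \<omega> assume w: "\<omega> \<in> space M" and NT: "N \<omega> T = real k"
    obtain n where n: "N \<omega> s = real n" by (rule N_nat[OF w B(2)])
    have nk: "n \<le> k" using N_mono[OF w B(2,3)] n NT by simp
    have "c (jumps k \<omega>) = (\<Sum>j\<in>{1..k}. if j \<in> {1..n} then 1 else 0)"
      unfolding c_def using jump_time_le_iff[OF w B(2,3)] n nk
      by (intro sum.cong refl) (auto simp: jumps_def split: split_indicator)
    also have "\<dots> = (\<Sum>j\<in>{1..k} \<inter> {1..n}. 1)"
      by (rule sum.inter_restrict[symmetric]) simp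
    also have "{1..k} \<inter> {1..n} = {1..n}" using nk by auto
    also have "(\<Sum>j\<in>{1..n}. 1) = N \<omega> s" using n by simp
    finally show "\<omega> \<in> B \<longleftrightarrow> jumps k \<omega> \<in> c -` S \<inter> space seqs"
      using w by (simp add: B space_PiM)
  qed
next
  case Empty then show ?case by (intro bexI[of _ "{}"]) auto
next
  case (Compl B)
  obtain E where "E \<in> sets seqs" "\<forall>\<omega>\<in>space M. N \<omega> T = real k \<longrightarrow> (\<omega> \<in> B \<longleftrightarrow> jumps k \<omega> \<in> E)"
    using Compl.IH by blast
  moreover from this have "space seqs - E \<in> sets seqs" by (intro sets.compl_sets)
  ultimately show ?case by (intro bexI[of _ "space seqs - E"]) (auto simp: space_PiM)
next
  case (Union B)
  then obtain E where "\<And>i. E i \<in> sets seqs" "\<And>i. \<forall>\<omega>\<in>space M. N \<omega> T = real k \<longrightarrow> (\<omega> \<in> B i \<longleftrightarrow> jumps k \<omega> \<in> E i)" by metis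
  then show ?case by (intro bexI[of _ "\<Union>i. E i"]) auto
qed

end

section \<open>The likelihood ratio on a finite horizon\<close>

context counting_process
begin

text \<open>
  The exponential of \<open>\<zeta>\<close> at time \<open>T\<close> in terms of the jump times, wherever the cumulative intensity
  is finite. As an explicit function of the jump times it is measurable for the past of \<open>T\<close>.
\<close>

definition likelihood :: "('a \<times> real \<Rightarrow> ennreal) \<Rightarrow> 'a \<Rightarrow> ennreal" where
  "likelihood \<kappa> \<omega> = weight \<kappa> (nat \<lfloor>N \<omega> T\<rfloor>) \<omega> * expo (\<lambda>_. 1) \<kappa> (\<omega>, T)"

lemma cumul_1: "0 \<le> u \<Longrightarrow> cumul (\<lambda>_. 1) \<omega> u = ennreal u"
  by (simp add: cumul_def)

lemma likelihood_F_measurable: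
  assumes k: "\<kappa> \<in> borel_measurable pred_sigma"
  shows "likelihood \<kappa> \<in> borel_measurable (F T)"
proof -
  have k1: "(\<lambda>_. 1 :: ennreal) \<in> borel_measurable pred_sigma" by simp
  have n: "(\<lambda>\<omega>. nat \<lfloor>N \<omega> T\<rfloor>) \<in> measurable (F T) (count_space UNIV)"
    using N_F_measurable[OF T_nonneg order_refl] by measurable
  define f where "f = (\<lambda>k \<omega>. (\<Prod>j\<in>{1..k}. \<kappa> (\<omega>, min (jump_time j \<omega>) T)))"
  have f: "f k \<in> borel_measurable (F T)" for k
    unfolding f_def
    by (intro borel_measurable_prod_ennreal measurable_compose[OF graph_measurable[OF jump_time_measurable_F T_nonneg] k])
  have e: "(\<lambda>\<omega>. expo (\<lambda>_. 1) \<kappa> (\<omega>, T)) \<in> borel_measurable (F T)"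
    by (rule measurable_compose[OF pred_sigma_snd_const[OF T_nonneg] expo_pred_sigma[OF k1 k]])
  have "(\<lambda>\<omega>. f (nat \<lfloor>N \<omega> T\<rfloor>) \<omega> * expo (\<lambda>_. 1) \<kappa> (\<omega>, T)) \<in> borel_measurable (F T)"
    by (intro borel_measurable_times_ennreal measurable_compose_countable[OF f n] e)
  also have "(\<lambda>\<omega>. f (nat \<lfloor>N \<omega> T\<rfloor>) \<omega> * expo (\<lambda>_. 1) \<kappa> (\<omega>, T)) \<in> borel_measurable (F T) \<longleftrightarrow>
    likelihood \<kappa> \<in> borel_measurable (F T)"
  proof (rule measurable_cong)
    fix \<omega> assume "\<omega> \<in> space (F T)"
    then have w: "\<omega> \<in> space M" by simp
    obtain n where n: "N \<omega> T = real n" by (rule N_nat[OF w T_nonneg])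
    have "min (jump_time j \<omega>) T = jump_time j \<omega>" if "j \<in> {1..n}" for j
      using jump_time_le_iff[OF w T_nonneg order_refl, of j] that n by simp
    then have "f n \<omega> = weight \<kappa> n \<omega>" unfolding f_def weight_def by (intro prod.cong) auto
    then show "f (nat \<lfloor>N \<omega> T\<rfloor>) \<omega> * expo (\<lambda>_. 1) \<kappa> (\<omega>, T) = likelihood \<kappa> \<omega>"
      by (simp add: likelihood_def n)
  qed
  finally show ?thesis .
qed

lemma sum_over_levels:
  assumes sR: "sets R = sets M" and G: "\<And>k. G k \<in> borel_measurable M"
  shows "(\<integral>\<^sup>+\<omega>. G (nat \<lfloor>N \<omega> T\<rfloor>) \<omega> \<partial>R) = (\<Sum>k. \<integral>\<^sup>+\<omega>. G k \<omega> * indicator {real k} (N \<omega> T) \<partial>R)"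
proof -
  have spR: "space R = space M" using sR by (rule sets_eq_imp_space_eq)
  have [measurable]: "(\<lambda>\<omega>. N \<omega> T) \<in> borel_measurable R" "G k \<in> borel_measurable R" for k
    using N_measurable[OF T_nonneg] G[of k] sR by (simp_all cong: measurable_cong_sets)
  have "(\<integral>\<^sup>+\<omega>. G (nat \<lfloor>N \<omega> T\<rfloor>) \<omega> \<partial>R) = (\<integral>\<^sup>+\<omega>. (\<Sum>k. G k \<omega> * indicator {real k} (N \<omega> T)) \<partial>R)"
  proof (rule nn_integral_cong)
    fix \<omega> assume "\<omega> \<in> space R"
    then obtain n where n: "N \<omega> T = real n" using N_nat[OF _ T_nonneg] spR by metis
    have "(\<Sum>k. G k \<omega> * indicator {real k} (N \<omega> T)) = (\<Sum>k\<in>{n}. G k \<omega> * indicator {real k} (N \<omega> T))"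
      by (rule suminf_finite) (auto simp: n)
    then show "G (nat \<lfloor>N \<omega> T\<rfloor>) \<omega> = (\<Sum>k. G k \<omega> * indicator {real k} (N \<omega> T))" by (simp add: n)
  qed
  also have "\<dots> = (\<Sum>k. \<integral>\<^sup>+\<omega>. G k \<omega> * indicator {real k} (N \<omega> T) \<partial>R)"
    by (rule nn_integral_suminf) measurable
  finally show ?thesis .
qed

text \<open>
  The comparison of slices, summed over the number of jumps.
\<close>

lemma inverse_likelihood_le:
  assumes Q: "has_intensity Q \<kappa>" and P: "has_intensity P (\<lambda>_. 1)"
    and g: "g \<in> borel_measurable pred_sigma" "\<And>x. g x < \<infinity>" and gk: "\<And>x. g x * \<kappa> x = 1" and B: "B \<in> sets (F T)"
  shows "(\<integral>\<^sup>+\<omega>. weight g (nat \<lfloor>N \<omega> T\<rfloor>) \<omega> * expo \<kappa> (\<lambda>_. 0) (\<omega>, T) * ennreal (exp (- T)) * indicator B \<omega> \<partial>Q) \<le> emeasure P B"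
proof -
  let ?q = "\<lambda>k \<omega>. weight g k \<omega> * expo \<kappa> (\<lambda>_. 0) (\<omega>, T) * ennreal (exp (- T)) * indicator B \<omega>"
  let ?n = "\<lambda>k \<omega>. indicator {real k} (N \<omega> T) :: ennreal"
  let ?eP = "\<lambda>\<omega>. expo (\<lambda>_. 1) (\<lambda>_. 0) (\<omega>, T)"
  note sQ = has_intensityD(2)[OF Q] and sP = has_intensityD(2)[OF P] and k = has_intensityD(4)[OF Q]
  have k0: "(\<lambda>_. 0 :: ennreal) \<in> borel_measurable pred_sigma" and k1: "(\<lambda>_. 1 :: ennreal) \<in> borel_measurable pred_sigma" by simp_all
  have BM[measurable]: "B \<in> sets M" using B F_sub_M by blast
  have eM[measurable]: "(\<lambda>\<omega>. expo \<kappa> (\<lambda>_. 0) (\<omega>, T)) \<in> borel_measurable M"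
    by (rule F_measurable_M[OF measurable_compose[OF pred_sigma_snd_const[OF T_nonneg] expo_pred_sigma[OF k k0]]])
  note [measurable] = weight_measurable[OF g(1)] N_measurable[OF T_nonneg]
  have mQ: "f \<in> borel_measurable Q" "f \<in> borel_measurable P" if "f \<in> borel_measurable M" for f :: "'a \<Rightarrow> ennreal"
    using that sQ sP by (simp_all cong: measurable_cong_sets)
  have ee: "?eP \<omega> * ennreal (exp (- T)) = 1" for \<omega>
    using T_nonneg by (simp add: expo_def cumul_1 cumul_def[of "\<lambda>_. 0"] ennreal_mult[symmetric] exp_add[symmetric])
  have level: "(\<integral>\<^sup>+\<omega>. ?q k \<omega> * ?n k \<omega> \<partial>Q)
     \<le> (\<integral>\<^sup>+\<omega>. indicator B \<omega> * ?n k \<omega> \<partial>P)" for k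
  proof -
    obtain E where E: "E \<in> sets seqs" "\<And>\<omega>. \<omega> \<in> space M \<Longrightarrow> N \<omega> T = real k \<Longrightarrow> (\<omega> \<in> B \<longleftrightarrow> jumps k \<omega> \<in> E)"
      using past_factors_through_jumps[OF B, of k] by blast
    define f where "f = (indicator E :: (nat \<Rightarrow> real) \<Rightarrow> ennreal)"
    have f: "f \<in> borel_measurable seqs" "\<And>x. f x \<le> 1"
      unfolding f_def using E by (auto split: split_indicator)
    have fB: "f (jumps k \<omega>) * ?n k \<omega> = indicator B \<omega> * ?n k \<omega>" if "\<omega> \<in> space M" for \<omega>
      using E(2)[OF that] by (auto simp: f_def split: split_indicator)
    note [measurable] = measurable_compose[OF jumps_measurable f(1)]
    have "(\<integral>\<^sup>+\<omega>. ?q k \<omega> * ?n k \<omega> \<partial>Q) =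
      (\<integral>\<^sup>+\<omega>. ((f (jumps k \<omega>) * weight g k \<omega>) * expo \<kappa> (\<lambda>_. 0) (\<omega>, T) * ?n k \<omega>) * ennreal (exp (- T)) \<partial>Q)"
    proof (rule nn_integral_cong)
      fix \<omega> assume "\<omega> \<in> space Q"
      then have "\<omega> \<in> space M" using has_intensityD(3)[OF Q] by simp
      from fB[OF this] show "?q k \<omega> * ?n k \<omega> =
        ((f (jumps k \<omega>) * weight g k \<omega>) * expo \<kappa> (\<lambda>_. 0) (\<omega>, T) * ?n k \<omega>) * ennreal (exp (- T))"
        by (auto split: split_indicator simp: mult_ac)
    qed
    also have "\<dots> = slice Q g (expo \<kappa> (\<lambda>_. 0)) k T f * ennreal (exp (- T))"
      unfolding slice_def by (rule nn_integral_multc) (rule mQ, measurable)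
    also have "\<dots> \<le> slice P (\<lambda>_. 1) (expo (\<lambda>_. 1) (\<lambda>_. 0)) k T f * ennreal (exp (- T))"
      by (intro mult_right_mono slice_le[OF Q P g gk f T_nonneg order_refl]) simp
    also have "\<dots> = (\<integral>\<^sup>+\<omega>. ((f (jumps k \<omega>) * weight (\<lambda>_. 1) k \<omega>) * ?eP \<omega> * ?n k \<omega>) * ennreal (exp (- T)) \<partial>P)"
      unfolding slice_def
    proof (rule nn_integral_multc[symmetric], rule mQ)
      note [measurable] = F_measurable_M[OF measurable_compose[OF pred_sigma_snd_const[OF T_nonneg] expo_pred_sigma[OF k1 k0]]] weight_measurable[OF k1]
      show "(\<lambda>\<omega>. f (jumps k \<omega>) * weight (\<lambda>_. 1) k \<omega> * ?eP \<omega> * ?n k \<omega>) \<in> borel_measurable M"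
        by measurable
    qed
    also have "\<dots> = (\<integral>\<^sup>+\<omega>. indicator B \<omega> * ?n k \<omega> \<partial>P)"
    proof (rule nn_integral_cong)
      fix \<omega> assume "\<omega> \<in> space P"
      then have "\<omega> \<in> space M" using has_intensityD(3)[OF P] by simp
      from fB[OF this] ee[of \<omega>] show "((f (jumps k \<omega>) * weight (\<lambda>_. 1) k \<omega>) * ?eP \<omega> * ?n k \<omega>) * ennreal (exp (- T)) =
        indicator B \<omega> * ?n k \<omega>"
        by (auto split: split_indicator simp: weight_def mult.assoc)
    qed
    finally show ?thesis .
  qed
  have "(\<integral>\<^sup>+\<omega>. weight g (nat \<lfloor>N \<omega> T\<rfloor>) \<omega> * expo \<kappa> (\<lambda>_. 0) (\<omega>, T) * ennreal (exp (- T)) * indicator B \<omega> \<partial>Q) =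
    (\<Sum>k. \<integral>\<^sup>+\<omega>. ?q k \<omega> * ?n k \<omega> \<partial>Q)"
    by (rule sum_over_levels[OF sQ, where G = "\<lambda>k \<omega>. ?q k \<omega>"]) measurable
  also have "\<dots> \<le> (\<Sum>k. \<integral>\<^sup>+\<omega>. indicator B \<omega> * ?n k \<omega> \<partial>P)"
    by (intro suminf_le level) auto
  also have "\<dots> = (\<integral>\<^sup>+\<omega>. indicator B \<omega> \<partial>P)"
    by (rule sum_over_levels[OF sP, symmetric]) measurable
  also have "\<dots> = emeasure P B" using BM sP by simp
  finally show ?thesis .
qed

text \<open>
  Let \<open>p j\<close> be the expectation over the paths with \<open>j\<close> jumps, and \<open>V j\<close> the expectation of the
  likelihood taken at the \<open>j\<close>-th jump. What is not yet collected in \<open>p j\<close> flows into the next jump,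
  \<open>p j + V (j + 1) \<le> V j\<close>, and \<open>V 0 = 1\<close>.
\<close>

lemma likelihood_integral_le_1:
  assumes P: "has_intensity P (\<lambda>_. 1)" and k: "\<kappa> \<in> borel_measurable pred_sigma" "\<And>x. \<kappa> x < \<infinity>"
    and fin: "AE \<omega> in P. cumul \<kappa> \<omega> T < \<infinity>"
  shows "(\<integral>\<^sup>+\<omega>. likelihood \<kappa> \<omega> \<partial>P) \<le> 1"
proof -
  note pP = has_intensityD(1)[OF P] and sP = has_intensityD(2)[OF P]
  have k1: "(\<lambda>_. 1 :: ennreal) \<in> borel_measurable pred_sigma" by simp
  note eP = expo_pred_sigma[OF k1 k(1)]
  let ?e = "expo (\<lambda>_. 1) \<kappa>"
  define p where "p = (\<lambda>j. \<integral>\<^sup>+\<omega>. weight \<kappa> j \<omega> * ?e (\<omega>, T) * indicator {real j} (N \<omega> T) \<partial>P)"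
  define V where "V = (\<lambda>j. \<integral>\<^sup>+\<omega>. weight \<kappa> j \<omega> * ?e (\<omega>, jump_time j \<omega>) * indicator {..T} (jump_time j \<omega>) \<partial>P)"
  have f1: "(\<lambda>_. 1 :: ennreal) \<in> borel_measurable seqs" by simp
  have step: "p j + V (Suc j) \<le> V j" for j
  proof -
    have "V (Suc j) = (\<integral>\<^sup>+\<omega>. (\<integral>\<^sup>+r. weight \<kappa> j \<omega> * (?e (\<omega>, r) * \<kappa> (\<omega>, r)) * indicator (level j \<omega> \<inter> {..T}) r \<partial>lborel) \<partial>P)"
      using jump_step[OF P f1 k(1) eP T_nonneg order_refl, of j] unfolding V_def by simp
    then show ?thesis
      using one_jump_inequality[OF P k(1) fin prior_weight[OF f1 k(1), of j] T_nonneg order_refl] weight_finite[OF k(2)]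
      unfolding p_def V_def by simp
  qed
  have V0: "V 0 = 1"
    using slice_0[OF pP sP, of "\<lambda>_. 1" \<kappa> "\<lambda>_. 1" \<kappa> T] T_nonneg by (simp add: V_def)
  have sum: "(\<Sum>j<n. p j) + V n \<le> 1" for n
  proof (induction n)
    case 0 then show ?case by (simp add: V0)
  next
    case (Suc n)
    have "(\<Sum>j<Suc n. p j) + V (Suc n) = (\<Sum>j<n. p j) + (p n + V (Suc n))" by (simp add: add.assoc)
    also have "\<dots> \<le> (\<Sum>j<n. p j) + V n" by (intro add_left_mono step)
    also have "\<dots> \<le> 1" by (rule Suc)
    finally show ?case .
  qed
  have "(\<integral>\<^sup>+\<omega>. likelihood \<kappa> \<omega> \<partial>P) = (\<Sum>j. p j)"
    unfolding likelihood_def p_def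
  proof (rule sum_over_levels[OF sP, where G = "\<lambda>j \<omega>. weight \<kappa> j \<omega> * ?e (\<omega>, T)"])
    note [measurable] = weight_measurable[OF k(1)] F_measurable_M[OF measurable_compose[OF pred_sigma_snd_const[OF T_nonneg] eP]]
    show "(\<lambda>\<omega>. weight \<kappa> j \<omega> * ?e (\<omega>, T)) \<in> borel_measurable M" for j by measurable
  qed
  also have "\<dots> \<le> 1"
  proof (rule suminf_le_const)
    show "summable p" by (rule summableI)
    show "sum p {..<n} \<le> 1" for n
      using sum[of n] by (meson le_iff_add order_trans)
  qed
  finally show ?thesis .
qed

text \<open>
  The comparison for events extends to nonnegative functions; applied to the likelihood itself it says
  \<open>Q \<le> Z P\<close>. Both sides are measures and the right one has mass at most \<open>1\<close>, so they agree on
  every event and on its complement.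
\<close>

theorem likelihood_is_density:
  assumes Q: "has_intensity Q \<kappa>" and P: "has_intensity P (\<lambda>_. 1)"
    and k: "\<And>x. 0 < \<kappa> x" "\<And>x. \<kappa> x < \<infinity>" and finP: "AE \<omega> in P. cumul \<kappa> \<omega> T < \<infinity>"
    and B: "B \<in> sets (F T)"
  shows "emeasure Q B = (\<integral>\<^sup>+\<omega>\<in>B. likelihood \<kappa> \<omega> \<partial>P)"
proof -
  note sQ = has_intensityD(2)[OF Q] and sP = has_intensityD(2)[OF P] and kP = has_intensityD(4)[OF Q]
    and spP = has_intensityD(3)[OF P]
  interpret Q: prob_space Q by (rule has_intensityD(1)[OF Q])
  define g where "g = (\<lambda>x. inverse (\<kappa> x))"
  have g: "g \<in> borel_measurable pred_sigma" "\<And>x. g x < \<infinity>" "\<And>x. g x * \<kappa> x = 1"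
  proof -
    show "g \<in> borel_measurable pred_sigma" unfolding g_def using kP by measurable
    show "g x < \<infinity>" for x using k(1)[of x] by (simp add: g_def less_top[symmetric] ennreal_inverse_eq_top_iff)
    show "g x * \<kappa> x = 1" for x
      using k[of x] ennreal_divide_self[of "\<kappa> x"] by (simp add: g_def divide_ennreal_def mult.commute less_top)
  qed
  \<comment> \<open>the reciprocal of the likelihood\<close>
  define L where "L = (\<lambda>\<omega>. weight g (nat \<lfloor>N \<omega> T\<rfloor>) \<omega> * expo \<kappa> (\<lambda>_. 0) (\<omega>, T) * ennreal (exp (- T)))"
  have k0: "(\<lambda>_. 0 :: ennreal) \<in> borel_measurable pred_sigma" by simp
  have LM: "L \<in> borel_measurable M"
    unfolding L_def
  proof (intro borel_measurable_times_ennreal)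
    have "(\<lambda>\<omega>. nat \<lfloor>N \<omega> T\<rfloor>) \<in> measurable M (count_space UNIV)"
      using N_measurable[OF T_nonneg] by measurable
    then show "(\<lambda>\<omega>. weight g (nat \<lfloor>N \<omega> T\<rfloor>) \<omega>) \<in> borel_measurable M"
      by (rule measurable_compose_countable[OF weight_measurable[OF g(1)]])
    show "(\<lambda>\<omega>. expo \<kappa> (\<lambda>_. 0) (\<omega>, T)) \<in> borel_measurable M"
      by (rule F_measurable_M[OF measurable_compose[OF pred_sigma_snd_const[OF T_nonneg] expo_pred_sigma[OF kP k0]]])
  qed simp
  have LQ[measurable]: "L \<in> borel_measurable Q" using LM sQ by (simp cong: measurable_cong_sets)
  have L1: "L \<omega> * likelihood \<kappa> \<omega> = 1" for \<omega>
  proof -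
    have "weight g j \<omega> * weight \<kappa> j \<omega> = 1" for j
      unfolding weight_def prod.distrib[symmetric] g(3) by simp
    moreover have "expo \<kappa> (\<lambda>_. 0) (\<omega>, T) * ennreal (exp (- T)) * expo (\<lambda>_. 1) \<kappa> (\<omega>, T) = 1"
      using T_nonneg by (simp add: expo_def cumul_1 cumul_def[of "\<lambda>_. 0"] ennreal_mult[symmetric] exp_add[symmetric])
    moreover have "(a * b * c) * (d * e) = (a * d) * (b * c * e)" for a b c d e :: ennreal by (simp add: mult_ac)
    ultimately show ?thesis unfolding L_def likelihood_def by simp
  qed
  define mQ where "mQ = distr (density Q L) (F T) (\<lambda>x. x)"
  define mP where "mP = distr P (F T) (\<lambda>x. x)"
  have idQ: "(\<lambda>x. x) \<in> measurable (density Q L) (F T)" "(\<lambda>x. x) \<in> measurable P (F T)"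
    using F_sub_M[of T] sQ sP spP has_intensityD(3)[OF Q] by (auto simp: measurable_def)
  have BQ: "C \<in> sets Q" if "C \<in> sets (F T)" for C using that F_sub_M sQ by blast
  have "mQ \<le> mP"
  proof (subst le_measure)
    show "sets mQ = sets mP" by (simp add: mQ_def mP_def)
    show "\<forall>A\<in>sets mQ. emeasure mQ A \<le> emeasure mP A"
    proof
      fix A assume "A \<in> sets mQ"
      then have A: "A \<in> sets (F T)" by (simp add: mQ_def)
      have [simp]: "A \<inter> space M = A" using F_sets_le[OF A] by auto
      have "emeasure mQ A = (\<integral>\<^sup>+\<omega>. L \<omega> * indicator A \<omega> \<partial>Q)"
        unfolding mQ_def using A idQ has_intensityD(3)[OF Q] BQ[OF A]
        by (subst emeasure_distr) (auto simp: emeasure_density)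
      also have "\<dots> \<le> emeasure P A" unfolding L_def by (rule inverse_likelihood_le[OF Q P g A])
      also have "\<dots> = emeasure mP A" unfolding mP_def using A idQ spP by (subst emeasure_distr) auto
      finally show "emeasure mQ A \<le> emeasure mP A" .
    qed
  qed
  then have int_le: "(\<integral>\<^sup>+\<omega>. h \<omega> \<partial>mQ) \<le> (\<integral>\<^sup>+\<omega>. h \<omega> \<partial>mP)" for h
    by (intro nn_integral_mono_measure) (auto simp: mQ_def mP_def)
  have le: "emeasure Q C \<le> (\<integral>\<^sup>+\<omega>. likelihood \<kappa> \<omega> * indicator C \<omega> \<partial>P)" if C: "C \<in> sets (F T)" for C
  proof -
    have h: "(\<lambda>\<omega>. likelihood \<kappa> \<omega> * indicator C \<omega>) \<in> borel_measurable (F T)"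
      using likelihood_F_measurable[OF kP] C by measurable
    have hQ: "(\<lambda>\<omega>. likelihood \<kappa> \<omega> * indicator C \<omega>) \<in> borel_measurable Q"
      using F_measurable_M[OF h] sQ by (simp cong: measurable_cong_sets)
    have "emeasure Q C = (\<integral>\<^sup>+\<omega>. L \<omega> * (likelihood \<kappa> \<omega> * indicator C \<omega>) \<partial>Q)"
      using BQ[OF C] by (simp add: mult.assoc[symmetric] L1)
    also have "\<dots> = (\<integral>\<^sup>+\<omega>. likelihood \<kappa> \<omega> * indicator C \<omega> \<partial>mQ)"
      unfolding mQ_def using h hQ idQ by (subst nn_integral_distr) (auto simp: nn_integral_density)
    also have "\<dots> \<le> (\<integral>\<^sup>+\<omega>. likelihood \<kappa> \<omega> * indicator C \<omega> \<partial>mP)" by (rule int_le)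
    also have "\<dots> = (\<integral>\<^sup>+\<omega>. likelihood \<kappa> \<omega> * indicator C \<omega> \<partial>P)"
      unfolding mP_def using h idQ by (subst nn_integral_distr) auto
    finally show ?thesis .
  qed
  have Bc: "space M - B \<in> sets (F T)" using B by (metis sets.compl_sets space_F)
  let ?q = "\<lambda>C. \<integral>\<^sup>+\<omega>. likelihood \<kappa> \<omega> * indicator C \<omega> \<partial>P"
  have lP[measurable]: "likelihood \<kappa> \<in> borel_measurable P"
    using F_measurable_M[OF likelihood_F_measurable[OF kP]] sP by (simp cong: measurable_cong_sets)
  have BP[measurable]: "B \<in> sets P" "space M - B \<in> sets P" using B Bc F_sub_M sP by blast+
  have "?q B + ?q (space M - B) = (\<integral>\<^sup>+\<omega>. likelihood \<kappa> \<omega> * indicator B \<omega> + likelihood \<kappa> \<omega> * indicator (space M - B) \<omega> \<partial>P)"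
    by (rule nn_integral_add[symmetric]) measurable
  also have "\<dots> = (\<integral>\<^sup>+\<omega>. likelihood \<kappa> \<omega> \<partial>P)"
    by (intro nn_integral_cong) (auto simp: spP split: split_indicator)
  also have "\<dots> \<le> 1" by (rule likelihood_integral_le_1[OF P kP k(2) finP])
  also have "1 = emeasure Q B + emeasure Q (space M - B)"
  proof -
    have "emeasure Q B + emeasure Q (space M - B) = emeasure Q (B \<union> (space M - B))"
      using BQ[OF B] BQ[OF Bc] by (intro plus_emeasure) auto
    also have "B \<union> (space M - B) = space Q" using F_sets_le[OF B] has_intensityD(3)[OF Q] by auto
    finally show ?thesis by (simp add: Q.emeasure_space_1)
  qed
  finally have *: "?q B + ?q (space M - B) \<le> emeasure Q B + emeasure Q (space M - B)" .
  have "?q B + emeasure Q (space M - B) \<le> emeasure Q B + emeasure Q (space M - B)"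
    by (rule order_trans[OF add_left_mono[OF le[OF Bc]] *])
  then have "?q B \<le> emeasure Q B"
    by (simp add: add.commute ennreal_add_left_cancel_le)
  then show ?thesis using le[OF B] by simp
qed

end

section \<open>The Poisson process has intensity one\<close>

lemma char_poisson:
  assumes r: "0 < (r::real)"
  shows "char (distr (measure_pmf (poisson_pmf r)) borel real) u = exp (complex_of_real r * (iexp u - 1))"
proof -
  let ?f = "\<lambda>k::nat. (r ^ k / fact k * exp (- r)) *\<^sub>R iexp (u * real k)"
  have "(\<lambda>k. (complex_of_real r * iexp u) ^ k /\<^sub>R fact k) sums exp (complex_of_real r * iexp u)"
    by (rule exp_converges)
  from sums_mult[OF this, of "exp (- complex_of_real r)"]
  have s: "?f sums exp (complex_of_real r * (iexp u - 1))"
  proof -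
    have "exp (- complex_of_real r) * ((complex_of_real r * iexp u) ^ k /\<^sub>R fact k) = ?f k" for k
    proof -
      have "iexp u ^ k = iexp (u * real k)"
        by (simp add: exp_of_nat_mult[symmetric] mult_ac)
      then show ?thesis
        by (simp add: power_mult_distrib scaleR_conv_of_real exp_of_real[symmetric] field_simps)
    qed
    moreover have "exp (- complex_of_real r) * exp (complex_of_real r * iexp u) = exp (complex_of_real r * (iexp u - 1))"
      by (simp add: exp_add[symmetric] algebra_simps)
    ultimately show ?thesis
      using \<open>(\<lambda>k. exp (- complex_of_real r) * ((complex_of_real r * iexp u) ^ k /\<^sub>R fact k)) sums _\<close> by simp
  qed
  have "char (distr (measure_pmf (poisson_pmf r)) borel real) u = (CLINT k|measure_pmf (poisson_pmf r). iexp (u * real k))"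
    unfolding char_def by (subst integral_distr) auto
  also have "\<dots> = (\<integral>k. ?f k \<partial>count_space UNIV)"
    unfolding measure_pmf_eq_density by (subst integral_density) (use r in \<open>auto intro!: AE_I2\<close>)
  also have "\<dots> = exp (complex_of_real r * (iexp u - 1))"
  proof -
    have "integrable (count_space UNIV) ?f"
    proof (subst integrable_count_space_nat_iff)
      have "norm (?f k) = r ^ k / fact k * exp (- r)" for k
        using r by (simp add: norm_exp_i_times abs_mult)
      moreover have "summable (\<lambda>k. r ^ k / fact k * exp (- r))"
        using summable_exp[of r] by (intro summable_mult2) (simp add: field_simps)
      ultimately show "summable (\<lambda>k. norm (?f k))" by simp
    qed
    from sums_integral_count_space_nat[OF this] s show ?thesis by (rule sums_unique2)
  qed
  finally show ?thesis .
qed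

lemma poisson_mean:
  assumes r: "0 < (r::real)"
  shows "(\<integral>\<^sup>+k. ennreal (real k) \<partial>measure_pmf (poisson_pmf r)) = ennreal r"
proof -
  let ?f = "\<lambda>k::nat. r ^ k / fact k * exp (- r) * real k"
  have "(\<lambda>k. r ^ k /\<^sub>R fact k) sums exp r" by (rule exp_converges)
  from sums_mult[OF this, of "r * exp (- r)"]
  have "(\<lambda>k. ?f (Suc k)) sums r"
  proof -
    assume *: "(\<lambda>k. r * exp (- r) * (r ^ k /\<^sub>R fact k)) sums (r * exp (- r) * exp r)"
    have "r * exp (- r) * (r ^ k /\<^sub>R fact k) = ?f (Suc k)" for k
      by (simp add: field_simps del: of_nat_Suc)
    moreover have "r * exp (- r) * exp r = r" by (simp add: exp_minus)
    ultimately show ?thesis using * by (simp only:)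
  qed
  then have s: "?f sums r" using sums_Suc[of ?f r] by simp
  have "(\<integral>\<^sup>+k. ennreal (real k) \<partial>measure_pmf (poisson_pmf r)) = (\<integral>\<^sup>+k. ennreal (pmf (poisson_pmf r) k) * ennreal (real k) \<partial>count_space UNIV)"
    by (rule nn_integral_measure_pmf)
  also have "\<dots> = (\<integral>\<^sup>+k. ennreal (?f k) \<partial>count_space UNIV)"
    using r by (intro nn_integral_cong) (simp add: ennreal_mult[symmetric])
  also have "\<dots> = (\<Sum>k. ennreal (?f k))" by (rule nn_integral_count_space_nat)
  also have "\<dots> = ennreal r" using s r by (intro suminf_ennreal_eq) auto
  finally show ?thesis .
qed

lemma poisson_counting:
  assumes "poisson_process P (natural_filtration (space P) N) N rate" "0 \<le> T"
  shows "counting_process P N T"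
proof
  have sub: "subalgebra P (natural_filtration (space P) N t)" if "0 \<le> t" for t
    using assms(1) that unfolding poisson_process_def is_filtration_def by blast
  show "(\<lambda>\<omega>. N \<omega> t) \<in> borel_measurable P" if "0 \<le> t" for t
  proof -
    have "(\<lambda>\<omega>. N \<omega> t) \<in> borel_measurable (natural_filtration (space P) N t)"
      using assms(1) that unfolding poisson_process_def adapted_def by blast
    with sub[OF that] show ?thesis by (rule measurable_from_subalg)
  qed
qed (use assms in \<open>unfold poisson_process_def, blast+\<close>)

text \<open>
  The characteristic function determines the law of the increment.
\<close>

lemma poisson_increment_mean:
  assumes P: "poisson_process P (natural_filtration (space P) N) N 1" and st: "0 \<le> s" "s \<le> t"
  shows "(\<integral>\<^sup>+\<omega>. ennreal (N \<omega> t - N \<omega> s) \<partial>P) = ennreal (t - s)"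
proof (cases "s = t")
  case False
  interpret counting_process P N 0 using P by (rule poisson_counting) simp
  define r where "r = t - s"
  have r: "0 < r" using st False by (simp add: r_def)
  interpret prob_space P using P unfolding poisson_process_def by blast
  define X where "X = (\<lambda>\<omega>. N \<omega> t - N \<omega> s)"
  have [measurable]: "X \<in> borel_measurable P"
    unfolding X_def by (intro borel_measurable_diff N_measurable st order_trans[OF st])
  let ?\<nu> = "distr (measure_pmf (poisson_pmf r)) borel real"
  have "distr P borel X = ?\<nu>"
  proof (rule Levy_uniqueness)
    show "real_distribution (distr P borel X)" by (rule real_distribution_distr) simp
    show "real_distribution ?\<nu>" by (rule prob_space.real_distribution_distr) (auto intro: prob_space_measure_pmf)
    show "char (distr P borel X) = char ?\<nu>"
    proof
      fix u
      have "char (distr P borel X) u = (CLINT \<omega>|P. iexp (u * X \<omega>))"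
        unfolding char_def by (subst integral_distr) auto
      also have "\<dots> = exp (complex_of_real (1 * (t - s)) * (iexp u - 1))"
        using P st unfolding poisson_process_def X_def by blast
      also have "\<dots> = char ?\<nu> u" using char_poisson[OF r] by (simp add: r_def)
      finally show "char (distr P borel X) u = char ?\<nu> u" .
    qed
  qed
  moreover have "(\<integral>\<^sup>+\<omega>. ennreal (X \<omega>) \<partial>P) = (\<integral>\<^sup>+x. ennreal x \<partial>distr P borel X)"
    by (rule nn_integral_distr[symmetric]) auto
  moreover have "(\<integral>\<^sup>+x. ennreal x \<partial>?\<nu>) = ennreal r"
    using poisson_mean[OF r] by (subst nn_integral_distr) auto
  ultimately show ?thesis by (simp add: X_def r_def)
qed simp

lemma poisson_has_intensity:
  assumes P: "poisson_process P (natural_filtration (space P) N) N 1"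
  shows "counting_process.has_intensity P N P (\<lambda>_. 1)"
proof -
  interpret counting_process P N 0 using P by (rule poisson_counting) simp
  interpret prob_space P using P unfolding poisson_process_def by blast
  have c1: "cumul (\<lambda>_. 1) \<omega> u = ennreal u" if "0 \<le> u" for u \<omega> using that by (rule cumul_1)
  have cN: "counted_minus_cumul (\<lambda>_. 1) \<omega> u = N \<omega> u - u" if "0 \<le> u" for u \<omega> using that by (simp add: counted_minus_cumul_def c1)
  have iX: "integrable P (\<lambda>\<omega>. N \<omega> b - N \<omega> a)" and eX: "(\<integral>\<omega>. N \<omega> b - N \<omega> a \<partial>P) = b - a" if ab: "0 \<le> a" "a \<le> b" for a b
  proof -
    have m[measurable]: "(\<lambda>\<omega>. N \<omega> b - N \<omega> a) \<in> borel_measurable P"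
      by (intro borel_measurable_diff N_measurable ab order_trans[OF ab])
    have nn: "AE \<omega> in P. 0 \<le> N \<omega> b - N \<omega> a" using N_mono[OF _ ab] by (intro AE_I2) simp
    have e: "(\<integral>\<^sup>+\<omega>. ennreal (N \<omega> b - N \<omega> a) \<partial>P) = ennreal (b - a)" by (rule poisson_increment_mean[OF P ab])
    show "integrable P (\<lambda>\<omega>. N \<omega> b - N \<omega> a)"
      by (rule integrableI_nonneg[OF m nn]) (simp add: e)
    show "(\<integral>\<omega>. N \<omega> b - N \<omega> a \<partial>P) = b - a"
      using integral_eq_nn_integral[OF m nn] e ab by simp
  qed
  have iN: "integrable P (\<lambda>\<omega>. N \<omega> u)" if "0 \<le> u" for u
  proof -
    have "integrable P (\<lambda>\<omega>. N \<omega> u - N \<omega> 0) \<longleftrightarrow> integrable P (\<lambda>\<omega>. N \<omega> u)"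
      by (rule Bochner_Integration.integrable_cong) (auto simp: starts_at_0)
    with iX[of 0 u] that show ?thesis by simp
  qed
  show ?thesis unfolding has_intensity_def
  proof (intro conjI allI impI)
    show "prob_space P" by (rule prob_space_axioms)
    show "AE \<omega> in P. cumul (\<lambda>_. 1) \<omega> u < \<infinity>" if "0 \<le> u" for u using that by (simp add: c1)
    show "integrable P (\<lambda>\<omega>. counted_minus_cumul (\<lambda>_. 1) \<omega> u)" if "0 \<le> u" for u using iN[OF that] that by (simp add: cN)
    fix a b :: real and g :: "'a \<Rightarrow> real" assume ab: "0 \<le> a" "a \<le> b" and g: "g \<in> borel_measurable (F a)" and g1: "\<forall>\<omega>. \<bar>g \<omega>\<bar> \<le> 1"
    have gP[measurable]: "g \<in> borel_measurable P" using g by (rule F_measurable_M)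
    have [measurable]: "(\<lambda>\<omega>. N \<omega> a) \<in> borel_measurable P" "(\<lambda>\<omega>. N \<omega> b) \<in> borel_measurable P"
      using N_measurable ab by auto
    have ig: "integrable P g" using g1 by (intro integrable_const_bound[where B = 1]) auto
    have igm: "integrable P (\<lambda>\<omega>. g \<omega> * Y \<omega>)" if "integrable P Y" for Y
      by (rule Bochner_Integration.integrable_bound[OF that])
        (use that g1 in \<open>auto simp: abs_mult mult_left_le_one_le\<close>)
    have ind: "indep_var borel g borel (\<lambda>\<omega>. N \<omega> b - N \<omega> a)"
    proof (subst indep_var_eq, intro conjI)
      have "indep_set (sets (vimage_algebra (space P) (\<lambda>\<omega>. N \<omega> b - N \<omega> a) borel)) (sets (F a))"
        using P ab unfolding poisson_process_def by blast
      then have i: "indep_set (sets (F a)) (sets (vimage_algebra (space P) (\<lambda>\<omega>. N \<omega> b - N \<omega> a) borel))"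
        unfolding indep_sets2_eq by (metis Int_commute mult.commute)
      have "{g -` A \<inter> space P |A. A \<in> sets borel} \<subseteq> sets (F a)"
        using measurable_sets[OF g] by auto
      then have "sigma_sets (space P) {g -` A \<inter> space P |A. A \<in> sets borel} \<subseteq> sets (F a)"
        using sets.sigma_sets_subset[of _ "F a"] by simp
      with i show "indep_set (sigma_sets (space P) {g -` A \<inter> space P |A. A \<in> sets borel})
         (sigma_sets (space P) {(\<lambda>\<omega>. N \<omega> b - N \<omega> a) -` A \<inter> space P |A. A \<in> sets borel})"
        unfolding indep_sets2_eq sets_vimage_algebra by blast
    qed auto
    have "(\<integral>\<omega>. g \<omega> * (N \<omega> b - N \<omega> a) \<partial>P) = (\<integral>\<omega>. g \<omega> \<partial>P) * (b - a)"
      using indep_var_lebesgue_integral[OF ind ig iX[OF ab]] eX[OF ab] by simp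
    then show "(\<integral>\<omega>. g \<omega> * counted_minus_cumul (\<lambda>_. 1) \<omega> b \<partial>P) = (\<integral>\<omega>. g \<omega> * counted_minus_cumul (\<lambda>_. 1) \<omega> a \<partial>P)"
      using igm[OF iN[OF ab(1)]] igm[OF iN[of b]] ab ig by (simp add: cN right_diff_distrib algebra_simps)
  qed auto
qed

section \<open>The martingale hypothesis and the exponent of the density\<close>

context counting_process
begin

text \<open>
  The value \<open>1\<close> off the sample space makes the intensity positive everywhere, so that it can be
  inverted without side conditions.
\<close>

definition intensity :: "('a \<Rightarrow> real \<Rightarrow> real) \<Rightarrow> 'a \<times> real \<Rightarrow> ennreal" where
  "intensity lam x = (if fst x \<in> space M then ennreal (lam (fst x) (max 0 (snd x))) else 1)"

lemma intensity_pred_sigma: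
  assumes "predictable (space M) F lam" shows "intensity lam \<in> borel_measurable pred_sigma"
proof -
  have "intensity lam \<in> borel_measurable pred_sigma \<longleftrightarrow> (\<lambda>x. ennreal (case x of (\<omega>, r) \<Rightarrow> lam \<omega> (max 0 r))) \<in> borel_measurable pred_sigma"
    by (rule measurable_cong) (auto simp: intensity_def)
  also have "\<dots>" using predictable_pred_sigma[OF assms] by measurable
  finally show ?thesis .
qed

lemma cumul_intensity:
  assumes "\<omega> \<in> space M" "0 \<le> u"
  shows "cumul (intensity lam) \<omega> u = cumulative_intensity lam \<omega> u"
  unfolding cumul_def cumulative_intensity_def
  by (rule nn_integral_cong_AE, rule AE_mp[OF AE_lborel_singleton[of 0]], rule AE_I2)
    (use assms in \<open>auto simp: intensity_def max_def split: split_indicator\<close>)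

text \<open>
  Integrability forces the cumulative intensity to be finite almost surely, so the extended and the
  real compensated processes agree almost surely, and conditional expectations can be tested
  against bounded functions of the past.
\<close>

lemma martingale_has_intensity:
  assumes Q: "prob_space Q" "sets Q = sets M" and pred: "predictable (space M) F lam"
    and mart: "martingale Q F (compensated N lam)"
  shows "has_intensity Q (intensity lam)"
proof -
  interpret prob_space Q by fact
  have spQ: "space Q = space M" using Q(2) by (rule sets_eq_imp_space_eq)
  let ?A = "cumul (intensity lam)"
  note k = intensity_pred_sigma[OF pred]
  have X: "compensated N lam \<omega> u = ereal (N \<omega> u) - enn2ereal (?A \<omega> u)" if "\<omega> \<in> space Q" "0 \<le> u" for \<omega> u
    using cumul_intensity[of \<omega> u lam] that spQ by (simp add: compensated_def)
  have filt: "subalgebra Q (F t)" if "0 \<le> t" for t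
    using mart that unfolding martingale_def is_filtration_def by blast
  have Xm: "(\<lambda>\<omega>. compensated N lam \<omega> t) \<in> borel_measurable Q" if "0 \<le> t" for t
    using mart that measurable_from_subalg[OF filt[OF that]] unfolding martingale_def adapted_def by blast
  have Xint: "(\<integral>\<^sup>+\<omega>. e2ennreal \<bar>compensated N lam \<omega> t\<bar> \<partial>Q) < \<infinity>" if "0 \<le> t" for t
    using mart that unfolding martingale_def by blast
  have fin: "AE \<omega> in Q. ?A \<omega> t < \<infinity>" if t: "0 \<le> t" for t
  proof -
    have "(\<lambda>\<omega>. e2ennreal \<bar>compensated N lam \<omega> t\<bar>) \<in> borel_measurable Q"
      using Xm[OF t] by measurable
    then have "AE \<omega> in Q. e2ennreal \<bar>compensated N lam \<omega> t\<bar> \<noteq> \<infinity>"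
      by (rule nn_integral_PInf_AE) (use Xint[OF t] in simp)
    then show ?thesis using AE_space
    proof eventually_elim
      case (elim \<omega>)
      show ?case
      proof (rule ccontr)
        assume "\<not> ?case"
        then have "?A \<omega> t = \<infinity>" by (simp add: not_less top_unique)
        then have "compensated N lam \<omega> t = - \<infinity>" using X[OF elim(2) t] by simp
        then show False using elim(1) by simp
      qed
    qed
  qed
  have XN: "AE \<omega> in Q. compensated N lam \<omega> t = ereal (counted_minus_cumul (intensity lam) \<omega> t)" if t: "0 \<le> t" for t
    using fin[OF t] AE_space
  proof eventually_elim
    case (elim \<omega>)
    then obtain a where a: "?A \<omega> t = ennreal a" "0 \<le> a" by (cases "?A \<omega> t") auto
    then show ?case unfolding X[OF elim(2) t] counted_minus_cumul_def by simp
  qed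
  have cm[measurable]: "(\<lambda>\<omega>. counted_minus_cumul (intensity lam) \<omega> t) \<in> borel_measurable Q" if "0 \<le> t" for t
    using F_measurable_M[OF counted_minus_cumul_F_measurable[OF k that]] Q(2) by (simp cong: measurable_cong_sets)
  have ic: "integrable Q (\<lambda>\<omega>. counted_minus_cumul (intensity lam) \<omega> t)" if t: "0 \<le> t" for t
  proof (rule integrableI_bounded[OF cm[OF t]])
    have "(\<integral>\<^sup>+\<omega>. ennreal (norm (counted_minus_cumul (intensity lam) \<omega> t)) \<partial>Q) = (\<integral>\<^sup>+\<omega>. e2ennreal \<bar>compensated N lam \<omega> t\<bar> \<partial>Q)"
    proof (rule nn_integral_cong_AE)
      show "AE \<omega> in Q. ennreal (norm (counted_minus_cumul (intensity lam) \<omega> t)) = e2ennreal \<bar>compensated N lam \<omega> t\<bar>"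
        using XN[OF t] by eventually_elim (simp add: e2ennreal_ereal)
    qed
    then show "(\<integral>\<^sup>+\<omega>. ennreal (norm (counted_minus_cumul (intensity lam) \<omega> t)) \<partial>Q) < \<infinity>" using Xint[OF t] by simp
  qed
  have XR: "AE \<omega> in Q. real_of_ereal (compensated N lam \<omega> t) = counted_minus_cumul (intensity lam) \<omega> t" if t: "0 \<le> t" for t
    using XN[OF t] by eventually_elim simp
  show ?thesis unfolding has_intensity_def
  proof (intro conjI allI impI)
    show "prob_space Q" "sets Q = sets M" "intensity lam \<in> borel_measurable pred_sigma" by (fact Q k)+
    show "AE \<omega> in Q. ?A \<omega> u < \<infinity>" "integrable Q (\<lambda>\<omega>. counted_minus_cumul (intensity lam) \<omega> u)" if "0 \<le> u" for u
      using fin ic that by auto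
    fix a b :: real and g :: "'a \<Rightarrow> real" assume ab: "0 \<le> a" "a \<le> b" and g: "g \<in> borel_measurable (F a)" and g1: "\<forall>\<omega>. \<bar>g \<omega>\<bar> \<le> 1"
    have b0: "0 \<le> b" using ab by simp
    interpret finite_measure_subalgebra Q "F a"
      by unfold_locales (rule filt[OF ab(1)])
    have gQ[measurable]: "g \<in> borel_measurable Q" using F_measurable_M[OF g] Q(2) by (simp cong: measurable_cong_sets)
    let ?Y = "\<lambda>\<omega>. real_of_ereal (compensated N lam \<omega> b)"
    have Ym[measurable]: "?Y \<in> borel_measurable Q" using Xm[OF b0] by measurable
    have "integrable Q (\<lambda>\<omega>. g \<omega> * counted_minus_cumul (intensity lam) \<omega> b)"
      by (rule Bochner_Integration.integrable_bound[OF ic[OF b0]])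
        (use cm[OF b0] g1 in \<open>auto simp: abs_mult mult_left_le_one_le\<close>)
    moreover have "integrable Q (\<lambda>\<omega>. g \<omega> * counted_minus_cumul (intensity lam) \<omega> b) \<longleftrightarrow> integrable Q (\<lambda>\<omega>. g \<omega> * ?Y \<omega>)"
      by (rule integrable_cong_AE) (use cm[OF b0] XR[OF b0] in auto)
    ultimately have ig: "integrable Q (\<lambda>\<omega>. g \<omega> * ?Y \<omega>)" by simp
    have "(\<integral>\<omega>. g \<omega> * counted_minus_cumul (intensity lam) \<omega> b \<partial>Q) = (\<integral>\<omega>. g \<omega> * ?Y \<omega> \<partial>Q)"
      by (rule integral_cong_AE) (use cm[OF b0] XR[OF b0] in auto)
    also have "\<dots> = (\<integral>\<omega>. g \<omega> * real_cond_exp Q (F a) ?Y \<omega> \<partial>Q)"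
      by (rule real_cond_exp_intg(2)[OF ig g Ym, symmetric])
    also have "\<dots> = (\<integral>\<omega>. g \<omega> * counted_minus_cumul (intensity lam) \<omega> a \<partial>Q)"
    proof (rule integral_cong_AE)
      have "AE \<omega> in Q. real_cond_exp Q (F a) ?Y \<omega> = real_of_ereal (compensated N lam \<omega> a)"
        using mart ab unfolding martingale_def by blast
      with XR[OF ab(1)] show "AE \<omega> in Q. g \<omega> * real_cond_exp Q (F a) ?Y \<omega> = g \<omega> * counted_minus_cumul (intensity lam) \<omega> a"
        by eventually_elim simp
    qed (use cm[OF ab(1)] in measurable)
    finally show "(\<integral>\<omega>. g \<omega> * counted_minus_cumul (intensity lam) \<omega> b \<partial>Q) = (\<integral>\<omega>. g \<omega> * counted_minus_cumul (intensity lam) \<omega> a \<partial>Q)" .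
  qed
qed

lemma path_measure_Ioc:
  assumes w: "\<omega> \<in> space M" and ab: "0 \<le> a" "a \<le> b"
  shows "emeasure (path_measure N \<omega>) {a<..b} = ennreal (N \<omega> b - N \<omega> a)"
proof -
  let ?F = "\<lambda>u. N \<omega> (max 0 u)"
  have "emeasure (interval_measure ?F) {a<..b} = ennreal (?F b - ?F a)"
  proof (rule emeasure_interval_measure_Ioc[OF ab(2)])
    show "?F x \<le> ?F y" if "x \<le> y" for x y using N_mono[OF w, of "max 0 x" "max 0 y"] that by simp
    show "continuous (at_right x) ?F" for x
    proof -
      have "eventually (\<lambda>u. ?F u = ?F x) (at_right x)"
      proof (cases "0 \<le> x")
        case True
        have "eventually (\<lambda>u. x < u) (at_right x)" by (rule eventually_at_right_less)
        with N_right_eventually_const[OF w True] show ?thesis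
          by eventually_elim (use True in \<open>simp add: max_def\<close>)
      next
        case False
        then show ?thesis unfolding eventually_at_right_field by (intro exI[of _ 0]) auto
      qed
      then show ?thesis unfolding continuous_within by (rule tendsto_eventually)
    qed
  qed
  then show ?thesis using ab by (simp add: path_measure_def)
qed

text \<open>
  The atom is the limit of the masses of short intervals that end at the jump.
\<close>

lemma path_measure_atom:
  assumes w: "\<omega> \<in> space M" and j: "jump_time (Suc j) \<omega> \<le> T"
  shows "emeasure (path_measure N \<omega>) {jump_time (Suc j) \<omega>} = 1"
proof -
  define t where "t = jump_time (Suc j) \<omega>"
  define s where "s = jump_time j \<omega>"
  have s: "0 \<le> s" "s \<le> T" using jump_time_bounds(1) jump_time_mono[of j "Suc j" \<omega>] j by (auto simp: s_def)
  have st: "s < t" unfolding s_def t_def using s by (intro jump_time_strict[OF w]) (simp add: s_def)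
  have tT: "t \<le> T" using j by (simp add: t_def)
  have Nt: "N \<omega> t = real (Suc j)"
    using N_eq_iff[OF w, of t "Suc j"] jump_time_strict[OF w j] s st tT by (simp add: t_def)
  have Nr: "N \<omega> r = real j" if "s \<le> r" "r < t" for r
    using N_eq_iff[OF w, of r j] that s tT by (simp add: t_def s_def)
  have [simp]: "sets (path_measure N \<omega>) = sets borel" by (simp add: path_measure_def)
  define A where "A = (\<lambda>m::nat. {max s (t - 1 / real (Suc m))<..t})"
  have eA: "emeasure (path_measure N \<omega>) (A m) = 1" for m
  proof -
    have "max s (t - 1 / real (Suc m)) < t" using st by simp
    then show ?thesis unfolding A_def using s Nt Nr[of "max s (t - 1 / real (Suc m))"] by (subst path_measure_Ioc[OF w]) auto
  qed
  have "(\<lambda>m. emeasure (path_measure N \<omega>) (A m)) \<longlonglongrightarrow> emeasure (path_measure N \<omega>) (\<Inter>m. A m)"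
  proof (rule Lim_emeasure_decseq)
    show "range A \<subseteq> sets (path_measure N \<omega>)" by (auto simp: A_def)
    show "decseq A"
    proof (rule decseq_SucI)
      fix m
      have "1 / real (Suc (Suc m)) \<le> 1 / real (Suc m)" by (intro divide_left_mono) auto
      then show "A (Suc m) \<subseteq> A m" unfolding A_def by auto
    qed
  qed (simp add: eA)
  moreover have "(\<Inter>m. A m) = {t}"
  proof
    show "(\<Inter>m. A m) \<subseteq> {t}"
    proof
      fix x assume x: "x \<in> (\<Inter>m. A m)"
      have "x = t"
      proof (rule ccontr)
        assume "x \<noteq> t"
        with x have "x < t" by (auto simp: A_def)
        then obtain m where "inverse (real (Suc m)) < t - x" using reals_Archimedean[of "t - x"] by auto
        moreover have "x \<in> A m" using x by blast
        ultimately show False by (auto simp: A_def inverse_eq_divide)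
      qed
      then show "x \<in> {t}" by simp
    qed
    show "{t} \<subseteq> (\<Inter>m. A m)" using st by (auto simp: A_def)
  qed
  ultimately show ?thesis using LIMSEQ_unique[OF tendsto_const[of "1::ennreal"]] by (simp add: eA t_def)
qed

text \<open>
  The atoms at the \<open>n\<close> jump times have total mass \<open>n\<close>, which is the mass of the whole interval.
\<close>

lemma path_integral:
  fixes f :: "real \<Rightarrow> real"
  assumes w: "\<omega> \<in> space M" and v: "0 \<le> v" "v \<le> T" and n: "N \<omega> v = real n"
    and f: "set_borel_measurable borel {0<..v} f"
  shows "(LINT u:{0<..v}|path_measure N \<omega>. f u) = (\<Sum>j\<in>{1..n}. f (jump_time j \<omega>))"
proof -
  let ?\<mu> = "path_measure N \<omega>"
  have sm[simp, measurable_cong]: "sets ?\<mu> = sets borel" by (simp add: path_measure_def)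
  have jv: "jump_time j \<omega> \<le> v" if "j \<in> {1..n}" for j
    using jump_time_le_iff[OF w v, of j] n that by simp
  then have jT: "jump_time j \<omega> \<le> T" if "j \<in> {1..n}" for j
    using v(2) that by fastforce
  have atom: "emeasure ?\<mu> {jump_time j \<omega>} = 1" if "j \<in> {1..n}" for j
    using path_measure_atom[OF w, of "j - 1"] jT[OF that] that by simp
  define S where "S = (\<lambda>j. jump_time j \<omega>) ` {1..n}"
  have inj: "inj_on (\<lambda>j. jump_time j \<omega>) {1..n}"
  proof (rule linorder_inj_onI')
    fix i j assume ij: "i \<in> {1..n}" "j \<in> {1..n}" "i < j"
    have "jump_time i \<omega> < jump_time (Suc i) \<omega>" by (rule jump_time_strict[OF w jT[OF ij(1)]])
    also have "\<dots> \<le> jump_time j \<omega>" using ij by (intro jump_time_mono) simp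
    finally show "jump_time i \<omega> \<noteq> jump_time j \<omega>" by simp
  qed
  have S: "finite S" "S \<subseteq> {0<..v}" unfolding S_def using jv jump_time_pos[OF w] by auto
  have eS: "emeasure ?\<mu> S = ennreal (real n)"
  proof -
    have "emeasure ?\<mu> S = (\<Sum>x\<in>S. emeasure ?\<mu> {x})" using S by (intro emeasure_eq_sum_singleton) auto
    also have "\<dots> = (\<Sum>j\<in>{1..n}. emeasure ?\<mu> {jump_time j \<omega>})"
      unfolding S_def by (rule sum.reindex[OF inj, unfolded o_def])
    also have "\<dots> = (\<Sum>j\<in>{1..n}. 1)" by (rule sum.cong[OF refl atom])
    finally show ?thesis by (simp add: ennreal_of_nat_eq_real_of_nat)
  qed
  have eT: "emeasure ?\<mu> {0<..v} = ennreal (real n)"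
    using path_measure_Ioc[OF w order_refl v(1)] n starts_at_0[OF w] by simp
  have Sb: "S \<in> sets borel" using S(1) by (simp add: borel_closed finite_imp_closed)
  have "emeasure ?\<mu> ({0<..v} - S) = 0"
    using emeasure_Diff[of ?\<mu> S "{0<..v}"] S Sb eS eT by simp
  then have null: "{0<..v} - S \<in> null_sets ?\<mu>" using Sb by (auto simp: null_sets_def)
  have "(LINT u:{0<..v}|?\<mu>. f u) = (\<integral>u. (\<Sum>x\<in>S. indicator {x} u *\<^sub>R f x) \<partial>?\<mu>)"
    unfolding set_lebesgue_integral_def
  proof (rule integral_cong_AE)
    show "(\<lambda>u. indicator {0<..v} u *\<^sub>R f u) \<in> borel_measurable ?\<mu>"
      using f unfolding set_borel_measurable_def by (simp cong: measurable_cong_sets)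
    show "AE u in ?\<mu>. indicator {0<..v} u *\<^sub>R f u = (\<Sum>x\<in>S. indicator {x} u *\<^sub>R f x)"
      using AE_not_in[OF null]
    proof eventually_elim
      case (elim u)
      have "(\<Sum>x\<in>S. indicator {x} u *\<^sub>R f x) = (\<Sum>x\<in>S. if u = x then f u else 0)"
        by (intro sum.cong refl) (auto split: split_indicator)
      also have "\<dots> = (if u \<in> S then f u else 0)" using S(1) by (simp add: sum.delta)
      finally show ?case using elim S(2) by (auto split: split_indicator)
    qed
  qed auto
  also have "\<dots> = (\<Sum>x\<in>S. \<integral>u. indicator {x} u *\<^sub>R f x \<partial>?\<mu>)"
  proof (rule Bochner_Integration.integral_sum)
    fix x assume "x \<in> S"
    then have "emeasure ?\<mu> {x} < \<infinity>" using atom by (auto simp: S_def)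
    then show "integrable ?\<mu> (\<lambda>u. indicator {x} u *\<^sub>R f x)" by simp
  qed
  also have "\<dots> = (\<Sum>x\<in>S. f x)"
  proof (intro sum.cong refl)
    fix x assume "x \<in> S"
    then have e: "emeasure ?\<mu> {x} = 1" using atom by (auto simp: S_def)
    then show "(\<integral>u. indicator {x} u *\<^sub>R f x \<partial>?\<mu>) = f x" by (simp add: measure_def)
  qed
  also have "\<dots> = (\<Sum>j\<in>{1..n}. f (jump_time j \<omega>))" unfolding S_def by (rule sum.reindex[OF inj, unfolded o_def])
  finally show ?thesis .
qed

lemma zeta_eq:
  assumes w: "\<omega> \<in> space M" and pred: "predictable (space M) F lam" and pos: "\<And>t. 0 \<le> t \<Longrightarrow> 0 < lam \<omega> t"
    and v: "0 \<le> v" "v \<le> T" and fin: "cumul (intensity lam) \<omega> v < \<infinity>"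
  shows "zeta N lam 0 v \<omega> = v - enn2real (cumul (intensity lam) \<omega> v)
    + (\<Sum>j\<in>{1..nat \<lfloor>N \<omega> v\<rfloor>}. ln (lam \<omega> (jump_time j \<omega>)))"
proof -
  have lm: "(\<lambda>r. lam \<omega> (max 0 r)) \<in> borel_measurable borel"
    using measurable_compose[OF section_pred_sigma[OF w] predictable_pred_sigma[OF pred]] by simp
  have lc: "indicator {0<..v} r *\<^sub>R f (lam \<omega> r) = indicator {0<..v} r *\<^sub>R f (lam \<omega> (max 0 r))" for f :: "real \<Rightarrow> real" and r
    by (auto split: split_indicator simp: max_def)
  have sm: "set_borel_measurable borel {0<..v} (\<lambda>r. f (lam \<omega> r))" if "f \<in> borel_measurable borel" for f :: "real \<Rightarrow> real"
    unfolding set_borel_measurable_def lc using lm that by measurable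
  have A: "cumul (intensity lam) \<omega> v = (\<integral>\<^sup>+r. ennreal (indicator {0<..v} r *\<^sub>R lam \<omega> r) \<partial>lborel)"
    unfolding cumul_def by (intro nn_integral_cong) (use w in \<open>auto simp: intensity_def split: split_indicator\<close>)
  have nn: "AE r in lborel. 0 \<le> indicator {0<..v} r *\<^sub>R lam \<omega> r"
    using pos by (intro AE_I2) (auto split: split_indicator intro: less_imp_le)
  have m1: "(\<lambda>r. indicator {0<..v} r *\<^sub>R lam \<omega> r) \<in> borel_measurable lborel"
    using sm[of "\<lambda>x. x"] unfolding set_borel_measurable_def by simp
  have il: "set_integrable lborel {0<..v} (\<lambda>r. lam \<omega> r)"
    unfolding set_integrable_def by (rule integrableI_nonneg[OF m1 nn]) (use fin A in simp)
  have vl: "(LINT u:{0<..v}|lborel. lam \<omega> u) = enn2real (cumul (intensity lam) \<omega> v)"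
    unfolding set_lebesgue_integral_def A by (rule integral_eq_nn_integral[OF m1 nn])
  have i1: "set_integrable lborel {0<..v} (\<lambda>r. 1 :: real)"
    unfolding set_integrable_def using v by (auto simp: integrable_real_indicator)
  have "(LINT u:{0<..v}|lborel. 1 - lam \<omega> u) = (LINT u:{0<..v}|lborel. 1) - (LINT u:{0<..v}|lborel. lam \<omega> u)"
    by (rule set_integral_diff(2)[OF i1 il])
  also have "(LINT u:{0<..v}|lborel. 1) = v" using v by (simp add: set_lebesgue_integral_def)
  finally have z1: "(LINT u:{0<..v}|lborel. 1 - lam \<omega> u) = v - enn2real (cumul (intensity lam) \<omega> v)" unfolding vl .
  obtain n where n: "N \<omega> v = real n" by (rule N_nat[OF w v(1)])
  have z2: "(LINT u:{0<..v}|path_measure N \<omega>. ln (lam \<omega> u)) = (\<Sum>j\<in>{1..n}. ln (lam \<omega> (jump_time j \<omega>)))"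
    by (rule path_integral[OF w v n sm]) measurable
  show ?thesis unfolding zeta_def z1 z2 by (simp add: n)
qed

lemma exp_zeta_eq_likelihood:
  assumes w: "\<omega> \<in> space M" and pred: "predictable (space M) F lam" and pos: "\<And>t. 0 \<le> t \<Longrightarrow> 0 < lam \<omega> t"
    and fin: "cumul (intensity lam) \<omega> T < \<infinity>"
  shows "ennreal (exp (zeta N lam 0 T \<omega>)) = likelihood (intensity lam) \<omega>"
proof -
  obtain n where n: "N \<omega> T = real n" by (rule N_nat[OF w T_nonneg])
  have "exp (\<Sum>j\<in>{1..n}. ln (lam \<omega> (jump_time j \<omega>))) = (\<Prod>j\<in>{1..n}. lam \<omega> (jump_time j \<omega>))"
    using pos[OF jump_time_bounds(1)] by (simp add: exp_sum)
  moreover have "zeta N lam 0 T \<omega> = T - enn2real (cumul (intensity lam) \<omega> T)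
    + (\<Sum>j\<in>{1..nat \<lfloor>N \<omega> T\<rfloor>}. ln (lam \<omega> (jump_time j \<omega>)))"
    by (rule zeta_eq[OF w pred _ T_nonneg order_refl fin]) (rule pos)
  ultimately have "ennreal (exp (zeta N lam 0 T \<omega>)) =
    ennreal ((\<Prod>j\<in>{1..n}. lam \<omega> (jump_time j \<omega>)) * exp (T - enn2real (cumul (intensity lam) \<omega> T)))"
    by (simp add: exp_add mult.commute n)
  also have "\<dots> = (\<Prod>j\<in>{1..n}. ennreal (lam \<omega> (jump_time j \<omega>))) * ennreal (exp (T - enn2real (cumul (intensity lam) \<omega> T)))"
    using pos[OF jump_time_bounds(1)] by (simp add: ennreal_mult prod_nonneg less_imp_le prod_ennreal)
  also have "\<dots> = likelihood (intensity lam) \<omega>"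
    using T_nonneg w jump_time_bounds(1) by (simp add: likelihood_def weight_def expo_def n cumul_1 intensity_def max_def)
  finally show ?thesis .
qed

end

section \<open>Densities along a filtration and their limit\<close>

locale density_process = P: prob_space P + Q: prob_space Q
  for P Q :: "'a measure" and G :: "nat \<Rightarrow> 'a measure" and z :: "nat \<Rightarrow> 'a \<Rightarrow> real" +
  assumes sQ: "sets Q = sets P"
    and sub: "subalgebra P (G n)"
    and mono: "m \<le> n \<Longrightarrow> sets (G m) \<subseteq> sets (G n)"
    and z: "z n \<in> borel_measurable (G n)"
    and z0: "0 \<le> z n \<omega>"
    and dens: "A \<in> sets (G n) \<Longrightarrow> emeasure Q A = (\<integral>\<^sup>+\<omega>\<in>A. ennreal (z n \<omega>) \<partial>P)"
begin

lemma G_P: "sets (G n) \<subseteq> sets P" "space (G n) = space P"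
  using sub[of n] by (simp_all add: subalgebra_def)

lemma sigma_P: "sigma_sets (space P) (\<Union>n. sets (G n)) \<subseteq> sets P"
  by (rule sets.sigma_sets_subset) (use G_P in blast)

text \<open>
  The sets that can be approximated for both measures at once form a sigma-algebra.
\<close>

lemma approx_by_filtration:
  assumes E: "E \<in> sigma_sets (space P) (\<Union>n. sets (G n))" and e: "0 < e"
  shows "\<exists>n. \<exists>C\<in>sets (G n). measure P ((E - C) \<union> (C - E)) < e \<and> measure Q ((E - C) \<union> (C - E)) < e"
  using E e
proof (induction arbitrary: e rule: sigma_sets.induct)
  case (Basic a)
  then obtain n where "a \<in> sets (G n)" by auto
  with Basic.prems show ?case by (intro exI[of _ n] bexI[of _ a]) auto
next
  case Empty
  then show ?case by (intro exI[of _ 0] bexI[of _ "{}"]) auto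
next
  case (Compl a)
  then obtain n C where C: "C \<in> sets (G n)" "measure P ((a - C) \<union> (C - a)) < e" "measure Q ((a - C) \<union> (C - a)) < e"
    by blast
  have sp: "space (G n) = space P" using sub[of n] by (simp add: subalgebra_def)
  have "a \<subseteq> space P" using Compl.hyps sub sigma_sets_into_sp[of "\<Union>n. sets (G n)" "space P" a] sets.sets_into_space
    by (fastforce simp: subalgebra_def)
  moreover have "C \<subseteq> space P" using sets.sets_into_space[OF C(1)] sp by simp
  ultimately have eq: "(space P - a - (space P - C)) \<union> (space P - C - (space P - a)) = (a - C) \<union> (C - a)" by blast
  have "space P - C \<in> sets (G n)" using C(1) sp by (metis sets.compl_sets)
  then show ?case using C(2,3) unfolding eq[symmetric] by blast
next
  case (Union a)
  have aP[measurable]: "a i \<in> sets P" for i using Union.hyps sigma_P by blast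
  have aQ[measurable]: "a i \<in> sets Q" for i using aP sQ by simp
  have lim: "\<exists>m. \<forall>k\<ge>m. measure R ((\<Union>i. a i) - (\<Union>i<k. a i)) < e / 2"
    if R: "finite_measure R" "sets R = sets P" for R
  proof -
    interpret R: finite_measure R by fact
    have aR[measurable]: "a i \<in> sets R" for i using aP R by simp
    have "(\<lambda>k. measure R ((\<Union>i. a i) - (\<Union>i<k. a i))) \<longlonglongrightarrow> measure R (\<Inter>k. ((\<Union>i. a i) - (\<Union>i<k. a i)))"
      by (rule R.finite_Lim_measure_decseq) (auto simp: decseq_def intro: less_le_trans)
    moreover have "(\<Inter>k. ((\<Union>i. a i) - (\<Union>i<k. a i))) = {}"
    proof (intro equals0I)
      fix x assume x: "x \<in> (\<Inter>k. ((\<Union>i. a i) - (\<Union>i<k. a i)))"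
      then obtain i where "x \<in> a i" by auto
      moreover have "x \<notin> (\<Union>i<Suc i. a i)" using x by blast
      ultimately show False by auto
    qed
    ultimately have "(\<lambda>k. measure R ((\<Union>i. a i) - (\<Union>i<k. a i))) \<longlonglongrightarrow> 0"
      by (simp only: measure_empty)
    then have "eventually (\<lambda>k. measure R ((\<Union>i. a i) - (\<Union>i<k. a i)) < e / 2) sequentially"
      using Union.prems by (intro order_tendstoD(2)) auto
    then show ?thesis unfolding eventually_sequentially .
  qed
  obtain m1 where m1: "\<And>k. k \<ge> m1 \<Longrightarrow> measure P ((\<Union>i. a i) - (\<Union>i<k. a i)) < e / 2"
    using lim[OF P.finite_measure_axioms refl] by blast
  obtain m2 where m2: "\<And>k. k \<ge> m2 \<Longrightarrow> measure Q ((\<Union>i. a i) - (\<Union>i<k. a i)) < e / 2"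
    using lim[OF Q.finite_measure_axioms sQ] by blast
  define m where "m = max m1 m2"
  \<comment> \<open>half of \<open>e\<close> pays for the tail of the union, the other half for \<open>m\<close> approximations\<close>
  define d where "d = e / (2 * real (Suc m))"
  have d: "0 < d" using Union.prems by (simp add: d_def)
  have "\<forall>i. \<exists>n C. C \<in> sets (G n) \<and> measure P ((a i - C) \<union> (C - a i)) < d \<and> measure Q ((a i - C) \<union> (C - a i)) < d"
    using Union.IH[OF d] by blast
  then obtain n C where C: "\<And>i. C i \<in> sets (G (n i))" "\<And>i. measure P ((a i - C i) \<union> (C i - a i)) < d"
    "\<And>i. measure Q ((a i - C i) \<union> (C i - a i)) < d" by metis
  define K where "K = Max (insert 0 (n ` {..<m}))"
  define D where "D = (\<Union>i<m. C i)"
  have D: "D \<in> sets (G K)"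
    unfolding D_def
  proof (rule sets.finite_UN)
    fix i assume "i \<in> {..<m}"
    then have "n i \<le> K" unfolding K_def by (intro Max_ge) auto
    then show "C i \<in> sets (G K)" using C(1) mono by blast
  qed simp
  have CP[measurable]: "C i \<in> sets P" for i using C(1) G_P by blast
  have bound: "measure R (((\<Union>i. a i) - D) \<union> (D - (\<Union>i. a i))) < e"
    if R: "finite_measure R" "sets R = sets P" and h: "measure R ((\<Union>i. a i) - (\<Union>i<m. a i)) < e / 2"
      "\<And>i. measure R ((a i - C i) \<union> (C i - a i)) < d" for R
  proof -
    interpret R: finite_measure R by fact
    have [measurable]: "a i \<in> sets R" "C i \<in> sets R" for i using aP CP R by simp_all
    let ?U = "\<Union>i<m. ((a i - C i) \<union> (C i - a i))"
    have "measure R (((\<Union>i. a i) - D) \<union> (D - (\<Union>i. a i))) \<le> measure R (((\<Union>i. a i) - (\<Union>i<m. a i)) \<union> ?U)"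
      by (rule R.finite_measure_mono) (auto simp: D_def)
    also have "\<dots> \<le> measure R ((\<Union>i. a i) - (\<Union>i<m. a i)) + measure R ?U"
      by (rule measure_Un_le) auto
    also have "measure R ?U \<le> (\<Sum>i<m. measure R ((a i - C i) \<union> (C i - a i)))"
      by (rule measure_UNION_le) auto
    also have "\<dots> \<le> (\<Sum>i<m. d)" by (intro sum_mono less_imp_le h)
    also have "\<dots> \<le> e / 2" using Union.prems by (simp add: d_def field_simps)
    finally show ?thesis using h(1) by simp
  qed
  show ?case
    using D bound[OF P.finite_measure_axioms refl m1 C(2)] bound[OF Q.finite_measure_axioms sQ m2 C(3)] by (auto simp: m_def)
qed

text \<open>
  Split the event according to the first \<open>n \<ge> s\<close> at which \<open>z n\<close> reaches \<open>d\<close>. That part belongs to the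
  \<open>n\<close>-th sigma-algebra, where \<open>z n\<close> is the density, so its \<open>Q\<close>-measure is at least \<open>d\<close> times its
  \<open>P\<close>-measure.
\<close>

lemma maximal_inequality:
  assumes C: "C \<in> sets (G s)" and d: "0 < d"
  shows "measure P (C \<inter> {\<omega>. \<exists>n\<ge>s. d \<le> z n \<omega>}) \<le> measure Q C / d"
    and "C \<inter> {\<omega>. \<exists>n\<ge>s. d \<le> z n \<omega>} \<in> sets P"
proof -
  define A where "A = (\<lambda>i. C \<inter> {\<omega>\<in>space (G (s + i)). d \<le> z (s + i) \<omega>})"
  define D where "D = disjointed A"
  have AG: "A i \<in> sets (G (s + i))" for i
  proof -
    have "{\<omega>\<in>space (G (s + i)). d \<le> z (s + i) \<omega>} \<in> sets (G (s + i))" using z by measurable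
    moreover have "C \<in> sets (G (s + i))" using C mono[of s "s + i"] by auto
    ultimately show ?thesis unfolding A_def by (rule sets.Int[rotated])
  qed
  have DG: "D i \<in> sets (G (s + i))" for i
  proof -
    have "A j \<in> sets (G (s + i))" if "j < i" for j using AG[of j] mono[of "s + j" "s + i"] that by auto
    then show ?thesis unfolding D_def disjointed_def using AG[of i] by (intro sets.Diff sets.finite_UN) auto
  qed
  have DP: "D i \<in> sets P" "D i \<in> sets Q" for i using DG G_P sQ by blast+
  have U: "C \<inter> {\<omega>. \<exists>n\<ge>s. d \<le> z n \<omega>} = (\<Union>i. D i)"
  proof -
    have "C \<inter> {\<omega>. \<exists>n\<ge>s. d \<le> z n \<omega>} = (\<Union>i. A i)"
    proof
      show "C \<inter> {\<omega>. \<exists>n\<ge>s. d \<le> z n \<omega>} \<subseteq> (\<Union>i. A i)"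
      proof
        fix x assume x: "x \<in> C \<inter> {\<omega>. \<exists>n\<ge>s. d \<le> z n \<omega>}"
        then obtain n where "n \<ge> s" "d \<le> z n x" by auto
        with x show "x \<in> (\<Union>i. A i)" using sets.sets_into_space[OF C] G_P(2)
          by (intro UN_I[of "n - s"]) (auto simp: A_def)
      qed
      show "(\<Union>i. A i) \<subseteq> C \<inter> {\<omega>. \<exists>n\<ge>s. d \<le> z n \<omega>}" by (auto simp: A_def intro: le_add1)
    qed
    then show ?thesis unfolding D_def by (simp add: UN_disjointed_eq)
  qed
  show "C \<inter> {\<omega>. \<exists>n\<ge>s. d \<le> z n \<omega>} \<in> sets P" unfolding U using DP by auto
  have CQ: "C \<in> sets Q" using C G_P sQ by blast
  have "ennreal d * emeasure P (\<Union>i. D i) = ennreal d * (\<Sum>i. emeasure P (D i))"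
    using DP by (subst suminf_emeasure[symmetric]) (auto simp: D_def disjoint_family_disjointed)
  also have "\<dots> = (\<Sum>i. ennreal d * emeasure P (D i))" by simp
  also have "\<dots> \<le> (\<Sum>i. emeasure Q (D i))"
  proof (intro suminf_le)
    fix i
    have "ennreal d * emeasure P (D i) = (\<integral>\<^sup>+\<omega>\<in>D i. ennreal d \<partial>P)"
      using DP by (simp add: nn_integral_cmult_indicator)
    also have "\<dots> \<le> (\<integral>\<^sup>+\<omega>\<in>D i. ennreal (z (s + i) \<omega>) \<partial>P)"
      using disjointed_subset[of A i]
      by (intro nn_integral_mono) (auto split: split_indicator intro!: ennreal_leI simp: D_def A_def)
    also have "\<dots> = emeasure Q (D i)" by (rule dens[OF DG, symmetric])
    finally show "ennreal d * emeasure P (D i) \<le> emeasure Q (D i)" .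
  qed auto
  also have "\<dots> = emeasure Q (\<Union>i. D i)"
    using DP by (intro suminf_emeasure) (auto simp: D_def disjoint_family_disjointed)
  also have "\<dots> \<le> emeasure Q C"
    unfolding U[symmetric] by (intro emeasure_mono CQ) auto
  finally have "ennreal (d * measure P (\<Union>i. D i)) \<le> ennreal (measure Q C)"
    using d by (simp add: P.emeasure_eq_measure Q.emeasure_eq_measure ennreal_mult)
  then have "d * measure P (\<Union>i. D i) \<le> measure Q C" by (simp add: ennreal_le_iff)
  then show "measure P (C \<inter> {\<omega>. \<exists>n\<ge>s. d \<le> z n \<omega>}) \<le> measure Q C / d"
    unfolding U using d by (simp add: field_simps)
qed

text \<open>
  Approximate \<open>E\<close> by some \<open>C\<close> of a finite stage. Then \<open>Q C\<close> is small, and the maximal inequality on \<open>C\<close>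
  shows that the density stays small from that stage on, up to small \<open>P\<close>-measure.
\<close>

lemma density_vanishes_on_null_sets:
  assumes E: "E \<in> sigma_sets (space P) (\<Union>n. sets (G n))" and QE: "emeasure Q E = 0"
  shows "AE \<omega> in P. \<omega> \<in> E \<longrightarrow> (\<lambda>n. z n \<omega>) \<longlonglongrightarrow> 0"
proof -
  have EP[measurable]: "E \<in> sets P" "E \<in> sets Q" using E sQ sigma_P by auto
  have zP[measurable]: "z n \<in> borel_measurable P" for n using z sub by (rule measurable_from_subalg[rotated])
  have small: "AE \<omega> in P. \<omega> \<in> E \<longrightarrow> (\<exists>s. \<forall>n\<ge>s. z n \<omega> < d)" if d: "0 < d" for d
  proof -
    let ?B = "{\<omega>\<in>space P. \<omega> \<in> E \<and> (\<forall>s. \<exists>n\<ge>s. d \<le> z n \<omega>)}"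
    have B[measurable]: "?B \<in> sets P" by measurable
    have "measure P ?B \<le> e * (1 + 1 / d)" if e: "0 < e" for e
    proof -
      obtain s C where C: "C \<in> sets (G s)" "measure P ((E - C) \<union> (C - E)) < e" "measure Q ((E - C) \<union> (C - E)) < e"
        using approx_by_filtration[OF E e] by blast
      have CP[measurable]: "C \<in> sets P" "C \<in> sets Q" using C G_P sQ by blast+
      note mx = maximal_inequality[OF C(1) d]
      have "measure P ?B \<le> measure P (((E - C) \<union> (C - E)) \<union> (C \<inter> {\<omega>. \<exists>n\<ge>s. d \<le> z n \<omega>}))"
        by (rule P.finite_measure_mono) (use mx(2) in auto)
      also have "\<dots> \<le> measure P ((E - C) \<union> (C - E)) + measure P (C \<inter> {\<omega>. \<exists>n\<ge>s. d \<le> z n \<omega>})"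
        by (rule measure_Un_le) (use mx(2) in auto)
      also have "\<dots> \<le> e + measure Q C / d" using C(2) mx(1) by simp
      also have "measure Q C \<le> measure Q (E \<union> ((E - C) \<union> (C - E)))" by (rule Q.finite_measure_mono) auto
      also have "\<dots> \<le> measure Q E + measure Q ((E - C) \<union> (C - E))" by (rule measure_Un_le) auto
      also have "\<dots> \<le> e" using QE C(3) by (simp add: Sigma_Algebra.measure_def)
      finally show ?thesis using d by (simp add: divide_right_mono distrib_left)
    qed
    note b = this
    have "measure P ?B \<le> 0"
    proof (rule field_le_epsilon)
      fix e :: real assume e: "0 < e"
      have "measure P ?B \<le> (e / (1 + 1 / d)) * (1 + 1 / d)"
        using e d by (intro b) (auto intro!: divide_pos_pos add_pos_pos)
      also have "\<dots> = e" using d by (auto simp: add_nonneg_eq_0_iff add_pos_pos less_imp_neq[symmetric])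
      finally show "measure P ?B \<le> 0 + e" by simp
    qed
    then have "emeasure P ?B = 0" by (simp add: P.emeasure_eq_measure measure_le_0_iff)
    then show ?thesis by (intro AE_I[where N = ?B]) (auto simp: not_less)
  qed
  have "AE \<omega> in P. \<forall>j::nat. \<omega> \<in> E \<longrightarrow> (\<exists>s. \<forall>n\<ge>s. z n \<omega> < 1 / real (Suc j))"
    unfolding AE_all_countable by (intro allI small) simp
  then show ?thesis
  proof eventually_elim
    case (elim \<omega>)
    show ?case
    proof
      assume w: "\<omega> \<in> E"
      show "(\<lambda>n. z n \<omega>) \<longlonglongrightarrow> 0"
      proof (rule LIMSEQ_I)
        fix r :: real assume "0 < r"
        then obtain j where j: "inverse (real (Suc j)) < r" using reals_Archimedean by blast
        obtain s where "\<forall>n\<ge>s. z n \<omega> < 1 / real (Suc j)" using elim w by blast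
        then have "\<forall>n\<ge>s. norm (z n \<omega> - 0) < r" using j z0[of _ \<omega>] by (auto simp: inverse_eq_divide intro: less_trans)
        then show "\<exists>no. \<forall>n\<ge>no. norm (z n \<omega> - 0) < r" by blast
      qed
    qed
  qed
qed

lemma density_on_level:
  assumes h: "h \<in> borel_measurable (G n)"
  shows "(\<integral>\<^sup>+\<omega>. h \<omega> \<partial>Q) = (\<integral>\<^sup>+\<omega>. ennreal (z n \<omega>) * h \<omega> \<partial>P)"
proof -
  have spQ: "space Q = space P" using sQ by (rule sets_eq_imp_space_eq)
  have zP[measurable]: "z n \<in> borel_measurable P" using z sub by (rule measurable_from_subalg[rotated])
  have hP: "h \<in> borel_measurable P" using h sub by (rule measurable_from_subalg[rotated])
  have id: "(\<lambda>x. x) \<in> measurable Q (G n)" "(\<lambda>x. x) \<in> measurable (density P (\<lambda>\<omega>. ennreal (z n \<omega>))) (G n)"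
    using G_P[of n] sQ spQ by (auto simp: measurable_def)
  have "distr Q (G n) (\<lambda>x. x) = distr (density P (\<lambda>\<omega>. ennreal (z n \<omega>))) (G n) (\<lambda>x. x)"
  proof (rule measure_eqI)
    fix A assume "A \<in> sets (distr Q (G n) (\<lambda>x. x))"
    then have A: "A \<in> sets (G n)" by simp
    have sp: "A \<inter> space P = A" using sets.sets_into_space[OF A] G_P(2)[of n] by auto
    have AP: "A \<in> sets P" using A G_P(1)[of n] by blast
    show "emeasure (distr Q (G n) (\<lambda>x. x)) A = emeasure (distr (density P (\<lambda>\<omega>. ennreal (z n \<omega>))) (G n) (\<lambda>x. x)) A"
      using A id sp spQ AP dens[OF A] by (simp add: emeasure_distr emeasure_density)
  qed simp
  then have "(\<integral>\<^sup>+\<omega>. h \<omega> \<partial>distr Q (G n) (\<lambda>x. x)) = (\<integral>\<^sup>+\<omega>. h \<omega> \<partial>distr (density P (\<lambda>\<omega>. ennreal (z n \<omega>))) (G n) (\<lambda>x. x))"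
    by simp
  then show ?thesis using h id hP by (simp add: nn_integral_distr nn_integral_density)
qed

text \<open>
  By \<open>density_vanishes_on_null_sets\<close> the densities converge almost surely under \<open>P\<close> too, with limit
  \<open>L\<close>. After a cutoff, the density identity on a fixed stage passes to the limit under both
  measures; removing the cutoff uses that the limit is finite almost surely under \<open>Q\<close>. An
  intersection-stable generator then yields the whole limit sigma-algebra.
\<close>

theorem limit_density:
  assumes E: "E \<in> sigma_sets (space P) (\<Union>n. sets (G n))" and QE: "emeasure Q E = 0"
    and conv: "\<And>\<omega>. \<omega> \<in> space P - E \<Longrightarrow> \<exists>l. (\<lambda>n. z n \<omega>) \<longlonglongrightarrow> l \<and> L \<omega> = ennreal l"
    and bad: "AE \<omega> in P. \<omega> \<in> E \<longrightarrow> L \<omega> \<le> liminf (\<lambda>n. ennreal (z n \<omega>))"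
    and A: "A \<in> sigma_sets (space P) (\<Union>n. sets (G n))"
  shows "emeasure Q A = (\<integral>\<^sup>+\<omega>\<in>A. L \<omega> \<partial>P)"
proof -
  let ?cQ = "\<lambda>c h \<omega>. ennreal (cutoff c (h \<omega>))"
  let ?cP = "\<lambda>c h \<omega>. ennreal (cutoff c (h \<omega>) * h \<omega>)"
  have spQ: "space Q = space P" using sQ by (rule sets_eq_imp_space_eq)
  have EP: "E \<in> sets P" "E \<in> sets Q" using E sQ sigma_P by auto
  have zP[measurable]: "z n \<in> borel_measurable P" for n using z sub by (rule measurable_from_subalg[rotated])
  have zQ[measurable]: "z n \<in> borel_measurable Q" for n using zP[of n] sQ by (simp cong: measurable_cong_sets)
  define l where "l = (\<lambda>\<omega>. lim (\<lambda>n. z n \<omega>))"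
  have [measurable]: "l \<in> borel_measurable P" "l \<in> borel_measurable Q" unfolding l_def by measurable
  have limP: "AE \<omega> in P. (\<lambda>n. z n \<omega>) \<longlonglongrightarrow> l \<omega> \<and> L \<omega> = ennreal (l \<omega>)"
    using density_vanishes_on_null_sets[OF E QE] bad AE_space
  proof eventually_elim
    case (elim \<omega>)
    show ?case
    proof (cases "\<omega> \<in> E")
      case True
      with elim have c: "(\<lambda>n. z n \<omega>) \<longlonglongrightarrow> 0" by simp
      then have l: "l \<omega> = 0" unfolding l_def by (rule limI)
      from c have "(\<lambda>n. ennreal (z n \<omega>)) \<longlonglongrightarrow> ennreal 0" by (rule tendsto_ennrealI)
      then have "liminf (\<lambda>n. ennreal (z n \<omega>)) = 0" by (simp add: lim_imp_Liminf)
      with elim True c l show ?thesis by simp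
    next
      case False
      with elim conv obtain a where a: "(\<lambda>n. z n \<omega>) \<longlonglongrightarrow> a" "L \<omega> = ennreal a" by blast
      then have "l \<omega> = a" unfolding l_def by (intro limI)
      with a show ?thesis by simp
    qed
  qed
  have limQ: "AE \<omega> in Q. (\<lambda>n. z n \<omega>) \<longlonglongrightarrow> l \<omega>"
  proof -
    have "E \<in> null_sets Q" using EP QE by auto
    from AE_not_in[OF this] AE_space show ?thesis
    proof eventually_elim
      case (elim \<omega>)
      with conv spQ obtain a where a: "(\<lambda>n. z n \<omega>) \<longlonglongrightarrow> a" by blast
      then have "l \<omega> = a" unfolding l_def by (rule limI)
      with a show ?case by simp
    qed
  qed
  have ccont: "isCont (cutoff c) x" for c x using cutoff_cont[of c] by (simp add: continuous_on_eq_continuous_at)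
  have on_level: "emeasure Q B = (\<integral>\<^sup>+\<omega>\<in>B. ennreal (l \<omega>) \<partial>P)" if B: "B \<in> sets (G s)" for B s
  proof -
    have BP[measurable]: "B \<in> sets P" "B \<in> sets Q" using B G_P sQ by blast+
    have cut: "(\<integral>\<^sup>+\<omega>. ?cQ c l \<omega> * indicator B \<omega> \<partial>Q) =
      (\<integral>\<^sup>+\<omega>. ?cP c l \<omega> * indicator B \<omega> \<partial>P)" for c
    proof -
      have eq: "(\<integral>\<^sup>+\<omega>. ?cQ c (z n) \<omega> * indicator B \<omega> \<partial>Q) =
        (\<integral>\<^sup>+\<omega>. ?cP c (z n) \<omega> * indicator B \<omega> \<partial>P)" if n: "s \<le> n" for n
      proof -
        have "B \<in> sets (G n)" using B mono[OF n] by blast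
        then have "(\<lambda>\<omega>. ?cQ c (z n) \<omega> * indicator B \<omega>) \<in> borel_measurable (G n)"
          using z[of n] by measurable
        from density_on_level[OF this] show ?thesis
          using cutoff_bounds z0 by (simp add: ennreal_mult mult_ac)
      qed
      have 1: "(\<lambda>n. \<integral>\<^sup>+\<omega>. ?cQ c (z n) \<omega> * indicator B \<omega> \<partial>Q) \<longlonglongrightarrow> (\<integral>\<^sup>+\<omega>. ?cQ c l \<omega> * indicator B \<omega> \<partial>Q)"
      proof (rule nn_integral_dominated_convergence[where w = "\<lambda>_. 1"])
        show "AE \<omega> in Q. ?cQ c (z n) \<omega> * indicator B \<omega> \<le> 1" for n
          using cutoff_bounds by (intro AE_I2) (auto split: split_indicator simp: ennreal_le_1)
        show "AE \<omega> in Q. (\<lambda>n. ?cQ c (z n) \<omega> * indicator B \<omega>) \<longlonglongrightarrow> ?cQ c l \<omega> * indicator B \<omega>"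
          using limQ
        proof eventually_elim
          case (elim \<omega>)
          have "(\<lambda>n. ?cQ c (z n) \<omega>) \<longlonglongrightarrow> ?cQ c l \<omega>"
            by (intro tendsto_ennrealI isCont_tendsto_compose[OF ccont] elim)
          then show ?case by (auto split: split_indicator)
        qed
      qed (auto simp: Q.emeasure_space_1)
      have 2: "(\<lambda>n. \<integral>\<^sup>+\<omega>. ?cP c (z n) \<omega> * indicator B \<omega> \<partial>P) \<longlonglongrightarrow> (\<integral>\<^sup>+\<omega>. ?cP c l \<omega> * indicator B \<omega> \<partial>P)"
      proof (rule nn_integral_dominated_convergence[where w = "\<lambda>_. ennreal (real c + 1)"])
        show "AE \<omega> in P. ?cP c (z n) \<omega> * indicator B \<omega> \<le> ennreal (real c + 1)" for n
          using ennreal_leI[OF order_trans[OF abs_ge_self cutoff_mult]]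
          by (intro AE_I2) (auto split: split_indicator simp del: ennreal_plus)
        show "(\<integral>\<^sup>+\<omega>. ennreal (real c + 1) \<partial>P) < \<infinity>" by (simp add: P.emeasure_space_1)
        show "AE \<omega> in P. (\<lambda>n. ?cP c (z n) \<omega> * indicator B \<omega>) \<longlonglongrightarrow> ?cP c l \<omega> * indicator B \<omega>"
          using limP
        proof eventually_elim
          case (elim \<omega>)
          have "(\<lambda>n. ?cP c (z n) \<omega>) \<longlonglongrightarrow> ?cP c l \<omega>"
            using elim by (intro tendsto_ennrealI tendsto_mult isCont_tendsto_compose[OF ccont]) auto
          then show ?case by (auto split: split_indicator)
        qed
      qed auto
      have "eventually (\<lambda>n. (\<integral>\<^sup>+\<omega>. ?cQ c (z n) \<omega> * indicator B \<omega> \<partial>Q) =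
        (\<integral>\<^sup>+\<omega>. ?cP c (z n) \<omega> * indicator B \<omega> \<partial>P)) sequentially"
        using eq unfolding eventually_sequentially by blast
      from Lim_transform_eventually[OF 1 this] 2 show ?thesis by (rule LIMSEQ_unique)
    qed
    have l0: "AE \<omega> in P. 0 \<le> l \<omega>"
      using limP by eventually_elim (auto intro: LIMSEQ_le_const z0)
    have 3: "(\<lambda>c. \<integral>\<^sup>+\<omega>. ?cQ c l \<omega> * indicator B \<omega> \<partial>Q) \<longlonglongrightarrow> (\<integral>\<^sup>+\<omega>. indicator B \<omega> \<partial>Q)"
    proof (rule nn_integral_LIMSEQ)
      show "incseq (\<lambda>c \<omega>. ?cQ c l \<omega> * indicator B \<omega>)"
        using cutoff_incseq by (auto simp: incseq_def le_fun_def intro!: mult_right_mono ennreal_leI)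
      show "(\<lambda>c. ?cQ c l \<omega> * indicator B \<omega>) \<longlonglongrightarrow> indicator B \<omega>" for \<omega>
        using tendsto_ennrealI[OF cutoff_lim[of "l \<omega>"]] by (auto split: split_indicator)
    qed measurable
    have 4: "(\<lambda>c. \<integral>\<^sup>+\<omega>. ?cP c l \<omega> * indicator B \<omega> \<partial>P) \<longlonglongrightarrow> (\<integral>\<^sup>+\<omega>\<in>B. ennreal (l \<omega>) \<partial>P)"
    proof -
      have "(\<integral>\<^sup>+\<omega>. ?cP c l \<omega> * indicator B \<omega> \<partial>P) = (\<integral>\<^sup>+\<omega>. ?cQ c l \<omega> * ennreal (l \<omega>) * indicator B \<omega> \<partial>P)" for c
        by (rule nn_integral_cong_AE) (use l0 in \<open>eventually_elim, simp add: ennreal_mult cutoff_bounds\<close>)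
      moreover have "(\<lambda>c. \<integral>\<^sup>+\<omega>. ?cQ c l \<omega> * ennreal (l \<omega>) * indicator B \<omega> \<partial>P) \<longlonglongrightarrow> (\<integral>\<^sup>+\<omega>\<in>B. ennreal (l \<omega>) \<partial>P)"
      proof (rule nn_integral_LIMSEQ)
        show "incseq (\<lambda>c \<omega>. ?cQ c l \<omega> * ennreal (l \<omega>) * indicator B \<omega>)"
          using cutoff_incseq by (auto simp: incseq_def le_fun_def intro!: mult_right_mono ennreal_leI)
        fix \<omega>
        have "(\<lambda>c. ?cQ c l \<omega>) \<longlonglongrightarrow> 1"
          using tendsto_ennrealI[OF cutoff_lim[of "l \<omega>"]] by simp
        then have "(\<lambda>c. ?cQ c l \<omega> * ennreal (l \<omega>)) \<longlonglongrightarrow> 1 * ennreal (l \<omega>)"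
          by (intro tendsto_mult_ennreal tendsto_const) auto
        then show "(\<lambda>c. ?cQ c l \<omega> * ennreal (l \<omega>) * indicator B \<omega>) \<longlonglongrightarrow> ennreal (l \<omega>) * indicator B \<omega>"
          by (auto split: split_indicator)
      qed measurable
      ultimately show ?thesis by simp
    qed
    show ?thesis using LIMSEQ_unique[OF 3 4[folded cut]] by simp
  qed
  let ?S = "sigma (space P) (\<Union>n. sets (G n))"
  have Gsub: "(\<Union>n. sets (G n)) \<subseteq> Pow (space P)" using G_P sets.sets_into_space by fastforce
  have setsS: "sets ?S = sigma_sets (space P) (\<Union>n. sets (G n))" by (rule sets_measure_of[OF Gsub])
  have spS: "space ?S = space P" by (rule space_measure_of[OF Gsub])
  define mQ where "mQ = distr Q ?S (\<lambda>x. x)"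
  define mP where "mP = distr (density P (\<lambda>\<omega>. ennreal (l \<omega>))) ?S (\<lambda>x. x)"
  have id: "(\<lambda>x. x) \<in> measurable Q ?S" "(\<lambda>x. x) \<in> measurable (density P (\<lambda>\<omega>. ennreal (l \<omega>))) ?S"
    using sigma_P sQ spQ unfolding measurable_def setsS spS by auto
  have eQ: "emeasure mQ B = emeasure Q B" and eP: "emeasure mP B = (\<integral>\<^sup>+\<omega>\<in>B. ennreal (l \<omega>) \<partial>P)"
    if B: "B \<in> sigma_sets (space P) (\<Union>n. sets (G n))" for B
  proof -
    have BP: "B \<in> sets P" using B sigma_P by blast
    have sp: "B \<inter> space P = B" using sets.sets_into_space[OF BP] by auto
    have BS: "B \<in> sets ?S" using B setsS by blast
    show "emeasure mQ B = emeasure Q B" unfolding mQ_def using id BS sp spQ by (simp add: emeasure_distr)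
    show "emeasure mP B = (\<integral>\<^sup>+\<omega>\<in>B. ennreal (l \<omega>) \<partial>P)"
      unfolding mP_def using id BS sp BP by (simp add: emeasure_distr emeasure_density)
  qed
  have "mQ = mP"
  proof (rule measure_eqI_generator_eq)
    show "Int_stable (\<Union>n. sets (G n))"
    proof (rule Int_stableI)
      fix X Y assume "X \<in> (\<Union>n. sets (G n))" "Y \<in> (\<Union>n. sets (G n))"
      then obtain m n where "X \<in> sets (G m)" "Y \<in> sets (G n)" by auto
      then have "X \<in> sets (G (max m n))" "Y \<in> sets (G (max m n))"
        using mono[of m "max m n"] mono[of n "max m n"] by auto
      then show "X \<inter> Y \<in> (\<Union>n. sets (G n))" by blast
    qed
    show "(\<Union>n. sets (G n)) \<subseteq> Pow (space P)" by (rule Gsub)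
    show "sets mQ = sigma_sets (space P) (\<Union>n. sets (G n))" "sets mP = sigma_sets (space P) (\<Union>n. sets (G n))"
      unfolding mQ_def mP_def sets_distr by (rule setsS)+
    show "range (\<lambda>_::nat. space P) \<subseteq> (\<Union>n. sets (G n))"
      using sets.top[of "G 0"] G_P(2)[of 0] by auto
    have sp: "space P \<in> sigma_sets (space P) (\<Union>n. sets (G n))" by (rule sigma_sets_top)
    show "emeasure mQ (space P) \<noteq> \<infinity>" unfolding eQ[OF sp] by simp
    fix X assume "X \<in> (\<Union>n. sets (G n))"
    then obtain n where X: "X \<in> sets (G n)" by auto
    then have "X \<in> sigma_sets (space P) (\<Union>n. sets (G n))" by (intro sigma_sets.Basic) auto
    then show "emeasure mQ X = emeasure mP X" using on_level[OF X] eQ eP by simp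
  qed auto
  then have "emeasure Q A = (\<integral>\<^sup>+\<omega>\<in>A. ennreal (l \<omega>) \<partial>P)" using eQ[OF A] eP[OF A] by simp
  also have "\<dots> = (\<integral>\<^sup>+\<omega>\<in>A. L \<omega> \<partial>P)"
    by (rule nn_integral_cong_AE) (use limP in \<open>eventually_elim, simp\<close>)
  finally show ?thesis .
qed

end

section \<open>The density of the second measure\<close>

lemma Liminf_at_top_le_liminf:
  fixes f :: "real \<Rightarrow> ennreal"
  shows "Liminf at_top f \<le> liminf (\<lambda>n. f (real n))"
  unfolding le_Liminf_iff
proof (intro allI impI)
  fix y assume "y < Liminf at_top f"
  then have "eventually (\<lambda>t. y < f t) at_top" using le_Liminf_iff[of "Liminf at_top f" at_top f] by simp
  then show "eventually (\<lambda>n. y < f (real n)) sequentially"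
    using filterlim_real_sequentially unfolding filterlim_iff by blast
qed

context counting_process
begin

lemma likelihood_finite: "(\<And>x. \<kappa> x < \<infinity>) \<Longrightarrow> likelihood \<kappa> \<omega> < \<infinity>"
  unfolding likelihood_def expo_def using weight_finite[of \<kappa>] by (simp add: ennreal_mult_less_top)

lemma zeta_right_continuous:
  assumes w: "\<omega> \<in> space M" and pred: "predictable (space M) F lam" and pos: "\<And>t. 0 \<le> t \<Longrightarrow> 0 < lam \<omega> t"
    and t: "0 \<le> t" "t < T" and fin: "cumul (intensity lam) \<omega> T < \<infinity>"
  shows "((\<lambda>v. zeta N lam 0 v \<omega>) \<longlongrightarrow> zeta N lam 0 t \<omega>) (at_right t)"
proof -
  let ?J = "\<lambda>v. \<Sum>j\<in>{1..nat \<lfloor>N \<omega> v\<rfloor>}. ln (lam \<omega> (jump_time j \<omega>))"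
  have eq: "zeta N lam 0 v \<omega> = v - enn2real (cumul (intensity lam) \<omega> v) + ?J v" if v: "0 \<le> v" "v \<le> T" for v
    by (rule zeta_eq[OF w pred _ v]) (use pos order.strict_trans1[OF cumul_mono[OF v(2)] fin] in auto)
  have A: "((\<lambda>v. cumul (intensity lam) \<omega> v) \<longlongrightarrow> cumul (intensity lam) \<omega> t) (at_right t)"
    by (rule tendsto_at_right_sequentially[OF t(2)])
      (rule cumul_tendsto[OF w intensity_pred_sigma[OF pred] fin], auto intro: less_imp_le)
  have "cumul (intensity lam) \<omega> t < \<infinity>" by (rule order.strict_trans1[OF cumul_mono fin]) (use t in simp)
  then have fin_t: "ennreal (enn2real (cumul (intensity lam) \<omega> t)) = cumul (intensity lam) \<omega> t" by simp
  have "((\<lambda>v. enn2real (cumul (intensity lam) \<omega> v)) \<longlongrightarrow> enn2real (cumul (intensity lam) \<omega> t)) (at_right t)"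
    by (rule tendsto_enn2real) (simp_all only: fin_t A enn2real_nonneg)
  then have lim: "((\<lambda>v. v - enn2real (cumul (intensity lam) \<omega> v) + ?J t) \<longlongrightarrow> zeta N lam 0 t \<omega>) (at_right t)"
    unfolding eq[OF t(1) less_imp_le[OF t(2)]] by (intro tendsto_add tendsto_diff tendsto_const tendsto_ident_at)
  have "eventually (\<lambda>v. v < T) (at_right t)"
    unfolding eventually_at_right_field using t by (intro exI[of _ T]) auto
  moreover have "eventually (\<lambda>v. t < v) (at_right t)" by (rule eventually_at_right_less)
  ultimately have "eventually (\<lambda>v. v - enn2real (cumul (intensity lam) \<omega> v) + ?J t = zeta N lam 0 v \<omega>) (at_right t)"
    using N_right_eventually_const[OF w t(1)]
    by eventually_elim (use eq t in simp)
  with lim show ?thesis by (rule Lim_transform_eventually)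
qed

end

text \<open>
  The Cauchy condition on rational times is a countable one, hence measurable when \<open>f\<close> is a path.
\<close>

lemma rational_cauchy_imp_convergent:
  fixes f :: "real \<Rightarrow> real"
  assumes rc: "\<And>t. 0 \<le> t \<Longrightarrow> (f \<longlongrightarrow> f t) (at_right t)"
    and cauchy: "\<And>e. 0 < e \<Longrightarrow> \<exists>m::nat. \<forall>p q::rat. real m \<le> of_rat p \<longrightarrow> real m \<le> of_rat q \<longrightarrow> \<bar>f (of_rat p) - f (of_rat q)\<bar> < e"
  shows "\<exists>l. (f \<longlongrightarrow> l) at_top"
proof -
  have approx: "\<exists>p::rat. t < of_rat p \<and> \<bar>f (of_rat p) - f t\<bar> < e" if t: "0 \<le> t" and e: "0 < e" for t e
  proof -
    have "eventually (\<lambda>u. dist (f u) (f t) < e) (at_right t)" using rc[OF t] e by (rule tendstoD)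
    then obtain b where b: "t < b" "\<And>y. t < y \<Longrightarrow> y < b \<Longrightarrow> dist (f y) (f t) < e"
      unfolding eventually_at_right_field by auto
    obtain p :: rat where "t < of_rat p" "of_rat p < b" using of_rat_dense[OF b(1)] by blast
    then show ?thesis using b(2) by (auto simp: dist_real_def)
  qed
  have real_cauchy: "\<exists>m::nat. \<forall>s t. real m \<le> s \<longrightarrow> real m \<le> t \<longrightarrow> \<bar>f s - f t\<bar> < e" if e: "0 < e" for e
  proof -
    have e3: "0 < e / 3" using e by simp
    obtain m :: nat where m: "\<And>p q::rat. real m \<le> of_rat p \<Longrightarrow> real m \<le> of_rat q \<Longrightarrow> \<bar>f (of_rat p) - f (of_rat q)\<bar> < e / 3"
      using cauchy[OF e3] by blast
    have "\<bar>f s - f t\<bar> < e" if st: "real m \<le> s" "real m \<le> t" for s t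
    proof -
      have s0: "0 \<le> s" "0 \<le> t" using st by (auto intro: order_trans[OF of_nat_0_le_iff])
      obtain p :: rat where p: "s < of_rat p" "\<bar>f (of_rat p) - f s\<bar> < e / 3" using approx[OF s0(1) e3] by blast
      obtain q :: rat where q: "t < of_rat q" "\<bar>f (of_rat q) - f t\<bar> < e / 3" using approx[OF s0(2) e3] by blast
      have "\<bar>f (of_rat p) - f (of_rat q)\<bar> < e / 3" using p q st by (intro m) auto
      then show ?thesis using p q by linarith
    qed
    then show ?thesis by blast
  qed
  have "Cauchy (\<lambda>n. f (real n))"
  proof (rule CauchyI)
    fix e :: real assume "0 < e"
    then obtain m :: nat where m: "\<And>s t. real m \<le> s \<Longrightarrow> real m \<le> t \<Longrightarrow> \<bar>f s - f t\<bar> < e" using real_cauchy by blast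
    then show "\<exists>M. \<forall>i\<ge>M. \<forall>n\<ge>M. norm (f (real i) - f (real n)) < e" by (intro exI[of _ m]) auto
  qed
  then obtain l where l: "(\<lambda>n. f (real n)) \<longlonglongrightarrow> l" using Cauchy_convergent_iff convergent_def by blast
  have "(f \<longlongrightarrow> l) at_top"
  proof (rule tendstoI)
    fix e :: real assume e: "0 < e"
    then obtain m :: nat where m: "\<And>s t. real m \<le> s \<Longrightarrow> real m \<le> t \<Longrightarrow> \<bar>f s - f t\<bar> < e / 2"
      using real_cauchy[of "e / 2"] by auto
    have "\<bar>f t - l\<bar> \<le> e / 2" if t: "real m \<le> t" for t
    proof (rule LIMSEQ_le_const2)
      show "(\<lambda>n. \<bar>f t - f (real n)\<bar>) \<longlonglongrightarrow> \<bar>f t - l\<bar>" by (intro tendsto_intros l)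
      show "\<exists>K. \<forall>n\<ge>K. \<bar>f t - f (real n)\<bar> \<le> e / 2" using m[OF t] by (intro exI[of _ m]) (auto intro: less_imp_le)
    qed
    then have "dist (f t) l < e" if "real m \<le> t" for t using that e by (force simp: dist_real_def)
    then show "eventually (\<lambda>t. dist (f t) l < e) at_top" unfolding eventually_at_top_linorder by blast
  qed
  then show ?thesis by blast
qed

theorem theorem2:
  fixes P Q :: "'a measure"
    and N lam :: "'a \<Rightarrow> real \<Rightarrow> real"
  defines "FN \<equiv> natural_filtration (space P) N"
  assumes "poisson_process P FN N 1"
    and "predictable (space P) FN lam"
    and "admissible_intensity P FN N lam"
    and "prob_space Q" and "space Q = space P" and "sets Q = sets P"
    and "martingale Q FN (compensated N lam)"
  shows "(\<forall>t\<ge>0. has_density_on Q P (\<lambda>\<omega>. ennreal (exp (zeta N lam 0 t \<omega>))) (FN t)) \<and>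
         (zeta_infinity_exists Q N lam \<longrightarrow>
            has_density_on Q P (exp_zeta_infinity N lam) (filtration_limit (space P) FN))"
proof -
  note pois = assms(2)[unfolded FN_def] and pred = assms(3)[unfolded FN_def]
    and mart = assms(8)[unfolded FN_def]
  interpret P: prob_space P using pois unfolding poisson_process_def by blast
  interpret Q: prob_space Q by fact
  \<comment> \<open>Notions that do not involve the horizon, such as intensities, are taken from the instance with
    horizon \<open>0\<close>; they are shared by all horizons.\<close>
  interpret C: counting_process P N 0 using pois by (rule poisson_counting) simp
  have CT: "counting_process P N t" if "0 \<le> t" for t using pois that by (rule poisson_counting)
  define \<kappa> where "\<kappa> = C.intensity lam"
  have pos: "0 < lam \<omega> t" if "\<omega> \<in> space P" "0 \<le> t" for \<omega> t
    using assms(4) that unfolding admissible_intensity_def by blast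
  have kpos: "0 < \<kappa> x" for x unfolding \<kappa>_def C.intensity_def using pos[of "fst x"] by simp
  have kfin: "\<kappa> x < \<infinity>" for x unfolding \<kappa>_def C.intensity_def by simp
  have kPA: "\<kappa> \<in> borel_measurable C.pred_sigma" unfolding \<kappa>_def by (rule C.intensity_pred_sigma[OF pred])
  have iP: "C.has_intensity P (\<lambda>_. 1)" using poisson_has_intensity[OF pois] .
  have iQ: "C.has_intensity Q \<kappa>" unfolding \<kappa>_def
    by (rule C.martingale_has_intensity[OF assms(5,7) pred mart])
  have finP: "AE \<omega> in P. C.cumul \<kappa> \<omega> t < \<infinity>" if t: "0 \<le> t" for t
  proof -
    have "AE \<omega> in P. cumulative_intensity lam \<omega> t < \<infinity>"
      using assms(4) t unfolding admissible_intensity_def by blast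
    then show ?thesis using AE_space
      by eventually_elim (use C.cumul_intensity[OF _ t] in \<open>simp add: \<kappa>_def\<close>)
  qed
  have finQ: "AE \<omega> in Q. C.cumul \<kappa> \<omega> t < \<infinity>" if "0 \<le> t" for t
    by (rule C.has_intensityD(5)[OF iQ that])
  define lik where "lik = (\<lambda>t. counting_process.likelihood N t \<kappa>)"
  have lik_dens: "emeasure Q B = (\<integral>\<^sup>+\<omega>\<in>B. lik t \<omega> \<partial>P)" if t: "0 \<le> t" and B: "B \<in> sets (FN t)" for t B
    unfolding lik_def
    by (rule counting_process.likelihood_is_density[OF CT[OF t] iQ iP kpos kfin finP[OF t] B[unfolded FN_def]])
  have lik_zeta: "ennreal (exp (zeta N lam 0 t \<omega>)) = lik t \<omega>"
    if t: "0 \<le> t" and w: "\<omega> \<in> space P" and f: "C.cumul \<kappa> \<omega> t < \<infinity>" for t \<omega>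
    unfolding lik_def \<kappa>_def
    by (rule counting_process.exp_zeta_eq_likelihood[OF CT[OF t] w pred pos[OF w] f[unfolded \<kappa>_def]])
  have lik_fin: "lik t \<omega> < \<infinity>" if t: "0 \<le> t" for t \<omega>
    unfolding lik_def by (rule counting_process.likelihood_finite[OF CT[OF t] kfin])
  have lik_meas: "lik t \<in> borel_measurable (FN t)" if t: "0 \<le> t" for t
    unfolding lik_def FN_def by (rule counting_process.likelihood_F_measurable[OF CT[OF t] kPA])
  have FN_sub: "sets (FN s) \<subseteq> sets (FN t)" if "s \<le> t" for s t
    unfolding FN_def by (rule C.F_mono[OF that])
  have FN_P: "sets (FN t) \<subseteq> sets P" "space (FN t) = space P" for t
    unfolding FN_def by (rule C.F_sub_M, rule C.space_F)

  have finite_horizon: "has_density_on Q P (\<lambda>\<omega>. ennreal (exp (zeta N lam 0 t \<omega>))) (FN t)" if t: "0 \<le> t" for t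
    unfolding has_density_on_def
  proof
    fix A assume A: "A \<in> sets (FN t)"
    have "emeasure Q A = (\<integral>\<^sup>+\<omega>\<in>A. lik t \<omega> \<partial>P)" by (rule lik_dens[OF t A])
    also have "\<dots> = (\<integral>\<^sup>+\<omega>\<in>A. ennreal (exp (zeta N lam 0 t \<omega>)) \<partial>P)"
    proof (rule nn_integral_cong_AE)
      show "AE \<omega> in P. lik t \<omega> * indicator A \<omega> = ennreal (exp (zeta N lam 0 t \<omega>)) * indicator A \<omega>"
        using finP[OF t] AE_space by eventually_elim (simp add: lik_zeta[OF t])
    qed
    finally show "emeasure Q A = (\<integral>\<^sup>+\<omega>\<in>A. ennreal (exp (zeta N lam 0 t \<omega>)) \<partial>P)" .
  qed

  have infinite_horizon: "has_density_on Q P (exp_zeta_infinity N lam) (filtration_limit (space P) FN)"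
    if ex: "zeta_infinity_exists Q N lam"
  proof -
    define G where "G = (\<lambda>n::nat. FN (real n))"
    define z where "z = (\<lambda>n \<omega>. enn2real (lik (real n) \<omega>))"
    interpret D: density_process P Q G z
    proof
      show "sets Q = sets P" by fact
      show "subalgebra P (G n)" for n unfolding G_def subalgebra_def using FN_P by simp
      show "sets (G m) \<subseteq> sets (G n)" if "m \<le> n" for m n unfolding G_def using that by (intro FN_sub) simp
      show "z n \<in> borel_measurable (G n)" for n
        unfolding z_def G_def using lik_meas[of "real n"] by measurable
      show "0 \<le> z n \<omega>" for n \<omega> unfolding z_def by simp
      show "emeasure Q A = (\<integral>\<^sup>+\<omega>\<in>A. ennreal (z n \<omega>) \<partial>P)" if "A \<in> sets (G n)" for A n
        using lik_dens[of "real n" A] that lik_fin[of "real n"] by (simp add: G_def z_def less_top)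
    qed
    let ?U = "\<Union>n. sets (G n)"
    define S where "S = sigma (space P) ?U"
    have US: "?U \<subseteq> Pow (space P)" using FN_P sets.sets_into_space unfolding G_def by fastforce
    have setsS: "sets S = sigma_sets (space P) ?U" unfolding S_def by (rule sets_measure_of[OF US])
    have spS: "space S = space P" unfolding S_def by (rule space_measure_of[OF US])
    have toS: "f \<in> borel_measurable S" if f: "f \<in> borel_measurable (FN t)" for f :: "'a \<Rightarrow> 'c::topological_space" and t
    proof -
      obtain n :: nat where "t \<le> real n" using real_arch_simple by blast
      then have "sets (FN t) \<subseteq> sets S" unfolding setsS using FN_sub[of t "real n"]
        by (auto simp: G_def intro!: sigma_sets.Basic)
      then show ?thesis using f FN_P(2)[of t] spS by (auto simp: measurable_def)
    qed
    define ell where "ell = (\<lambda>r \<omega>. ln (enn2real (lik (max 0 r) \<omega>)))"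
    have ell_meas[measurable]: "ell r \<in> borel_measurable S" for r
      unfolding ell_def by (rule toS[of _ "max 0 r"]) (use lik_meas[of "max 0 r"] in measurable)
    have cum_meas[measurable]: "(\<lambda>\<omega>. C.cumul \<kappa> \<omega> (real n)) \<in> borel_measurable S" for n :: nat
      by (rule toS[of _ "real n"]) (unfold FN_def, rule C.cumul_F_measurable[OF kPA], simp)
    \<comment> \<open>Convergence of \<open>\<zeta>\<close>, phrased through countably many random variables.\<close>
    define good where "good = {\<omega>\<in>space S. (\<forall>n::nat. C.cumul \<kappa> \<omega> (real n) < \<infinity>) \<and>
       (\<forall>j::nat. \<exists>m::nat. \<forall>p q::rat. real m \<le> of_rat p \<longrightarrow> real m \<le> of_rat q \<longrightarrow>
          \<bar>ell (of_rat p) \<omega> - ell (of_rat q) \<omega>\<bar> < 1 / real (Suc j))}"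
    have goodS: "good \<in> sets S" unfolding good_def by measurable
    define E where "E = space P - good"
    have ES: "E \<in> sigma_sets (space P) ?U"
      using sets.compl_sets[OF goodS] unfolding E_def setsS spS .
    have cum_all: "C.cumul \<kappa> \<omega> t < \<infinity>" if "\<forall>n::nat. C.cumul \<kappa> \<omega> (real n) < \<infinity>" for \<omega> t
    proof -
      obtain n :: nat where "t \<le> real n" using real_arch_simple by blast
      from order.strict_trans1[OF C.cumul_mono[OF this]] that show ?thesis by blast
    qed
    have ell_zeta: "ell t \<omega> = zeta N lam 0 t \<omega>"
      if "\<omega> \<in> space P" "\<forall>n::nat. C.cumul \<kappa> \<omega> (real n) < \<infinity>" "0 \<le> t" for \<omega> t
      unfolding ell_def using that(3) by (simp add: max_def lik_zeta[OF that(3,1) cum_all[OF that(2)], symmetric])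
    have z_zeta: "z n \<omega> = exp (zeta N lam 0 (real n) \<omega>)"
      if "\<omega> \<in> space P" "\<forall>n::nat. C.cumul \<kappa> \<omega> (real n) < \<infinity>" for \<omega> n
      unfolding z_def using lik_zeta[OF _ that(1) cum_all[OF that(2)], of "real n", symmetric] by simp
    have QE: "emeasure Q E = 0"
    proof -
      have "AE \<omega> in Q. \<forall>n::nat. C.cumul \<kappa> \<omega> (real n) < \<infinity>"
        unfolding AE_all_countable using finQ by simp
      moreover have "AE \<omega> in Q. \<exists>l::real. ((\<lambda>t. zeta N lam 0 t \<omega>) \<longlongrightarrow> l) at_top"
        using ex unfolding zeta_infinity_exists_def .
      ultimately have "AE \<omega> in Q. \<omega> \<notin> E"
        using AE_space
      proof eventually_elim
        case (elim \<omega>)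
        then have w: "\<omega> \<in> space P" using assms(6) by simp
        obtain l where l: "((\<lambda>t. zeta N lam 0 t \<omega>) \<longlongrightarrow> l) at_top" using elim by blast
        have "\<exists>m::nat. \<forall>p q::rat. real m \<le> of_rat p \<longrightarrow> real m \<le> of_rat q \<longrightarrow>
          \<bar>ell (of_rat p) \<omega> - ell (of_rat q) \<omega>\<bar> < 1 / real (Suc j)" for j :: nat
        proof -
          have "eventually (\<lambda>t. dist (zeta N lam 0 t \<omega>) l < 1 / real (Suc j) / 2) at_top"
            using l by (rule tendstoD) simp
          then obtain b where b: "\<And>t. b \<le> t \<Longrightarrow> dist (zeta N lam 0 t \<omega>) l < 1 / real (Suc j) / 2"
            unfolding eventually_at_top_linorder by blast
          obtain m :: nat where m: "b \<le> real m" using real_arch_simple by blast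
          have "\<bar>ell s \<omega> - ell t \<omega>\<bar> < 1 / real (Suc j)" if "real m \<le> s" "real m \<le> t" for s t
          proof -
            have "0 \<le> s" "0 \<le> t" using that by (auto intro: order_trans[OF of_nat_0_le_iff])
            then have "ell s \<omega> = zeta N lam 0 s \<omega>" "ell t \<omega> = zeta N lam 0 t \<omega>"
              using ell_zeta[OF w elim(1)] by auto
            moreover have "dist (zeta N lam 0 s \<omega>) l < 1 / real (Suc j) / 2" "dist (zeta N lam 0 t \<omega>) l < 1 / real (Suc j) / 2"
              using b[of s] b[of t] that m by linarith+
            moreover have "\<bar>x - y\<bar> < d" if "dist x l < d / 2" "dist y l < d / 2" for x y d :: real
              using that unfolding dist_real_def by linarith
            ultimately show ?thesis by metis
          qed
          then show ?thesis by blast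
        qed
        then show ?case unfolding E_def good_def spS using w elim(1) by blast
      qed
      moreover have "E \<in> sets Q" using ES D.sigma_P assms(7) by blast
      ultimately show ?thesis
        using AE_iff_measurable[of E Q "\<lambda>\<omega>. \<omega> \<notin> E"] sets.sets_into_space[of E Q] by (auto simp: Collect_conj_eq Int_absorb1)
    qed
    show ?thesis unfolding has_density_on_def
    proof
      fix A assume "A \<in> sets (filtration_limit (space P) FN)"
      moreover have "(\<Union>t\<in>{0..}. sets (FN t)) = ?U"
      proof
        show "(\<Union>t\<in>{0..}. sets (FN t)) \<subseteq> ?U"
        proof
          fix B assume "B \<in> (\<Union>t\<in>{0..}. sets (FN t))"
          then obtain t where t: "B \<in> sets (FN t)" by blast
          obtain n :: nat where "t \<le> real n" using real_arch_simple by blast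
          then show "B \<in> ?U" using t FN_sub[of t "real n"] by (auto simp: G_def)
        qed
        show "?U \<subseteq> (\<Union>t\<in>{0..}. sets (FN t))" by (auto simp: G_def intro!: bexI[of _ "real _"])
      qed
      ultimately have A: "A \<in> sigma_sets (space P) ?U"
        unfolding filtration_limit_def using setsS by (simp add: S_def)
      show "emeasure Q A = (\<integral>\<^sup>+\<omega>\<in>A. exp_zeta_infinity N lam \<omega> \<partial>P)"
      proof (rule D.limit_density[OF ES QE _ _ A])
        fix \<omega> assume "\<omega> \<in> space P - E"
        then have w: "\<omega> \<in> space P" and f: "\<forall>n::nat. C.cumul \<kappa> \<omega> (real n) < \<infinity>"
          and c: "\<And>j::nat. \<exists>m::nat. \<forall>p q::rat. real m \<le> of_rat p \<longrightarrow> real m \<le> of_rat q \<longrightarrow>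
            \<bar>ell (of_rat p) \<omega> - ell (of_rat q) \<omega>\<bar> < 1 / real (Suc j)"
          unfolding E_def good_def by blast+
        have "\<exists>l. ((\<lambda>t. zeta N lam 0 t \<omega>) \<longlongrightarrow> l) at_top"
        proof (rule rational_cauchy_imp_convergent)
          show "((\<lambda>t. zeta N lam 0 t \<omega>) \<longlongrightarrow> zeta N lam 0 t \<omega>) (at_right t)" if t: "0 \<le> t" for t
          proof (rule counting_process.zeta_right_continuous[OF CT[of "t + 1"] w pred pos[OF w] t])
            show "C.cumul (C.intensity lam) \<omega> (t + 1) < \<infinity>" using cum_all[OF f] unfolding \<kappa>_def .
          qed (use t in auto)
          fix e :: real assume "0 < e"
          then obtain j where j: "inverse (real (Suc j)) < e" using reals_Archimedean by blast
          obtain m :: nat where m: "\<And>p q::rat. real m \<le> of_rat p \<Longrightarrow> real m \<le> of_rat q \<Longrightarrow>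
            \<bar>ell (of_rat p) \<omega> - ell (of_rat q) \<omega>\<bar> < 1 / real (Suc j)" using c[of j] by blast
          have "\<bar>zeta N lam 0 (of_rat p) \<omega> - zeta N lam 0 (of_rat q) \<omega>\<bar> < e"
            if pq: "real m \<le> of_rat p" "real m \<le> of_rat q" for p q :: rat
          proof -
            have "0 \<le> (of_rat p :: real)" "0 \<le> (of_rat q :: real)"
              using pq by (meson of_nat_0_le_iff order_trans)+
            then show ?thesis using m[OF pq] j ell_zeta[OF w f] by (auto simp: inverse_eq_divide)
          qed
          then show "\<exists>m::nat. \<forall>p q::rat. real m \<le> of_rat p \<longrightarrow> real m \<le> of_rat q \<longrightarrow>
            \<bar>zeta N lam 0 (of_rat p) \<omega> - zeta N lam 0 (of_rat q) \<omega>\<bar> < e" by blast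
        qed
        then obtain l where l: "((\<lambda>t. zeta N lam 0 t \<omega>) \<longlongrightarrow> l) at_top" by blast
        then have el: "((\<lambda>t. exp (zeta N lam 0 t \<omega>)) \<longlongrightarrow> exp l) at_top" by (rule tendsto_exp)
        have "(\<lambda>n. exp (zeta N lam 0 (real n) \<omega>)) \<longlonglongrightarrow> exp l"
          by (rule filterlim_compose[OF el filterlim_real_sequentially])
        then have "(\<lambda>n. z n \<omega>) \<longlonglongrightarrow> exp l" unfolding z_zeta[OF w f] .
        moreover have "exp_zeta_infinity N lam \<omega> = ennreal (exp l)"
          unfolding exp_zeta_infinity_def
          by (rule lim_imp_Liminf) (auto intro: tendsto_ennrealI el)
        ultimately show "\<exists>l. (\<lambda>n. z n \<omega>) \<longlonglongrightarrow> l \<and> exp_zeta_infinity N lam \<omega> = ennreal l" by blast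
      next
        have "AE \<omega> in P. \<forall>n::nat. C.cumul \<kappa> \<omega> (real n) < \<infinity>"
          unfolding AE_all_countable using finP by simp
        then show "AE \<omega> in P. \<omega> \<in> E \<longrightarrow> exp_zeta_infinity N lam \<omega> \<le> liminf (\<lambda>n. ennreal (z n \<omega>))"
          using AE_space
        proof eventually_elim
          case (elim \<omega>)
          have "exp_zeta_infinity N lam \<omega> \<le> liminf (\<lambda>n. ennreal (exp (zeta N lam 0 (real n) \<omega>)))"
            unfolding exp_zeta_infinity_def by (rule Liminf_at_top_le_liminf)
          then show ?case unfolding z_zeta[OF elim(2,1)] by simp
        qed
      qed
    qed
  qed
  show ?thesis using finite_horizon infinite_horizon by blast
qed

end
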